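(* Consider the retreat stage of the BVR differential game described in the context. Assume that $B_L$ moves with constant heading $\theta_B$, that $\mathbf{x}\in\mathcal{R}_D$, and that $\theta_B\in[\underline{\theta}+\lambda_A,\bar{\theta}+\lambda_A]$ (with $\underline{\theta},\bar\theta$ defined in the context). Then the state-feedback optimal strategies of $A$ and $D$ in the relative coordinate frame are given, respectively, by $$\cos\chi^*=\frac{x_m-x_A'}{\sqrt{(x_m-x_A')^2+y^{*2}}},\qquad \sin\chi^*=\frac{y^*}{\sqrt{(x_m-x_A')^2+y^{*2}}},$$ $$\cos\psi^*=\frac{x_m}{\sqrt{x_m^2+y^{*2}}},\qquad \sin\psi^*=\frac{y^*}{\sqrt{x_m^2+y^{*2}}},$$ where $y^*$ is the solution of the quartic equation $$c_4y^4+2c_3y^3+c_2y^2+2c_1y+c_0=0$$ which minimizes the cost $$J=\big(d_m+\alpha\sqrt{x_m^2+y^2}\big)^2+(y-y_m)^2-2(y-y_m)\big(d_m+\alpha\sqrt{x_m^2+y^2}\big)\cos\varphi.$$ The coefficients are $$c_4=(2\alpha\cos\varphi)^2-(1+\alpha^2)^2,$$ $$c_3=y_B'+\alpha^2[(1-2\cos^2\varphi)y_m-d_m\cos\varphi],$$ $$c_2=\alpha^2[(d_m+y_m\cos\varphi)^2+(2x_m\cos\varphi)^2]-y_B'^2-x_m^2(1+\alpha^2)^2,$$ $$c_1=y_B'x_m^2+\alpha^2x_m^2y_m\sin^2\varphi,$$ $$c_0=(\alpha x_m^2\cos\varphi)^2-x_m^2y_B'^2,$$ where $\varphi=\theta_B-\frac{\pi}{2}-\lambda_A$,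 $d_m=\frac{x_m-x_B'}{\sin\varphi}$, and $y_m=y_B'-d_m\cos\varphi$.
   Context: Retreat-stage BVR (Beyond Visual Range) differential game (non-cooperative asset). In the plane, an asset $B_L=(x_B,y_B)$ flies with constant heading $\theta_B$ (known to all) and constant speed $v_B$; an attacking missile $A=(x_A,y_A)$ with speed $v_A$ pursues $B_L$, and a defending missile $D=(x_D,y_D)$ with speed $v_D$ tries to intercept $A$. The missiles have equal speed $v_A=v_D$, and $\alpha=v_B/v_A<1$. Dynamics: $\dot x_B=v_B\cos\theta_B$, $\dot y_B=v_B\sin\theta_B$, $\dot x_A=v_A\cos\chi$, $\dot y_A=v_A\sin\chi$, $\dot x_D=v_D\cos\psi$, $\dot y_D=v_D\sin\psi$; the headings $\chi,\psi\in[-\pi,\pi)$ are the controls of $A$ and $D$ respectively. The state is $\mathbf{x}=(x_B,y_B,x_A,y_A,x_D,y_D)\in\mathbb{R}^6$. The game terminates either when $A$ and $B_L$ coincide ($A$ captures $B_L$) or when $D$ and $A$ coincide ($D$ intercepts $A$). $\mathcal{R}_D\subset\mathbb{R}^6$ denotes the Defender's winning subspace: the states for which, under optimal play, $A$ is intercepted by $D$ before $A$ can capture $B_L$. On $\mathcal{R}_D$ the game terminates at the interception time $t_f$, with terminal payoff $\sqrt{(x_A(t_f)-x_B(t_f))^2+(y_A(t_f)-y_B(t_f))^2}$, minimized by $A$ and maximized by $D$ over state-feedback strategies; "optimal" means saddle-point strategies of this zero-sum game. Relative coordinate frame: the translated and rotated frame in which $D=(0,0)$, $A=(x_A',0)$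 with $x_A'=\sqrt{(x_A-x_D)^2+(y_A-y_D)^2}$, and $B_L=(x_B',y_B')$ with $x_B'=d_B\cos(\lambda_B-\lambda_A)$, $y_B'=d_B\sin(\lambda_B-\lambda_A)$, where $d_B=\sqrt{(x_B-x_D)^2+(y_B-y_D)^2}$ and $\lambda_B,\lambda_A$ are the polar angles of the vectors from $D$ to $B_L$ and from $D$ to $A$ ($\lambda_B=\arctan\frac{y_B-y_D}{x_B-x_D}$, $\lambda_A=\arctan\frac{y_A-y_D}{x_A-x_D}$, in the correct quadrant). Let $x_m=\frac12x_A'$. The heading $\theta_B$ is measured in the original (fixed) frame, modulo $2\pi$. The angles $\underline\theta,\bar\theta$ are $\underline{\theta}=\arctan\left(\frac{\underline{y}-y_B'}{x_m-x_B'}\right)$ and $\bar{\theta}=\arctan\left(\frac{\bar{y}-y_B'}{x_m-x_B'}\right)$, where $\arctan\left(\frac{y-y_B'}{x_m-x_B'}\right)$ denotes the polar angle, taken in $[-\pi/2,3\pi/2)$, of the vector $(x_m-x_B',y-y_B')$, and $$\underline{y}=\frac{y_B'+\sqrt{S}}{1-\alpha^2},\quad \bar{y}=\frac{y_B'-\sqrt{S}}{1-\alpha^2},\quad S=\alpha^2[(x_B'-x_A')^2+y_B'^2]-[(1-\alpha^2)x_m-x_B'+\alpha^2x_A']^2.$$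
   Formalization: Optimality of A's strategy is claimed only against defender deviations that keep the state in R_D and reach A with separation shrinking at least linearly; with equal speeds a tangential merger by D can beat it. S ≥ 0 is assumed, and the formulas are used at every state with A ≠ D. *)

theory Defs
  imports "HOL-Analysis.Analysis"
begin

section \<open>Dynamics\<close>

text \<open>The plane is identified with the complex numbers, so a state in six real coordinates is a
  triple (asset, attacker, defender) and a unit vector with heading h is \<^term>\<open>cis h\<close>.\<close>

type_synonym state = "complex \<times> complex \<times> complex"

definition posB :: "state \<Rightarrow> complex" where "posB z = fst z"
definition posA :: "state \<Rightarrow> complex" where "posA z = fst (snd z)"
definition posD :: "state \<Rightarrow> complex" where "posD z = snd (snd z)"

definition velocity :: "real \<Rightarrow> real \<Rightarrow> real \<Rightarrow> real \<Rightarrow> real \<Rightarrow> real \<Rightarrow> state" where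
  "velocity vB vA vD \<theta>B chi psi =
     (of_real vB * cis \<theta>B, of_real vA * cis chi, of_real vD * cis psi)"

text \<open>Caratheodory solutions on an initial segment I of the half-line, for the heading histories
  chi and psi. Integrability of the right-hand side is part of the definition.\<close>

definition trajectory ::
  "real \<Rightarrow> real \<Rightarrow> real \<Rightarrow> real \<Rightarrow> (real \<Rightarrow> real) \<Rightarrow> (real \<Rightarrow> real) \<Rightarrow> state \<Rightarrow> (real \<Rightarrow> state) \<Rightarrow> real set \<Rightarrow> bool"
  where
  "trajectory vB vA vD \<theta>B chi psi z0 x I \<longleftrightarrow>
     (\<forall>t\<in>I. ((\<lambda>s. velocity vB vA vD \<theta>B (chi s) (psi s)) has_integral (x t - z0)) {0..t})"

definition terminal :: "state \<Rightarrow> bool" where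
  "terminal z \<longleftrightarrow> posA z = posB z \<or> posA z = posD z"

section \<open>Winning region of the defender\<close>

definition controls :: "(real \<Rightarrow> real) set" where
  "controls = {u \<in> borel_measurable borel. \<forall>t. -pi \<le> u t \<and> u t < pi}"

definition nonanticipative :: "((real \<Rightarrow> real) \<Rightarrow> (real \<Rightarrow> real)) \<Rightarrow> bool" where
  "nonanticipative \<beta> \<longleftrightarrow>
     (\<forall>chi\<in>controls. \<beta> chi \<in> controls) \<and>
     (\<forall>chi\<in>controls. \<forall>chi'\<in>controls. \<forall>t\<ge>0.
        (\<forall>s\<in>{0..t}. chi s = chi' s) \<longrightarrow> (\<forall>s\<in>{0..t}. \<beta> chi s = \<beta> chi' s))"

text \<open>The defender wins the game of kind when it can guarantee that every arrival of the attacker at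
  the asset is strictly preceded by an interception. (Trajectories are continued past the
  interception only for the sake of the definition.) An attacker that runs away for ever does not
  capture the asset, hence does not win. Strategies for this game are nonanticipative, so that
  every strategy has a trajectory against every control of the attacker; with state feedback the
  defender could "win" by choosing a law for which no solution exists.\<close>

definition defender_region :: "real \<Rightarrow> real \<Rightarrow> real \<Rightarrow> real \<Rightarrow> state set" where
  "defender_region vB vA vD \<theta>B =
     {z. posA z \<noteq> posD z \<and>
         (\<exists>\<beta>. nonanticipative \<beta> \<and>
            (\<forall>chi\<in>controls. \<forall>x. trajectory vB vA vD \<theta>B chi (\<beta> chi) z x {0..} \<longrightarrow>
               (\<forall>t\<ge>0. posA (x t) = posB (x t) \<longrightarrow> (\<exists>s\<in>{0..<t}. posA (x s) = posD (x s)))))}"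

section \<open>State-feedback strategies and saddle points\<close>

text \<open>Headings are measured in the fixed frame. No regularity of the feedback is required; a feedback
  pair is judged on the trajectories it admits.\<close>

definition feedback :: "(state \<Rightarrow> real) set" where
  "feedback = {\<sigma>. \<forall>z. -pi \<le> \<sigma> z \<and> \<sigma> z < pi}"

definition play ::
  "real \<Rightarrow> real \<Rightarrow> real \<Rightarrow> real \<Rightarrow> (state \<Rightarrow> real) \<Rightarrow> (state \<Rightarrow> real) \<Rightarrow> state \<Rightarrow> (real \<Rightarrow> state) \<Rightarrow> real \<Rightarrow> bool"
  where
  "play vB vA vD \<theta>B chi psi z0 x tf \<longleftrightarrow>
     0 \<le> tf \<and> trajectory vB vA vD \<theta>B (\<lambda>t. chi (x t)) (\<lambda>t. psi (x t)) z0 x {0..tf} \<and>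
     terminal (x tf) \<and> (\<forall>t\<in>{0..<tf}. \<not> terminal (x t))"

definition payoff :: "state \<Rightarrow> real" where
  "payoff z = dist (posA z) (posB z)"

text \<open>A play of the game of degree: it stays in the region R until the interception, and the
  interception is a genuine collision, i.e. the separation of the missiles vanishes at a nonzero
  rate (the terminal set is not reached tangentially).\<close>

definition regular_interception :: "state set \<Rightarrow> (real \<Rightarrow> state) \<Rightarrow> real \<Rightarrow> bool" where
  "regular_interception R x tf \<longleftrightarrow>
     posA (x tf) = posD (x tf) \<and> (\<forall>t\<in>{0..<tf}. x t \<in> R) \<and>
     (\<exists>c>0. \<forall>t\<in>{0..tf}. c * (tf - t) \<le> dist (posA (x t)) (posD (x t)))"

text \<open>The attacker minimizes and the defender maximizes. The attacker may deviate without any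
  restriction; plays ending in capture count with their terminal distance 0. Deviations of the
  defender are restricted to regular interceptions. A defender that leaves R has lost
  the game of degree, and the attacker then changes to its capturing strategy. Tangential contact has
  to be excluded because with equal speeds a defender can move abreast of the attacker and merge with
  it: an attacker that heads for a point of the current bisector is then turned and caught early, as
  the man by the lion, at a larger distance from the asset.\<close>

definition saddle_point ::
  "real \<Rightarrow> real \<Rightarrow> real \<Rightarrow> real \<Rightarrow> (state \<Rightarrow> real) \<Rightarrow> (state \<Rightarrow> real) \<Rightarrow> state \<Rightarrow> bool" where
  "saddle_point vB vA vD \<theta>B chi psi z0 \<longleftrightarrow>
     chi \<in> feedback \<and> psi \<in> feedback \<and>
     (\<exists>x tf. play vB vA vD \<theta>B chi psi z0 x tf \<and>
        regular_interception (defender_region vB vA vD \<theta>B) x tf \<and>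
        (\<forall>chi'\<in>feedback. \<forall>x' tf'. play vB vA vD \<theta>B chi' psi z0 x' tf' \<longrightarrow>
           payoff (x tf) \<le> payoff (x' tf')) \<and>
        (\<forall>psi'\<in>feedback. \<forall>x' tf'. play vB vA vD \<theta>B chi psi' z0 x' tf' \<longrightarrow>
           regular_interception (defender_region vB vA vD \<theta>B) x' tf' \<longrightarrow>
           payoff (x' tf') \<le> payoff (x tf)))"

section \<open>Relative frame\<close>

definition d_B :: "state \<Rightarrow> real" where "d_B z = cmod (posB z - posD z)"
definition lam_A :: "state \<Rightarrow> real" where "lam_A z = Arg (posA z - posD z)"
definition lam_B :: "state \<Rightarrow> real" where "lam_B z = Arg (posB z - posD z)"

definition xA' :: "state \<Rightarrow> real" where "xA' z = cmod (posA z - posD z)"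
definition xB' :: "state \<Rightarrow> real" where "xB' z = d_B z * cos (lam_B z - lam_A z)"
definition yB' :: "state \<Rightarrow> real" where "yB' z = d_B z * sin (lam_B z - lam_A z)"
definition x_m :: "state \<Rightarrow> real" where "x_m z = xA' z / 2"

section \<open>Range of asset headings\<close>

definition S_disc :: "real \<Rightarrow> state \<Rightarrow> real" where
  "S_disc \<alpha> z = \<alpha>^2 * ((xB' z - xA' z)^2 + (yB' z)^2)
     - ((1 - \<alpha>^2) * x_m z - xB' z + \<alpha>^2 * xA' z)^2"

definition y_under :: "real \<Rightarrow> state \<Rightarrow> real" where
  "y_under \<alpha> z = (yB' z + sqrt (S_disc \<alpha> z)) / (1 - \<alpha>^2)"

definition y_over :: "real \<Rightarrow> state \<Rightarrow> real" where
  "y_over \<alpha> z = (yB' z - sqrt (S_disc \<alpha> z)) / (1 - \<alpha>^2)"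

text \<open>Polar angle with values in the half-open interval from -pi/2 to 3pi/2, whereas \<^term>\<open>Arg\<close> has
  values in the one from -pi to pi.\<close>

definition polar_angle :: "complex \<Rightarrow> real" where
  "polar_angle w = (if Arg w < - pi / 2 then Arg w + 2 * pi else Arg w)"

definition theta_under :: "real \<Rightarrow> state \<Rightarrow> real" where
  "theta_under \<alpha> z = polar_angle (Complex (x_m z - xB' z) (y_under \<alpha> z - yB' z))"

definition theta_over :: "real \<Rightarrow> state \<Rightarrow> real" where
  "theta_over \<alpha> z = polar_angle (Complex (x_m z - xB' z) (y_over \<alpha> z - yB' z))"

section \<open>Cost, quartic equation and aim point\<close>

text \<open>If \<^term>\<open>sin (phi \<theta>B z) = 0\<close>, i.e. if the asset moves parallel to the bisector of the
  missiles, then \<^term>\<open>d_m \<theta>B z\<close> is 0 because division by 0 gives 0. The coefficients below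
  then have the values obtained by continuity, and the cost differs from the squared terminal distance
  only by a constant, so the minimizers are still the intended ones.\<close>

definition phi :: "real \<Rightarrow> state \<Rightarrow> real" where
  "phi \<theta>B z = \<theta>B - pi / 2 - lam_A z"

definition d_m :: "real \<Rightarrow> state \<Rightarrow> real" where
  "d_m \<theta>B z = (x_m z - xB' z) / sin (phi \<theta>B z)"

definition y_m :: "real \<Rightarrow> state \<Rightarrow> real" where
  "y_m \<theta>B z = yB' z - d_m \<theta>B z * cos (phi \<theta>B z)"

definition cost_J :: "real \<Rightarrow> real \<Rightarrow> state \<Rightarrow> real \<Rightarrow> real" where
  "cost_J \<alpha> \<theta>B z y =
     (d_m \<theta>B z + \<alpha> * sqrt ((x_m z)^2 + y^2))^2 + (y - y_m \<theta>B z)^2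
     - 2 * (y - y_m \<theta>B z) * (d_m \<theta>B z + \<alpha> * sqrt ((x_m z)^2 + y^2)) * cos (phi \<theta>B z)"

definition c4 :: "real \<Rightarrow> real \<Rightarrow> state \<Rightarrow> real" where
  "c4 \<alpha> \<theta>B z = (2 * \<alpha> * cos (phi \<theta>B z))^2 - (1 + \<alpha>^2)^2"

definition c3 :: "real \<Rightarrow> real \<Rightarrow> state \<Rightarrow> real" where
  "c3 \<alpha> \<theta>B z = yB' z
     + \<alpha>^2 * ((1 - 2 * (cos (phi \<theta>B z))^2) * y_m \<theta>B z - d_m \<theta>B z * cos (phi \<theta>B z))"

definition c2 :: "real \<Rightarrow> real \<Rightarrow> state \<Rightarrow> real" where
  "c2 \<alpha> \<theta>B z =
     \<alpha>^2 * ((d_m \<theta>B z + y_m \<theta>B z * cos (phi \<theta>B z))^2 + (2 * x_m z * cos (phi \<theta>B z))^2)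
     - (yB' z)^2 - (x_m z)^2 * (1 + \<alpha>^2)^2"

definition c1 :: "real \<Rightarrow> real \<Rightarrow> state \<Rightarrow> real" where
  "c1 \<alpha> \<theta>B z =
     yB' z * (x_m z)^2 + \<alpha>^2 * (x_m z)^2 * y_m \<theta>B z * (sin (phi \<theta>B z))^2"

definition c0 :: "real \<Rightarrow> real \<Rightarrow> state \<Rightarrow> real" where
  "c0 \<alpha> \<theta>B z = (\<alpha> * (x_m z)^2 * cos (phi \<theta>B z))^2 - (x_m z)^2 * (yB' z)^2"

definition quartic_root :: "real \<Rightarrow> real \<Rightarrow> state \<Rightarrow> real \<Rightarrow> bool" where
  "quartic_root \<alpha> \<theta>B z y \<longleftrightarrow>
     c4 \<alpha> \<theta>B z * y^4 + 2 * c3 \<alpha> \<theta>B z * y^3 + c2 \<alpha> \<theta>B z * y^2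
       + 2 * c1 \<alpha> \<theta>B z * y + c0 \<alpha> \<theta>B z = 0"

definition y_star :: "real \<Rightarrow> real \<Rightarrow> state \<Rightarrow> real" where
  "y_star \<alpha> \<theta>B z = (ARG_MIN (cost_J \<alpha> \<theta>B z) y. quartic_root \<alpha> \<theta>B z y)"

end

theory Submission
  imports Defs
begin

text \<open>Write A, D, B for the positions and r for the distance of a point P of the bisector of A and D from
  both missiles. Flying straight to P, the attacker misses the asset by the vector w = P - B - \<alpha> r u,
  where u is the unit vector of the asset's heading, and the value of the game is the minimum of |w| over
  the bisector. The cost J is its square up to a constant, and the quartic is the squared stationarity
  condition.

  The envelope theorem gives the derivative of the value: it is a combination of the losses that the two
  missiles incur by not heading for the optimal P, and the signs of the coefficients are right as long as
  the first point at which the attacker could capture the undefended asset is strictly nearer to the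
  defender. This condition is necessary for a state to belong to the winning region of the defender. It is
  preserved by the defender's law, because the value vanishes where it is violated. Hence neither missile
  can gain by deviating. The derivative is used almost everywhere in time, as the controls are
  only measurable and the minimizer may jump.\<close>

section \<open>Lipschitz functions and indefinite integrals\<close>

text \<open>The value is a minimum over aim points, so it need not be differentiable along a
  trajectory. But the miss for the parameter that is best at time t, kept frozen, is a majorant of
  the value that touches it at t and, for almost every t, is differentiable there. Its slope bounds
  the increments of the value on both sides of t, so such majorants prove monotonicity in either
  direction. The two guarantees are not symmetric at the end of the game. For the defender it is
  enough that the value is at most the miss of the midpoint, which tends to the payoff. The attacker
  needs the opposite comparison, which can fail if the missiles merge while the best aim point stays
  far away. This is where the positive collision rate of a regular interception enters, through a
  logarithmic Lyapunov function. The range of headings yields that the velocity of the asset has a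
  component pointing from the attacker's side of the bisector to the defender's side. This makes the
  minimizer unique and keeps the same aim point optimal while both missiles fly to it, so that the
  feedback laws generate the straight play.\<close>

lemma antimono_from_right_Dini:
  fixes F :: "real \<Rightarrow> real"
  assumes ab: "a \<le> b" and lip: "K-lipschitz_on {a..b} F" and N: "negligible N"
    and dini: "\<And>t e. t \<in> {a<..<b} - N \<Longrightarrow> e > 0 \<Longrightarrow>
        \<exists>d>0. \<forall>h. 0 < h \<and> h < d \<and> t + h \<le> b \<longrightarrow> F (t + h) \<le> F t + e * h"
  shows "F b \<le> F a"
proof -
  have K0: "K \<ge> 0" using lip lipschitz_on_nonneg by blast
  have cont: "continuous_on {a..b} F" using lip by (rule lipschitz_on_continuous_on)
  have main: "F b \<le> F a + e * (b - a) + K * e" if e: "e > 0" for e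
  proof -
    \<comment> \<open>The bad times are covered by an open set \<open>U\<close> of measure below
      \<open>e\<close>, on which the Lipschitz bound costs at most \<open>K * e\<close> in all. The
      left endpoint is included because the Dini bound is assumed in the open interval only.\<close>
    have "insert a N \<in> lmeasurable"
      using N by (simp add: negligible_imp_measurable)
    then obtain U where U0: "open U" "insert a N \<subseteq> U" "U - insert a N \<in> lmeasurable"
        "emeasure lebesgue (U - insert a N) < ennreal e"
      using sets_lebesgue_outer_open[OF fmeasurableD[OF \<open>insert a N \<in> lmeasurable\<close>] e] by blast
    have mN: "measure lebesgue (insert a N) = 0"
      using N by (intro negligible_imp_measure0) simp
    have "U = (U - insert a N) \<union> insert a N" using U0 by auto
    hence U3: "U \<in> lmeasurable"
      using U0(3) \<open>insert a N \<in> lmeasurable\<close> by (metis fmeasurable.Un)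
    have "measure lebesgue (U - insert a N) < e"
      using U0(3,4) e by (simp add: emeasure_eq_measure2 ennreal_less_iff)
    moreover have "measure lebesgue (U - insert a N) = measure lebesgue U"
      using N by (intro measure_negligible_symdiff[symmetric] measure_Diff_null_set) (auto simp: negligible_iff_null_sets U3 fmeasurableD)
    ultimately have U: "open U" "insert a N \<subseteq> U" "U \<in> lmeasurable" "measure lebesgue U < measure lebesgue (insert a N) + e"
      using U0 U3 mN by auto
    define \<mu> where "\<mu> t = measure lebesgue (U \<inter> {a..t})" for t
    have ms: "U \<inter> {a..t} \<in> lmeasurable" for t
      using U(3) by (simp add: fmeasurable_Int_fmeasurable lmeasurable_cbox)
    have mono: "\<mu> s \<le> \<mu> t" if "s \<le> t" for s t
      unfolding \<mu>_def by (rule measure_mono_fmeasurable) (use that ms in \<open>auto simp: fmeasurableD\<close>)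
    have \<mu>b: "\<mu> t \<le> e" for t
    proof -
      have "\<mu> t \<le> measure lebesgue U"
        unfolding \<mu>_def by (rule measure_mono_fmeasurable) (use U ms in \<open>auto simp: fmeasurableD\<close>)
      thus ?thesis using U(4) mN by simp
    qed
    \<comment> \<open>Continuation argument: outside \<open>U\<close> the increase is paid by
      \<open>e\<close> times the step, inside \<open>U\<close> by \<open>K\<close> times the length
      of \<open>U\<close> passed so far, which is \<open>\<mu>\<close>. The supremum of the good
      times then cannot lie below \<open>b\<close>.\<close>
    define S where "S = {t \<in> {a..b}. \<forall>s\<in>{a..t}. F s \<le> F a + e * (s - a) + K * \<mu> s}"
    have aS: "a \<in> S" using ab K0 unfolding S_def \<mu>_def by (auto intro!: mult_nonneg_nonneg)
    have bdd: "bdd_above S" unfolding S_def by (auto intro: bdd_aboveI[of _ b])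
    define c where "c = Sup S"
    have cab: "c \<in> {a..b}"
    proof -
      have "a \<le> c" unfolding c_def by (rule cSup_upper[OF aS bdd])
      moreover have "c \<le> b" unfolding c_def by (rule cSup_least) (use aS in \<open>auto simp: S_def\<close>)
      ultimately show ?thesis by simp
    qed
    have below: "F s \<le> F a + e * (s - a) + K * \<mu> s" if "a \<le> s" "s < c" for s
    proof -
      have "S \<noteq> {}" using aS by blast
      from less_cSup_iff[OF this bdd] that(2) obtain t where "t \<in> S" "s < t" unfolding c_def by metis
      thus ?thesis using that by (auto simp: S_def)
    qed
    have atc: "F c \<le> F a + e * (c - a) + K * \<mu> c"
    proof (cases "c = a")
      case True thus ?thesis using aS by (auto simp: S_def)
    next
      case False
      hence ac: "a < c" using cab by auto
      have "((\<lambda>s. F s - e * (s - a)) \<longlongrightarrow> F c - e * (c - a)) (at c within {a..<c})"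
      proof (intro tendsto_intros)
        have "(F \<longlongrightarrow> F c) (at c within {a..b})" using cont cab by (auto simp: continuous_on_def)
        thus "(F \<longlongrightarrow> F c) (at c within {a..<c})" by (rule tendsto_within_subset) (use cab in auto)
      qed
      moreover have "\<forall>\<^sub>F s in at c within {a..<c}. F s - e * (s - a) \<le> F a + K * \<mu> c"
        unfolding eventually_at_filter
      proof (rule always_eventually, intro allI impI)
        fix s assume "s \<noteq> c" "s \<in> {a..<c}"
        hence "F s \<le> F a + e * (s - a) + K * \<mu> s" "\<mu> s \<le> \<mu> c" using below mono by auto
        thus "F s - e * (s - a) \<le> F a + K * \<mu> c" using mult_left_mono[OF _ K0, of "\<mu> s" "\<mu> c"] by linarith
      qed
      moreover have "at c within {a..<c} \<noteq> bot" using ac by (simp add: at_within_eq_bot_iff)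
      ultimately have "F c - e * (c - a) \<le> F a + K * \<mu> c"
        by (rule tendsto_upperbound)
      thus ?thesis by simp
    qed
    have "c = b"
    proof (rule ccontr)
      assume "c \<noteq> b"
      hence cb: "c < b" using cab by auto
      have "\<exists>d>0. \<forall>h. 0 < h \<and> h < d \<and> c + h \<le> b \<longrightarrow> F (c + h) \<le> F c + e * h + K * (\<mu> (c + h) - \<mu> c)"
      proof (cases "c \<in> U")
        case False
        hence "c \<noteq> a" "c \<notin> N" using U(2) by auto
        hence "c \<in> {a<..<b} - N" using cab cb by auto
        from dini[OF this e] obtain d where d: "d > 0"
          "\<And>h. 0 < h \<and> h < d \<and> c + h \<le> b \<Longrightarrow> F (c + h) \<le> F c + e * h" by blast
        show ?thesis
        proof (intro exI[of _ d] conjI allI impI d(1))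
          fix h assume h: "0 < h \<and> h < d \<and> c + h \<le> b"
          have "0 \<le> K * (\<mu> (c + h) - \<mu> c)" using K0 mono[of c "c+h"] h by simp
          thus "F (c + h) \<le> F c + e * h + K * (\<mu> (c + h) - \<mu> c)" using d(2)[OF h] by linarith
        qed
      next
        case True
        then obtain d where d: "d > 0" "ball c d \<subseteq> U" using U(1) openE by blast
        show ?thesis
        proof (intro exI[of _ d] conjI allI impI d(1))
          fix h assume h: "0 < h \<and> h < d \<and> c + h \<le> b"
          have "{c..c+h} \<subseteq> ball c d" using h by (auto simp: dist_real_def)
          hence sub: "{c..c+h} \<subseteq> U" using d by auto
          \<comment> \<open>A short step from a point of \<open>U\<close> stays in \<open>U\<close>,
            so \<open>\<mu>\<close> grows by exactly the step length and pays for the Lipschitz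
            bound.\<close>
          have eq: "U \<inter> {a..c + h} = (U \<inter> {a..c}) \<union> {c<..c+h}" using sub h cab by auto
          have disj: "(U \<inter> {a..c}) \<inter> {c<..c+h} = {}" by auto
          have "measure lebesgue {c<..c+h} = h" using h by simp
          moreover have "{c<..c+h} \<in> lmeasurable"
            by (rule fmeasurableI2[of "{c..c+h}"]) auto
          ultimately have "\<mu> (c + h) = \<mu> c + h"
            unfolding \<mu>_def eq by (subst measure_Un3) (use ms disj in auto)
          hence m: "\<mu> (c + h) - \<mu> c = h" by simp
          have "\<bar>F (c + h) - F c\<bar> \<le> K * h"
            using lipschitz_on_normD[OF lip, of "c+h" c] h cab by auto
          thus "F (c + h) \<le> F c + e * h + K * (\<mu> (c + h) - \<mu> c)" 
          proof -
            have "0 < e * h" using e h by simp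
            with \<open>\<bar>F (c + h) - F c\<bar> \<le> K * h\<close> show ?thesis unfolding m by linarith
          qed
        qed
      qed
      then obtain d where d: "d > 0" "\<And>h. 0 < h \<Longrightarrow> h < d \<Longrightarrow> c + h \<le> b \<Longrightarrow> F (c + h) \<le> F c + e * h + K * (\<mu> (c + h) - \<mu> c)"
        by blast
      define h where "h = min (d/2) (b - c)"
      have h: "0 < h" "h < d" "c + h \<le> b" using d cb by (auto simp: h_def)
      have "c + h \<in> S"
        unfolding S_def
      proof (intro CollectI conjI ballI)
        show "c + h \<in> {a..b}" using h cab by auto
        fix s assume s: "s \<in> {a..c+h}"
        consider "s < c" | "s = c" | "s > c" by linarith
        thus "F s \<le> F a + e * (s - a) + K * \<mu> s"
        proof cases
          case 1 thus ?thesis using below s by auto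
        next
          case 2 thus ?thesis using atc by auto
        next
          case 3
          have "F (c + (s - c)) \<le> F c + e * (s - c) + K * (\<mu> (c + (s - c)) - \<mu> c)"
            by (rule d(2)) (use 3 s h in auto)
          thus ?thesis using atc by (simp add: algebra_simps)
        qed
      qed
      hence "c + h \<le> c" unfolding c_def using bdd cSup_upper by blast
      thus False using h by auto
    qed
    thus ?thesis using atc \<mu>b[of b] mult_left_mono[OF \<mu>b[of b] K0] by simp
  qed
  show ?thesis
  proof (rule field_le_epsilon)
    fix \<epsilon> :: real assume \<epsilon>: "\<epsilon> > 0"
    let ?e = "\<epsilon> / (b - a + K + 1)"
    have p: "b - a + K + 1 > 0" using ab K0 by simp
    have "F b \<le> F a + ?e * (b - a) + K * ?e" by (rule main) (use p \<epsilon> in simp)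
    also have "\<dots> = F a + ?e * (b - a + K)" by (simp only: algebra_simps)
    also have "\<dots> \<le> F a + ?e * (b - a + K + 1)" using p \<epsilon> by (intro add_left_mono mult_left_mono) auto
    also have "\<dots> = F a + \<epsilon>" using p by simp
    finally show "F b \<le> F a + \<epsilon>" .
  qed
qed

lemma DERIV_nonpos_right:
  fixes f :: "real \<Rightarrow> real"
  assumes "(f has_real_derivative D) (at t)" "D \<le> 0" "e > 0"
  shows "\<exists>d>0. \<forall>h. 0 < h \<and> h < d \<longrightarrow> f (t + h) \<le> f t + e * h"
proof -
  have "((\<lambda>h. (f (t + h) - f t) / h) \<longlongrightarrow> D) (at 0)"
    using assms(1) by (simp add: DERIV_def)
  hence "\<forall>\<^sub>F h in at 0. (f (t + h) - f t) / h < D + e"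
    using assms(3) by (intro order_tendstoD) auto
  then obtain d where "d > 0" and d: "\<And>h. h \<noteq> 0 \<Longrightarrow> dist h 0 < d \<Longrightarrow> (f (t + h) - f t) / h < D + e"
    unfolding eventually_at by auto
  have "f (t + h) \<le> f t + e * h" if "0 < h" "h < d" for h
  proof -
    have "(f (t + h) - f t) / h < D + e" using d that by auto
    also have "\<dots> \<le> e" using assms by simp
    finally show ?thesis using that by (simp add: field_simps)
  qed
  thus ?thesis using \<open>d > 0\<close> by blast
qed

text \<open>A function that lies below \<open>\<phi>\<close> and touches it at t has forward
  increments at t no larger than those of \<open>\<phi>\<close>. In the application \<open>F\<close>
  is a minimum over a parameter and \<open>\<phi>\<close> the member of the family that is minimal
  at t.\<close>

lemma antimono_from_majorant:
  fixes F :: "real \<Rightarrow> real"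
  assumes ab: "a \<le> b" and lip: "K-lipschitz_on {a..b} F" and N: "negligible N"
    and maj: "\<And>t. t \<in> {a<..<b} - N \<Longrightarrow>
        \<exists>\<phi> D. \<phi> t = F t \<and> (\<forall>s\<in>{a..b}. F s \<le> \<phi> s) \<and> (\<phi> has_real_derivative D) (at t) \<and> D \<le> 0"
  shows "F b \<le> F a"
proof (rule antimono_from_right_Dini[OF ab lip N])
  fix t e :: real assume t: "t \<in> {a<..<b} - N" and e: "e > 0"
  from maj[OF t] obtain \<phi> D where \<phi>: "\<phi> t = F t" "\<And>s. s \<in> {a..b} \<Longrightarrow> F s \<le> \<phi> s"
    "(\<phi> has_real_derivative D) (at t)" "D \<le> 0" by blast
  from DERIV_nonpos_right[OF \<phi>(3,4) e] obtain d where
    d: "d > 0" "\<forall>h. 0 < h \<and> h < d \<longrightarrow> \<phi> (t + h) \<le> \<phi> t + e * h" by blast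
  show "\<exists>d>0. \<forall>h. 0 < h \<and> h < d \<and> t + h \<le> b \<longrightarrow> F (t + h) \<le> F t + e * h"
  proof (intro exI[of _ d] conjI allI impI d(1))
    fix h assume h: "0 < h \<and> h < d \<and> t + h \<le> b"
    have "F (t + h) \<le> \<phi> (t + h)" by (rule \<phi>(2)) (use h t in auto)
    thus "F (t + h) \<le> F t + e * h" using d(2) h \<phi>(1) by force
  qed
qed

text \<open>The majorant also controls \<open>F\<close> to the left of t, where a nonnegative slope
  keeps \<open>F\<close> low. Reversing time keeps it a majorant and changes the sign of its
  slope.\<close>

lemma mono_from_majorant:
  fixes F :: "real \<Rightarrow> real"
  assumes ab: "a \<le> b" and lip: "K-lipschitz_on {a..b} F" and N: "negligible N"
    and maj: "\<And>t. t \<in> {a<..<b} - N \<Longrightarrow>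
        \<exists>\<phi> D. \<phi> t = F t \<and> (\<forall>s\<in>{a..b}. F s \<le> \<phi> s) \<and> (\<phi> has_real_derivative D) (at t) \<and> 0 \<le> D"
  shows "F a \<le> F b"
proof -
  let ?G = "\<lambda>t. F (- t)"
  have "?G (- a) \<le> ?G (- b)"
  proof (rule antimono_from_majorant[where a="-b" and b="-a" and F="?G" and K=K and N="uminus ` N"])
    show "- b \<le> - a" using ab by simp
    show "K-lipschitz_on {- b..- a} ?G"
    proof (rule lipschitz_onI)
      fix x y assume "x \<in> {- b..- a}" "y \<in> {- b..- a}"
      thus "dist (F (- x)) (F (- y)) \<le> K * dist x y"
        using lipschitz_onD[OF lip, of "-x" "-y"] by (simp add: dist_real_def abs_minus_commute)
    qed (use lip lipschitz_on_nonneg in blast)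
    show "negligible (uminus ` N)"
      using N by (intro negligible_differentiable_image_negligible) (auto intro!: derivative_intros differentiable_on_minus differentiable_on_ident)
    fix t assume t: "t \<in> {- b<..<- a} - uminus ` N"
    hence "- t \<in> {a<..<b} - N" by force
    from maj[OF this] obtain \<phi> D where \<phi>: "\<phi> (-t) = F (-t)" "\<And>s. s \<in> {a..b} \<Longrightarrow> F s \<le> \<phi> s"
      "(\<phi> has_real_derivative D) (at (-t))" "0 \<le> D" by blast
    have "((\<lambda>s. \<phi> (- s)) has_real_derivative - D) (at t)"
      using \<phi>(3) by (auto intro!: derivative_eq_intros DERIV_chain'[where f=uminus and g=\<phi>, THEN DERIV_cong])
    thus "\<exists>\<psi> D. \<psi> t = F (- t) \<and> (\<forall>s\<in>{- b..- a}. F (- s) \<le> \<psi> s) \<and> (\<psi> has_real_derivative D) (at t) \<and> D \<le> 0"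
      using \<phi> by (intro exI[of _ "\<lambda>s. \<phi> (- s)"] exI[of _ "- D"]) auto
  qed
  thus ?thesis by simp
qed

text \<open>The differentiation theorem applied here gives the limit of forward difference quotients
  outside a null set. Applied to the reflected integrand it supplies the backward quotients.\<close>

lemma indefinite_integral_derivative_AE:
  fixes f F :: "real \<Rightarrow> 'b::euclidean_space"
  assumes F: "\<And>t. t \<in> {0..T} \<Longrightarrow> (f has_integral (F t - F0)) {0..t}"
  obtains N where "negligible N"
    "\<And>t. t \<in> {0<..<T} - N \<Longrightarrow> (F has_vector_derivative f t) (at t)"
proof (cases "0 \<le> T")
  case False
  thus ?thesis using that[of "{}"] by auto
next
  case True
  \<comment> \<open>Extension by 0 makes the integrand integrable on every interval, as the
    differentiation theorem requires.\<close>
  define g where "g x = (if x \<in> {0..T} then f x else 0)" for x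
  have "f integrable_on {0..T}" using F[of T] True by auto
  hence "g integrable_on UNIV" unfolding g_def by (simp only: integrable_restrict_UNIV)
  hence gi: "g integrable_on cbox a b" for a b using integrable_on_subcbox by blast
  have "(\<lambda>x. g (- x)) integrable_on cbox a b" for a b
    using gi[of "-b" "-a"] Henstock_Kurzweil_Integration.integrable_reflect_real[where f=g and a="-b" and b="-a"] by simp
  then obtain N2 where N2: "negligible N2"
     "\<And>x e. \<lbrakk>x \<notin> N2; 0 < e\<rbrakk> \<Longrightarrow> \<exists>d>0. \<forall>h. 0 < h \<and> h < d \<longrightarrow>
        norm (integral (cbox x (x + h)) (\<lambda>x. g (- x)) /\<^sub>R h - g (- x)) < e"
    using integrable_ccontinuous_explicit[of "\<lambda>x. g (- x)"] by auto
  obtain N1 where N1: "negligible N1"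
     "\<And>x e. \<lbrakk>x \<notin> N1; 0 < e\<rbrakk> \<Longrightarrow> \<exists>d>0. \<forall>h. 0 < h \<and> h < d \<longrightarrow>
        norm (integral (cbox x (x + h)) g /\<^sub>R h - g x) < e"
    using integrable_ccontinuous_explicit[of g] gi by auto
  have diff: "integral {s..t} g = F t - F s" if "0 \<le> s" "s \<le> t" "t \<le> T" for s t
  proof -
    have "(f has_integral (F t - F0)) {0..t}" "(f has_integral (F s - F0)) {0..s}" using F that by auto
    moreover have "integral {0..s} f + integral {s..t} f = integral {0..t} f"
      by (rule Henstock_Kurzweil_Integration.integral_combine) (use that calculation in auto)
    ultimately have "F s - F0 + integral {s..t} f = F t - F0"
      by (simp only: integral_unique)
    hence "integral {s..t} f = F t - F s" by (simp add: algebra_simps)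
    moreover have "integral {s..t} g = integral {s..t} f"
      by (rule Henstock_Kurzweil_Integration.integral_cong) (use that in \<open>auto simp: g_def\<close>)
    ultimately show ?thesis by simp
  qed
  have main: "(F has_vector_derivative f t) (at t)" if t: "t \<in> {0<..<T} - (N1 \<union> uminus ` N2)" for t
    unfolding has_vector_derivative_def has_derivative_at_alt
  proof (intro conjI allI impI)
    show "bounded_linear (\<lambda>x. x *\<^sub>R f t)" by (rule bounded_linear_scaleR_left)
    fix e :: real assume e: "0 < e"
    have t1: "t \<notin> N1" and t2: "- t \<notin> N2" using t by force+
    obtain d1 where d1: "d1 > 0" "\<And>h. 0 < h \<Longrightarrow> h < d1 \<Longrightarrow> norm (integral (cbox t (t + h)) g /\<^sub>R h - g t) < e"
      using N1(2)[OF t1 e] by blast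
    obtain d2 where d2: "d2 > 0" "\<And>h. 0 < h \<Longrightarrow> h < d2 \<Longrightarrow>
        norm (integral (cbox (-t) (-t + h)) (\<lambda>x. g (- x)) /\<^sub>R h - g (- (-t))) < e"
      using N2(2)[OF t2 e] by blast
    have gt: "g t = f t" using t by (simp add: g_def)
    have scale: "norm (X - h *\<^sub>R Y) \<le> e * h" if "h > 0" "norm (X /\<^sub>R h - Y) < e" for X Y :: 'b and h
    proof -
      have "X - h *\<^sub>R Y = h *\<^sub>R (X /\<^sub>R h - Y)" using that(1) by (simp add: scaleR_right_diff_distrib)
      hence "norm (X - h *\<^sub>R Y) = h * norm (X /\<^sub>R h - Y)" using that(1) by simp
      also have "\<dots> \<le> h * e" using that by (intro mult_left_mono) auto
      finally show ?thesis by (simp add: mult.commute)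
    qed
    define d where "d = Min {d1, d2, t, T - t}"
    have d: "d > 0" "d \<le> d1" "d \<le> d2" "d \<le> t" "d \<le> T - t" unfolding d_def using d1 d2 t by auto
    show "\<exists>d>0. \<forall>y. norm (y - t) < d \<longrightarrow> norm (F y - F t - (y - t) *\<^sub>R f t) \<le> e * norm (y - t)"
    proof (intro exI[of _ d] conjI allI impI d(1))
      fix y assume y: "norm (y - t) < d"
      consider "y = t" | "y > t" | "y < t" by linarith
      thus "norm (F y - F t - (y - t) *\<^sub>R f t) \<le> e * norm (y - t)"
      proof cases
        case 2
        have i: "integral (cbox t (t + (y - t))) g = F y - F t"
          using diff[of t y] y d 2 t by auto
        have "norm (integral (cbox t (t + (y - t))) g /\<^sub>R (y - t) - g t) < e"
          by (rule d1(2)) (use y d 2 in auto)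
        from scale[OF _ this] 2 show ?thesis unfolding i gt by auto
      next
        case 3
        have "integral (cbox (-t) (-t + (t - y))) (\<lambda>x. g (- x)) = integral {y..t} g"
          using Henstock_Kurzweil_Integration.integral_reflect_real[of t y g] by simp
        also have "\<dots> = F t - F y" using diff[of y t] y d 3 t by auto
        finally have i: "integral (cbox (-t) (-t + (t - y))) (\<lambda>x. g (- x)) = F t - F y" .
        have "norm (integral (cbox (-t) (-t + (t - y))) (\<lambda>x. g (- x)) /\<^sub>R (t - y) - g (- (-t))) < e"
          by (rule d2(2)) (use y d 3 in auto)
        from scale[OF _ this] 3 have "norm (F t - F y - (t - y) *\<^sub>R f t) \<le> e * (t - y)" unfolding i by (simp add: gt)
        also have "F t - F y - (t - y) *\<^sub>R f t = - (F y - F t - (y - t) *\<^sub>R f t)"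
          by (simp add: algebra_simps)
        finally show ?thesis using 3 by (simp add: norm_minus_commute)
      qed auto
    qed
  qed
  have "negligible (uminus ` N2)"
    using N2(1) by (intro negligible_differentiable_image_negligible) (auto intro!: derivative_intros differentiable_on_minus differentiable_on_ident)
  hence "negligible (N1 \<union> uminus ` N2)" using N1(1) by simp
  from that[OF this main] show thesis by blast
qed

section \<open>The bisector in relative coordinates\<close>

text \<open>The distance from the attacker to the moving asset changes at a rate of at most \<alpha>
  < 1 per unit of the attacker's flight length, whereas the flight length grows at rate 1. So the
  two quantities are equal only once; this and \<open>capture_ge\<close> locate any \<sigma>
  relative to that point.\<close>

lemma capture_le:
  fixes \<delta> u :: "'a::real_normed_vector"
  assumes "norm u = 1" "0 < \<alpha>" "\<alpha> < 1" "norm (\<delta> + (\<alpha> * \<rho>) *\<^sub>R u) = \<rho>" "norm (\<delta> + (\<alpha> * \<sigma>) *\<^sub>R u) \<le> \<sigma>"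
  shows "\<rho> \<le> \<sigma>"
proof (rule ccontr)
  assume "\<not> \<rho> \<le> \<sigma>"
  hence less: "\<sigma> < \<rho>" by simp
  have "\<delta> + (\<alpha> * \<rho>) *\<^sub>R u = (\<delta> + (\<alpha> * \<sigma>) *\<^sub>R u) + (\<alpha> * (\<rho> - \<sigma>)) *\<^sub>R u" by (simp add: algebra_simps)
  hence "\<rho> \<le> \<sigma> + norm ((\<alpha> * (\<rho> - \<sigma>)) *\<^sub>R u)" using assms(4,5) norm_triangle_ineq
    by (metis add_right_mono order_trans)
  also have "norm ((\<alpha> * (\<rho> - \<sigma>)) *\<^sub>R u) = \<alpha> * (\<rho> - \<sigma>)" using assms less by simp
  also have "\<alpha> * (\<rho> - \<sigma>) < 1 * (\<rho> - \<sigma>)" using assms less by (intro mult_strict_right_mono) auto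
  finally show False by simp
qed

lemma capture_ge:
  fixes \<delta> u :: "'a::real_normed_vector"
  assumes "norm u = 1" "0 < \<alpha>" "\<alpha> < 1" "norm (\<delta> + (\<alpha> * \<rho>) *\<^sub>R u) = \<rho>" "\<sigma> \<le> norm (\<delta> + (\<alpha> * \<sigma>) *\<^sub>R u)"
  shows "\<sigma> \<le> \<rho>"
proof (rule ccontr)
  assume "\<not> \<sigma> \<le> \<rho>"
  hence less: "\<rho> < \<sigma>" by simp
  have "\<delta> + (\<alpha> * \<sigma>) *\<^sub>R u = (\<delta> + (\<alpha> * \<rho>) *\<^sub>R u) + (\<alpha> * (\<sigma> - \<rho>)) *\<^sub>R u" by (simp add: algebra_simps)
  hence "\<sigma> \<le> \<rho> + norm ((\<alpha> * (\<sigma> - \<rho>)) *\<^sub>R u)" using assms(4,5) norm_triangle_ineq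
    by (metis order_trans)
  also have "norm ((\<alpha> * (\<sigma> - \<rho>)) *\<^sub>R u) = \<alpha> * (\<sigma> - \<rho>)" using assms less by simp
  also have "\<alpha> * (\<sigma> - \<rho>) < 1 * (\<sigma> - \<rho>)" using assms less by (intro mult_strict_right_mono) auto
  finally show False by simp
qed

text \<open>The origin is the midpoint of the missiles, the attacker is at (m, 0), the defender at (-m, 0) and the
  asset at (b1, b2), with heading (u1, u2). The vector (w1, w2) is the miss when the attacker flies to
  (0, y), k its component along the heading and p the one across it, which is affine in y.\<close>

locale frame =
  fixes \<alpha> m b1 b2 u1 u2 :: real
  assumes alpha_pos: "0 < \<alpha>" and alpha_less: "\<alpha> < 1" and m_pos: "0 < m"
    and unit: "u1\<^sup>2 + u2\<^sup>2 = 1"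
begin

definition r :: "real \<Rightarrow> real" where "r y = sqrt (m\<^sup>2 + y\<^sup>2)"
definition w1 :: "real \<Rightarrow> real" where "w1 y = - (b1 + \<alpha> * r y * u1)"
definition w2 :: "real \<Rightarrow> real" where "w2 y = y - b2 - \<alpha> * r y * u2"
definition L :: "real \<Rightarrow> real" where "L y = (w1 y)\<^sup>2 + (w2 y)\<^sup>2"
definition k :: "real \<Rightarrow> real" where "k y = u1 * w1 y + u2 * w2 y"
definition p :: "real \<Rightarrow> real" where "p y = u1 * (y - b2) + u2 * b1"
definition minimizer :: "real \<Rightarrow> bool" where "minimizer y \<longleftrightarrow> (\<forall>y'. L y \<le> L y')"
definition capture :: "real \<Rightarrow> bool" where
  "capture \<rho> \<longleftrightarrow> cmod (Complex (b1 + \<alpha> * \<rho> * u1 - m) (b2 + \<alpha> * \<rho> * u2)) = \<rho>"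

lemma r_pos: "r y > 0"
  unfolding r_def using m_pos by (simp add: add_pos_nonneg)

lemma r_sq: "(r y)\<^sup>2 = m\<^sup>2 + y\<^sup>2"
  unfolding r_def by simp

lemma r_le: "r y \<le> m + \<bar>y\<bar>"
  unfolding r_def using m_pos by (intro real_le_lsqrt) (auto simp: power2_sum)

lemma cos_sin_r: "(m / r y)\<^sup>2 + (y / r y)\<^sup>2 = 1"
proof -
  have "(m / r y)\<^sup>2 + (y / r y)\<^sup>2 = (r y)\<^sup>2 / (r y)\<^sup>2"
    by (simp only: r_sq power_divide add_divide_distrib)
  thus ?thesis using r_pos[of y] by simp
qed

lemma abs_dot_le: "\<bar>u2 * s + u1 * c\<bar> \<le> 1" if "c\<^sup>2 + s\<^sup>2 = 1" for c s
proof -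
  have "(u2 * s + u1 * c)\<^sup>2 + (u1 * s - u2 * c)\<^sup>2 = (u1\<^sup>2 + u2\<^sup>2) * (c\<^sup>2 + s\<^sup>2)" by algebra
  hence "(u2 * s + u1 * c)\<^sup>2 + (u1 * s - u2 * c)\<^sup>2 = 1" using that unit by simp
  hence "(u2 * s + u1 * c)\<^sup>2 \<le> 1" using zero_le_power2[of "u1 * s - u2 * c"] by linarith
  thus ?thesis by (simp add: abs_square_le_1)
qed

lemma abs_u2_s: "\<bar>u2 * (y / r y)\<bar> \<le> 1"
proof -
  have "\<bar>u2\<bar> \<le> 1" using unit by (metis abs_square_le_1 le_add_same_cancel2 zero_le_power2)
  moreover have "\<bar>y / r y\<bar> \<le> 1" using cos_sin_r[of y] by (metis abs_square_le_1 le_add_same_cancel2 zero_le_power2)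
  ultimately have "\<bar>u2\<bar> * \<bar>y / r y\<bar> \<le> 1" by (intro mult_le_one) auto
  thus ?thesis by (simp only: abs_mult)
qed

text \<open>This quantity is the factor that relates \<open>k\<close> and \<open>w1\<close> at a
  minimizer in \<open>stationary_k\<close>. Its positivity transfers signs from one to the other,
  its bounds give the constants of \<open>minimizer_bound\<close>.\<close>

lemma denominator_bounds: "1 - \<alpha> \<le> 1 - \<alpha> * u2 * y / r y" "1 - \<alpha> * u2 * y / r y \<le> 1 + \<alpha>"
proof -
  have "\<bar>\<alpha> * (u2 * (y / r y))\<bar> \<le> \<alpha>" using abs_u2_s[of y] alpha_pos
    by (metis abs_mult abs_of_pos mult.right_neutral mult_le_cancel_left_pos)
  hence "\<bar>\<alpha> * u2 * y / r y\<bar> \<le> \<alpha>" by (simp add: mult.assoc)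
  thus "1 - \<alpha> \<le> 1 - \<alpha> * u2 * y / r y" "1 - \<alpha> * u2 * y / r y \<le> 1 + \<alpha>" by linarith+
qed

lemma L_decomp: "L y = (k y)\<^sup>2 + (p y)\<^sup>2"
proof -
  have "u1 * w2 y - u2 * w1 y = p y" unfolding w1_def w2_def p_def by (simp add: algebra_simps)
  moreover have "(u1\<^sup>2 + u2\<^sup>2) * ((w1 y)\<^sup>2 + (w2 y)\<^sup>2) = (k y)\<^sup>2 + (u1 * w2 y - u2 * w1 y)\<^sup>2"
    unfolding k_def by algebra
  ultimately show ?thesis using unit by (simp add: L_def)
qed

lemma k_eq: "k y = u2 * (y - b2) - u1 * b1 - \<alpha> * r y"
proof -
  have "k y = u2 * (y - b2) - u1 * b1 - \<alpha> * r y * (u1\<^sup>2 + u2\<^sup>2)"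
    unfolding k_def w1_def w2_def by (simp add: algebra_simps power2_eq_square)
  thus ?thesis using unit by simp
qed

lemma r_cont: "continuous_on S r"
  unfolding r_def by (intro continuous_intros)

lemma L_cont: "continuous_on S L"
  unfolding L_def w1_def w2_def by (intro continuous_intros r_cont)

lemma k_cont: "continuous_on S k"
  unfolding k_def w1_def w2_def by (intro continuous_intros r_cont)

text \<open>The aim point moves out at rate 1 in y, while the path of the asset lengthens at a rate
  of at most \<alpha>.\<close>

lemma L_coercive: "(1 - \<alpha>) * \<bar>y\<bar> - (cmod (Complex b1 b2) + \<alpha> * m) \<le> sqrt (L y)"
proof -
  have sq: "sqrt (L y) = cmod (Complex (w1 y) (w2 y))" by (simp add: L_def cmod_def)
  have "Complex (w1 y) (w2 y) = Complex 0 y - (Complex b1 b2 + (\<alpha> * r y) *\<^sub>R Complex u1 u2)"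
    by (simp add: complex_eq_iff w1_def w2_def)
  hence "sqrt (L y) \<ge> cmod (Complex 0 y) - cmod (Complex b1 b2 + (\<alpha> * r y) *\<^sub>R Complex u1 u2)"
    unfolding sq by (metis norm_triangle_ineq2)
  moreover have "cmod (Complex b1 b2 + (\<alpha> * r y) *\<^sub>R Complex u1 u2) \<le> cmod (Complex b1 b2) + \<alpha> * r y"
  proof -
    have "cmod ((\<alpha> * r y) *\<^sub>R Complex u1 u2) = \<alpha> * r y"
    proof -
      have "cmod (Complex u1 u2) = 1" using unit by (simp add: cmod_def)
      thus ?thesis using alpha_pos r_pos[of y] by (simp only: norm_scaleR) simp
    qed
    thus ?thesis using norm_triangle_ineq[of "Complex b1 b2" "(\<alpha> * r y) *\<^sub>R Complex u1 u2"] by simp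
  qed
  moreover have "\<alpha> * r y \<le> \<alpha> * (m + \<bar>y\<bar>)" using r_le alpha_pos by (intro mult_left_mono) auto
  moreover have "cmod (Complex 0 y) = \<bar>y\<bar>" by (simp add: cmod_def)
  ultimately show ?thesis by (simp add: algebra_simps)
qed

lemma minimizer_exists: "\<exists>y. minimizer y"
proof -
  \<comment> \<open>Beyond \<open>Y\<close> the coercivity bound exceeds the miss at 0, so a minimum
    over the compact interval is global.\<close>
  define Y where "Y = (sqrt (L 0) + cmod (Complex b1 b2) + \<alpha> * m) / (1 - \<alpha>)"
  have L0: "L 0 \<ge> 0" by (simp add: L_def)
  have Y0: "Y \<ge> 0" unfolding Y_def using alpha_less alpha_pos m_pos L0 by simp
  have "\<exists>x\<in>{-Y..Y}. \<forall>y\<in>{-Y..Y}. L x \<le> L y"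
    by (intro continuous_attains_inf L_cont) (use Y0 in auto)
  then obtain x where x: "x \<in> {-Y..Y}" "\<And>y. y \<in> {-Y..Y} \<Longrightarrow> L x \<le> L y" by blast
  have "L x \<le> L y" for y
  proof (cases "y \<in> {-Y..Y}")
    case True thus ?thesis by (rule x(2))
  next
    case False
    hence "Y < \<bar>y\<bar>" by auto
    hence "(1 - \<alpha>) * Y < (1 - \<alpha>) * \<bar>y\<bar>" using alpha_less by simp
    moreover have "(1 - \<alpha>) * Y = sqrt (L 0) + cmod (Complex b1 b2) + \<alpha> * m"
      unfolding Y_def using alpha_less by simp
    ultimately have "sqrt (L 0) < sqrt (L y)" using L_coercive[of y] by linarith
    hence "L 0 < L y" by simp
    moreover have "L x \<le> L 0" by (rule x(2)) (use Y0 in auto)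
    ultimately show ?thesis by linarith
  qed
  thus ?thesis by (auto simp: minimizer_def)
qed

lemma r_deriv: "(r has_real_derivative y / r y) (at y)"
proof -
  have "m\<^sup>2 + y\<^sup>2 > 0" using m_pos by (simp add: add_pos_nonneg)
  thus ?thesis unfolding r_def by (auto intro!: derivative_eq_intros simp: field_simps)
qed

lemma L_deriv: "(L has_real_derivative 2 * (w2 y - \<alpha> * k y * y / r y)) (at y)"
proof -
  have "(w1 has_real_derivative (- (\<alpha> * (y / r y) * u1))) (at y)"
    unfolding w1_def by (auto intro!: derivative_eq_intros r_deriv)
  moreover have "(w2 has_real_derivative (1 - \<alpha> * (y / r y) * u2)) (at y)"
    unfolding w2_def by (auto intro!: derivative_eq_intros r_deriv)
  ultimately have "(L has_real_derivative 2 * w1 y * (- (\<alpha> * (y / r y) * u1)) + 2 * w2 y * (1 - \<alpha> * (y / r y) * u2)) (at y)"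
    unfolding L_def by (auto intro!: derivative_eq_intros)
  moreover have "2 * w1 y * (- (\<alpha> * (y / r y) * u1)) + 2 * w2 y * (1 - \<alpha> * (y / r y) * u2)
    = 2 * (w2 y - \<alpha> * k y * y / r y)"
    unfolding k_def by (simp add: algebra_simps add_divide_distrib)
  ultimately show ?thesis by simp
qed

lemma stationary:
  assumes "minimizer y"
  shows "w2 y = \<alpha> * k y * y / r y"
proof -
  have "2 * (w2 y - \<alpha> * k y * y / r y) = 0"
    by (rule DERIV_local_min[OF L_deriv zero_less_one]) (use assms in \<open>auto simp: minimizer_def\<close>)
  thus ?thesis by simp
qed

lemma stationary_k:
  assumes "minimizer y"
  shows "k y * (1 - \<alpha> * u2 * y / r y) = u1 * w1 y"
proof -
  have "k y = u1 * w1 y + u2 * (\<alpha> * k y * y / r y)"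
    using stationary[OF assms] by (simp add: k_def)
  thus ?thesis by (simp add: algebra_simps)
qed

lemma capture_unique:
  assumes "capture \<rho>"
  shows "cmod (Complex (b1 + \<alpha> * \<sigma> * u1 - m) (b2 + \<alpha> * \<sigma> * u2)) \<le> \<sigma> \<Longrightarrow> \<rho> \<le> \<sigma>"
    and "\<sigma> \<le> cmod (Complex (b1 + \<alpha> * \<sigma> * u1 - m) (b2 + \<alpha> * \<sigma> * u2)) \<Longrightarrow> \<sigma> \<le> \<rho>"
proof -
  have e: "Complex (b1 + \<alpha> * \<sigma> * u1 - m) (b2 + \<alpha> * \<sigma> * u2) = Complex (b1 - m) b2 + (\<alpha> * \<sigma>) *\<^sub>R Complex u1 u2" for \<sigma>
    by (simp add: complex_eq_iff)
  have n: "cmod (Complex u1 u2) = 1" using unit by (simp add: cmod_def)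
  show "cmod (Complex (b1 + \<alpha> * \<sigma> * u1 - m) (b2 + \<alpha> * \<sigma> * u2)) \<le> \<sigma> \<Longrightarrow> \<rho> \<le> \<sigma>"
    using capture_le[OF n alpha_pos alpha_less] assms unfolding capture_def e by blast
  show "\<sigma> \<le> cmod (Complex (b1 + \<alpha> * \<sigma> * u1 - m) (b2 + \<alpha> * \<sigma> * u2)) \<Longrightarrow> \<sigma> \<le> \<rho>"
    using capture_ge[OF n alpha_pos alpha_less] assms unfolding capture_def e by blast
qed

end

section \<open>Minimizers of the miss when the capture point lies on the defender's side\<close>

locale guarded_frame = frame +
  fixes \<rho> :: real
  assumes capture: "capture \<rho>" and guarded: "b1 + \<alpha> * \<rho> * u1 < 0"
begin

text \<open>A miss of zero means that the attacker meets the asset on the bisector. By uniqueness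
  this is the capture point, whose abscissa is negative.\<close>

lemma L_pos: "L y > 0"
proof -
  have "L y \<ge> 0" by (simp add: L_def)
  moreover have "L y \<noteq> 0"
  proof
    assume "L y = 0"
    hence w: "w1 y = 0" "w2 y = 0" by (auto simp: L_def)
    hence 1: "b1 + \<alpha> * r y * u1 = 0" "b2 + \<alpha> * r y * u2 = y" by (auto simp: w1_def w2_def)
    hence "cmod (Complex (b1 + \<alpha> * r y * u1 - m) (b2 + \<alpha> * r y * u2)) = r y"
      by (simp add: cmod_def r_def)
    hence "\<rho> = r y" using capture_unique[OF capture, of "r y"] by simp
    thus False using guarded 1 by simp
  qed
  ultimately show ?thesis by simp
qed

text \<open>The ordinate at which the line of the asset's path meets the bisector. There the miss
  has no component across the heading.\<close>

definition ym :: real where "ym = b2 - u2 * b1 / u1"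

lemma p_ym: "u1 \<noteq> 0 \<Longrightarrow> p y = u1 * (y - ym)"
  unfolding p_def ym_def by (simp add: field_simps)

text \<open>At \<open>ym\<close> the along-track component is \<alpha> times the difference of two
  flight lengths: \<sigma>, the one after which the asset is on the bisector, and the length needed
  to get to that point. As the capture point lies beyond the bisector, the sign of \<open>u1\<close>
  decides whether \<sigma> is smaller or larger than \<rho>, and uniqueness of the capture then
  orders the two lengths.\<close>

lemma k_ym: assumes "u1 \<noteq> 0" shows "0 < u1 * k ym"
proof -
  \<comment> \<open>A signed length: it is negative if the asset has already passed the
    bisector.\<close>
  define \<sigma> where "\<sigma> = - b1 / (\<alpha> * u1)"
  have \<sigma>: "b1 + \<alpha> * \<sigma> * u1 = 0" unfolding \<sigma>_def using assms alpha_pos by simp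
  have \<sigma>2: "b2 + \<alpha> * \<sigma> * u2 = ym" unfolding \<sigma>_def ym_def using assms alpha_pos by (simp add: field_simps)
  have c: "cmod (Complex (b1 + \<alpha> * \<sigma> * u1 - m) (b2 + \<alpha> * \<sigma> * u2)) = r ym"
    unfolding \<sigma> \<sigma>2 by (simp add: cmod_def r_def)
  have "k ym = u2 * (\<alpha> * \<sigma> * u2) - u1 * b1 - \<alpha> * r ym"
    unfolding k_eq using \<sigma>2[symmetric] by simp
  also have "u1 * b1 = - \<alpha> * \<sigma> * u1\<^sup>2" using \<sigma> by algebra
  also have "u2 * (\<alpha> * \<sigma> * u2) - - \<alpha> * \<sigma> * u1\<^sup>2 - \<alpha> * r ym = \<alpha> * \<sigma> * (u1\<^sup>2 + u2\<^sup>2) - \<alpha> * r ym"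
    by (simp add: algebra_simps power2_eq_square)
  finally have k: "k ym = \<alpha> * (\<sigma> - r ym)" using unit by (simp add: algebra_simps)
  have g: "\<alpha> * (u1 * (\<rho> - \<sigma>)) < 0" using guarded \<sigma> by (simp add: algebra_simps)
  hence g: "u1 * (\<rho> - \<sigma>) < 0" using alpha_pos by (simp add: mult_less_0_iff)
  show ?thesis
  proof (cases "u1 < 0")
    case True
    hence "\<sigma> < \<rho>" using g by (simp add: mult_less_0_iff)
    hence "\<not> r ym \<le> \<sigma>" using capture_unique(1)[OF capture, of \<sigma>] c by auto
    thus ?thesis unfolding k using True alpha_pos by (intro mult_neg_neg mult_pos_neg) auto
  next
    case False
    hence "\<rho> < \<sigma>" using g by (simp add: mult_less_0_iff)
    hence "\<not> \<sigma> \<le> r ym" using capture_unique(2)[OF capture, of \<sigma>] c by auto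
    thus ?thesis unfolding k using False assms alpha_pos by (intro mult_pos_pos) auto
  qed
qed

text \<open>By continuity \<open>k\<close> vanishes between \<open>ym\<close>, where
  \<open>u1 * k\<close> is positive, and y, where it is negative. The zero is closer to
  \<open>ym\<close> than y is, so the component across the heading is smaller as well. This discards
  every y with the wrong sign of \<open>k\<close>.\<close>

lemma crossing:
  assumes u1: "u1 \<noteq> 0" and neg: "u1 * k y < 0"
  obtains y' where "k y' = 0" "(p y')\<^sup>2 < (p y)\<^sup>2"
proof -
  have "\<exists>x\<ge>min ym y. x \<le> max ym y \<and> u1 * k x = 0"
  proof (cases "ym \<le> y")
    case True
    have "\<exists>x\<ge>ym. x \<le> y \<and> u1 * k x = 0"
      by (rule IVT2') (use True k_ym[OF u1] neg in \<open>auto intro!: continuous_intros k_cont\<close>)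
    thus ?thesis using True by auto
  next
    case False
    have "\<exists>x\<ge>y. x \<le> ym \<and> u1 * k x = 0"
      by (rule IVT') (use False k_ym[OF u1] neg in \<open>auto intro!: continuous_intros k_cont\<close>)
    thus ?thesis using False by auto
  qed
  then obtain x where x: "min ym y \<le> x" "x \<le> max ym y" "k x = 0" using u1 by auto
  have "x \<noteq> y" using neg x by auto
  hence "\<bar>x - ym\<bar> < \<bar>y - ym\<bar>" using x by (auto simp: min_def max_def split: if_splits)
  hence "(p x)\<^sup>2 < (p y)\<^sup>2" unfolding p_ym[OF u1] using u1

  proof -
    have "(x - ym)\<^sup>2 < (y - ym)\<^sup>2" using \<open>\<bar>x - ym\<bar> < \<bar>y - ym\<bar>\<close> by (metis abs_ge_zero power2_abs power_strict_mono zero_less_numeral)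
    thus "(u1 * (x - ym))\<^sup>2 < (u1 * (y - ym))\<^sup>2" using u1 by (simp add: power_mult_distrib)
  qed
  thus thesis using that x by blast
qed

text \<open>The asset is on the defender's side when the attacker arrives at the best aim point.
  Indeed \<open>crossing\<close> excludes the wrong sign of \<open>k\<close>, stationarity carries
  the sign over to \<open>w1\<close>, and \<open>w1 y = 0\<close> would make the whole miss
  vanish.\<close>

lemma minimizer_w1_pos:
  assumes "minimizer y"
  shows "0 < w1 y"
proof (cases "u1 = 0")
  case True
  have "w1 y = - b1" unfolding w1_def using True by (simp only: mult_zero_right add_0_right)
  moreover have "b1 < 0" using guarded True by simp
  ultimately show ?thesis by simp
next
  case False
  have "u1 * k y \<ge> 0"
  proof (rule ccontr)
    assume "\<not> u1 * k y \<ge> 0"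
    hence "u1 * k y < 0" by simp
    from crossing[OF False this] obtain y' where "k y' = 0" "(p y')\<^sup>2 < (p y)\<^sup>2" .
    hence "L y' < L y" unfolding L_decomp by (simp add: add_strict_increasing2)
    thus False using assms by (meson minimizer_def not_le)
  qed
  moreover have d: "1 - \<alpha> * u2 * y / r y > 0" using denominator_bounds[of y] alpha_less by linarith
  ultimately have "0 \<le> u1 * k y * (1 - \<alpha> * u2 * y / r y)" by simp
  also have "\<dots> = u1\<^sup>2 * w1 y" using stationary_k[OF assms] by (simp add: power2_eq_square)
  finally have "0 \<le> w1 y" using False by (simp add: zero_le_mult_iff)
  moreover have "w1 y \<noteq> 0"
  proof
    assume w: "w1 y = 0"
    hence "k y = 0" using stationary_k[OF assms] d by (metis less_irrefl mult_eq_0_iff mult_zero_right)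
    hence "w2 y = 0" using stationary[OF assms] by simp
    thus False using w L_pos[of y] by (simp add: L_def)
  qed
  ultimately show ?thesis by simp
qed

text \<open>The right-hand sides are, up to a common positive factor, the weights of the attacker's
  and of the defender's loss in \<open>envelope_identity\<close>. They must be comparable to the
  miss with a constant that does not depend on the state. One factor 1 - \<alpha> comes from
  comparing \<open>w1\<close> with the miss, the other from the scalar product of two unit vectors,
  and the denominator 1 + \<alpha> bounds the factor of \<open>stationary_k\<close>.\<close>

lemma minimizer_bound:
  assumes "minimizer y"
  shows "(1 - \<alpha>)\<^sup>2 / (1 + \<alpha>) * sqrt (L y) \<le> w1 y - \<alpha> * k y * m / r y"
    and "(1 - \<alpha>)\<^sup>2 / (1 + \<alpha>) * sqrt (L y) \<le> w1 y + \<alpha> * k y * m / r y"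
proof -
  define c s q where "c = m / r y" and "s = y / r y" and "q = 1 - \<alpha> * u2 * s"
  have cs: "c\<^sup>2 + s\<^sup>2 = 1" unfolding c_def s_def by (rule cos_sin_r)
  have q: "1 - \<alpha> \<le> q" "q \<le> 1 + \<alpha>" using denominator_bounds[of y] by (auto simp: q_def s_def)
  have q0: "q > 0" using q alpha_less by linarith
  have w: "w1 y > 0" by (rule minimizer_w1_pos[OF assms])
  have kq: "k y * q = u1 * w1 y" using stationary_k[OF assms] by (simp add: q_def s_def)
  have w2: "w2 y = \<alpha> * k y * s" using stationary[OF assms] by (simp add: s_def)
  have "\<bar>u1\<bar> \<le> 1" using unit by (metis abs_square_le_1 le_add_same_cancel1 zero_le_power2)
  have "\<bar>s\<bar> \<le> 1" using cs by (metis abs_square_le_1 le_add_same_cancel2 zero_le_power2)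
  have "\<bar>k y\<bar> * (1 - \<alpha>) \<le> \<bar>k y\<bar> * q" using q by (intro mult_left_mono) auto
  also have "\<dots> = \<bar>u1\<bar> * w1 y" using kq q0 w by (metis abs_mult abs_of_pos)
  also have "\<dots> \<le> 1 * w1 y" using w \<open>\<bar>u1\<bar> \<le> 1\<close> by (intro mult_right_mono) auto
  finally have k: "\<bar>k y\<bar> * (1 - \<alpha>) \<le> w1 y" by simp
  have "\<bar>w2 y\<bar> = \<alpha> * \<bar>k y\<bar> * \<bar>s\<bar>" unfolding w2 using alpha_pos by (simp add: abs_mult)
  also have "\<dots> \<le> \<alpha> * \<bar>k y\<bar> * 1" using alpha_pos \<open>\<bar>s\<bar> \<le> 1\<close> by (intro mult_left_mono) auto
  finally have "\<bar>w2 y\<bar> \<le> \<alpha> * \<bar>k y\<bar>" by simp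
  moreover have "sqrt (L y) \<le> \<bar>w1 y\<bar> + \<bar>w2 y\<bar>" unfolding L_def by (rule sqrt_sum_squares_le_sum_abs)
  ultimately have "sqrt (L y) \<le> w1 y + \<alpha> * \<bar>k y\<bar>" using w by simp
  hence "(1 - \<alpha>) * sqrt (L y) \<le> (1 - \<alpha>) * (w1 y + \<alpha> * \<bar>k y\<bar>)" using alpha_less by (intro mult_left_mono) auto
  also have "\<dots> = (1 - \<alpha>) * w1 y + \<alpha> * (\<bar>k y\<bar> * (1 - \<alpha>))" by (simp add: algebra_simps)
  also have "\<dots> \<le> (1 - \<alpha>) * w1 y + \<alpha> * w1 y" using k alpha_pos by simp
  finally have sL: "(1 - \<alpha>) * sqrt (L y) \<le> w1 y" by (simp add: algebra_simps)
  \<comment> \<open>Both signs of the cosine are treated at once; they belong to the directions from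
    the attacker and from the defender to the aim point.\<close>
  have gen: "(1 - \<alpha>)\<^sup>2 / (1 + \<alpha>) * sqrt (L y) \<le> w1 y + \<alpha> * k y * c'" if c': "c'\<^sup>2 = c\<^sup>2" for c'
  proof -
    have "\<bar>u2 * (- s) + u1 * c'\<bar> \<le> 1" by (rule abs_dot_le) (use cs c' in simp)
    hence "\<alpha> * (u2 * (- s) + u1 * c') \<ge> - \<alpha>" using alpha_pos
      by (metis abs_le_iff minus_le_iff mult.right_neutral mult_le_cancel_left_pos mult_minus_right)
    hence "1 - \<alpha> \<le> q + \<alpha> * u1 * c'" unfolding q_def by (simp add: algebra_simps)
    hence "(1 - \<alpha>) * w1 y \<le> (q + \<alpha> * u1 * c') * w1 y" using w by (intro mult_right_mono) auto
    also have "\<dots> = q * (w1 y + \<alpha> * k y * c')" using kq by algebra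
    finally have 1: "(1 - \<alpha>) * w1 y \<le> q * (w1 y + \<alpha> * k y * c')" .
    have "0 < (1 - \<alpha>) * w1 y" using w alpha_less by simp
    hence pos: "w1 y + \<alpha> * k y * c' > 0" using 1 q0 by (smt (verit) mult_nonneg_nonpos)
    have "(1 - \<alpha>)\<^sup>2 * sqrt (L y) = (1 - \<alpha>) * ((1 - \<alpha>) * sqrt (L y))" by (simp add: power2_eq_square)
    also have "\<dots> \<le> (1 - \<alpha>) * w1 y" using sL alpha_less by (intro mult_left_mono) auto
    also note 1
    also have "q * (w1 y + \<alpha> * k y * c') \<le> (1 + \<alpha>) * (w1 y + \<alpha> * k y * c')" using q pos by (intro mult_right_mono) auto
    finally show ?thesis using alpha_pos by (simp add: field_simps)
  qed
  show "(1 - \<alpha>)\<^sup>2 / (1 + \<alpha>) * sqrt (L y) \<le> w1 y - \<alpha> * k y * m / r y"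
    using gen[of "- c"] by (simp add: c_def)
  show "(1 - \<alpha>)\<^sup>2 / (1 + \<alpha>) * sqrt (L y) \<le> w1 y + \<alpha> * k y * m / r y"
    using gen[of "c"] by (simp add: c_def)
qed

text \<open>Arriving late lets the asset advance by e, which lowers \<open>k\<close> by e and leaves
  \<open>p\<close> alone. If \<open>k\<close> is nonpositive this moves it away from 0; if it is
  positive, \<open>crossing\<close> offers a point that is better than any delay at
  \<open>y'\<close>.\<close>

lemma minimizer_le_delayed:
  assumes u1: "u1 < 0" and y: "minimizer y" and e: "0 \<le> e"
  shows "L y \<le> (k y' - e)\<^sup>2 + (p y')\<^sup>2"
proof (cases "k y' \<le> 0")
  case True
  have "(k y')\<^sup>2 \<le> (k y' - e)\<^sup>2" using True e by (intro abs_le_square_iff[THEN iffD1]) auto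
  thus ?thesis using y L_decomp[of y'] unfolding minimizer_def by (metis add_right_mono order_trans)
next
  case False
  hence "u1 * k y' < 0" using u1 by (simp add: mult_less_0_iff)
  from crossing[OF less_imp_neq[OF u1] this] obtain y'' where "k y'' = 0" "(p y'')\<^sup>2 < (p y')\<^sup>2" .
  hence "L y'' \<le> (k y' - e)\<^sup>2 + (p y')\<^sup>2" unfolding L_decomp using zero_le_power2[of "k y' - e"] by (simp add: add_increasing)
  thus ?thesis using y unfolding minimizer_def by (meson order_trans)
qed

lemma r_midpoint: "r ((y + y') / 2) \<le> (r y + r y') / 2"
proof -
  have "r y = norm (m, y)" for y by (simp add: r_def norm_Pair)
  moreover have "(m, (y + y') / 2) = (1/2) *\<^sub>R ((m, y) + (m, y'))" by (simp add: field_simps)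
  moreover have "norm ((1/2) *\<^sub>R ((m, y) + (m, y'))) \<le> (norm (m, y) + norm (m, y')) / 2"
    using norm_triangle_ineq[of "(m, y)" "(m, y')"] by (simp add: divide_right_mono del: add_Pair)
  ultimately show ?thesis by metis
qed

text \<open>The function \<open>L\<close> need not be convex. But \<open>k\<close> is concave and
  nonpositive at minimizers, and \<open>p\<close> is affine and injective. So at the midpoint of two
  minimizers either \<open>k\<close> is still nonpositive and both squares are controlled by their
  averages, the second one strictly, or \<open>k\<close> is positive and \<open>crossing\<close>
  gives a better point.\<close>

lemma minimizer_unique:
  assumes u1: "u1 < 0" and a: "minimizer y" and b: "minimizer y'"
  shows "y = y'"
proof (rule ccontr)
  assume ne: "y \<noteq> y'"
  define c where "c = (y + y') / 2"
  have nonpos: "k x \<le> 0" if "minimizer x" for x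
  proof (rule ccontr)
    assume "\<not> k x \<le> 0"
    hence "u1 * k x < 0" using u1 by (simp add: mult_less_0_iff)
    from crossing[OF less_imp_neq[OF u1] this] obtain y' where "k y' = 0" "(p y')\<^sup>2 < (p x)\<^sup>2" .
    hence "L y' < L x" unfolding L_decomp by (simp add: add_strict_increasing2)
    thus False using that by (meson minimizer_def not_le)
  qed
  have eq: "L y = L y'" using a b by (meson minimizer_def order_antisym)
  have pc: "p c = (p y + p y') / 2" unfolding p_def c_def by (simp add: field_simps)
  have pne: "p y \<noteq> p y'" using u1 ne by (simp add: p_def)
  have avg: "((s + t) / 2)\<^sup>2 = (s\<^sup>2 + t\<^sup>2) / 2 - ((s - t) / 2)\<^sup>2" for s t :: real
    by (simp add: power2_eq_square field_simps)
  have sq: "(p c)\<^sup>2 < ((p y)\<^sup>2 + (p y')\<^sup>2) / 2" 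
  proof -
    have "((p y - p y') / 2)\<^sup>2 > 0" using pne by simp
    thus ?thesis unfolding pc avg by linarith
  qed
  show False
  proof (cases "k c \<le> 0")
    case True
    have "k c \<ge> (k y + k y') / 2"
    proof -
      have "\<alpha> * r c \<le> \<alpha> * ((r y + r y') / 2)" using r_midpoint[of y y'] alpha_pos by (simp add: c_def)
      thus ?thesis unfolding k_eq c_def by (simp add: field_simps)
    qed
    hence "(k c)\<^sup>2 \<le> ((k y + k y') / 2)\<^sup>2" using True nonpos[OF a] nonpos[OF b]
      by (metis abs_le_square_iff abs_of_nonpos neg_le_iff_le order_trans)
    also have "\<dots> \<le> ((k y)\<^sup>2 + (k y')\<^sup>2) / 2" unfolding avg
      using zero_le_power2[of "(k y - k y') / 2"] by linarith
    finally have "L c < ((k y)\<^sup>2 + (k y')\<^sup>2) / 2 + ((p y)\<^sup>2 + (p y')\<^sup>2) / 2"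
      unfolding L_decomp using sq by (rule add_le_less_mono)
    also have "\<dots> = (L y + L y') / 2" by (simp add: L_decomp field_simps)
    finally have "L c < (L y + L y') / 2" .
    thus False using a eq by (simp add: minimizer_def not_less[symmetric])
  next
    case False
    hence "u1 * k c < 0" using u1 by (simp add: mult_less_0_iff)
    from crossing[OF less_imp_neq[OF u1] this] obtain x where x: "k x = 0" "(p x)\<^sup>2 < (p c)\<^sup>2" .
    hence "L x < ((p y)\<^sup>2 + (p y')\<^sup>2) / 2" using sq by (simp add: L_decomp)
    also have "\<dots> \<le> (L y + L y') / 2" by (simp add: L_decomp)
    finally show False using a eq by (simp add: minimizer_def not_less[symmetric])
  qed
qed

end

section \<open>Aim point and miss distance\<close>

definition aim :: "state \<Rightarrow> real \<Rightarrow> complex" where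
  "aim z y = (posA z + posD z) / 2 + \<i> * of_real y * sgn (posA z - posD z)"

definition radius :: "state \<Rightarrow> real \<Rightarrow> real" where
  "radius z y = sqrt ((x_m z)\<^sup>2 + y\<^sup>2)"

definition miss :: "real \<Rightarrow> complex \<Rightarrow> state \<Rightarrow> real \<Rightarrow> complex" where
  "miss \<alpha> u z y = aim z y - posB z - of_real (\<alpha> * radius z y) * u"

definition best :: "real \<Rightarrow> complex \<Rightarrow> state \<Rightarrow> real \<Rightarrow> bool" where
  "best \<alpha> u z y \<longleftrightarrow> (\<forall>y'. cmod (miss \<alpha> u z y) \<le> cmod (miss \<alpha> u z y'))"

text \<open>An attacker that nobody disturbs can first capture the asset after flying the distance \<^term>\<open>\<rho>\<close>.\<close>

definition guarded :: "real \<Rightarrow> complex \<Rightarrow> state \<Rightarrow> bool" where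
  "guarded \<alpha> u z \<longleftrightarrow> (\<exists>\<rho>. cmod (posB z + of_real (\<alpha> * \<rho>) * u - posA z) = \<rho> \<and>
     cmod (posB z + of_real (\<alpha> * \<rho>) * u - posD z) < \<rho>)"

text \<open>The origin is the midpoint of the missiles, not the defender, so the real part differs
  from \<open>xB'\<close> by \<open>x_m\<close>.\<close>

definition relB :: "state \<Rightarrow> complex" where
  "relB z = cnj (sgn (posA z - posD z)) * (posB z - (posA z + posD z) / 2)"

definition relu :: "complex \<Rightarrow> state \<Rightarrow> complex" where
  "relu u z = cnj (sgn (posA z - posD z)) * u"

lemma x_m_pos: "posA z \<noteq> posD z \<Longrightarrow> 0 < x_m z"
  by (simp add: x_m_def xA'_def)

lemma sgn_unit: "w \<noteq> 0 \<Longrightarrow> cmod (sgn w) = 1" for w :: complex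
  by (simp add: norm_sgn)

lemma cnj_mult_unit: "cmod n = 1 \<Longrightarrow> cnj n * n = 1"
  by (metis complex_norm_square mult.commute of_real_1 one_power2)

lemma A_minus_D: "posA z - posD z = of_real (2 * x_m z) * sgn (posA z - posD z)"
  by (simp add: x_m_def xA'_def sgn_eq)

lemma aim_rel:
  "aim z y - posA z = sgn (posA z - posD z) * Complex (- x_m z) y"
  "aim z y - posD z = sgn (posA z - posD z) * Complex (x_m z) y"
proof -
  let ?n = "sgn (posA z - posD z)"
  have h: "(posA z - posD z) / 2 = of_real (x_m z) * ?n"
    using arg_cong[OF A_minus_D[of z], of "\<lambda>w. w / 2"] by simp
  have "aim z y - posA z = - ((posA z - posD z) / 2) + \<i> * of_real y * ?n"
    "aim z y - posD z = (posA z - posD z) / 2 + \<i> * of_real y * ?n"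
    by (simp_all add: aim_def field_simps)
  thus "aim z y - posA z = ?n * Complex (- x_m z) y" "aim z y - posD z = ?n * Complex (x_m z) y"
    unfolding h Complex_eq by (simp_all add: algebra_simps)
qed

lemma aim_dist:
  assumes "posA z \<noteq> posD z"
  shows "cmod (aim z y - posA z) = radius z y" "cmod (aim z y - posD z) = radius z y"
  unfolding aim_rel norm_mult using sgn_unit[of "posA z - posD z"] assms
  by (simp_all add: radius_def cmod_def)

context
  fixes \<alpha> :: real and u :: complex and z :: state
  assumes alpha: "0 < \<alpha>" "\<alpha> < 1" and u: "cmod u = 1" and AD: "posA z \<noteq> posD z"
begin

abbreviation (input) "los \<equiv> sgn (posA z - posD z)"

lemma n_unit: "cmod los = 1" "cnj los * los = 1"
  using sgn_unit cnj_mult_unit AD by auto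

lemma frame_state: "frame \<alpha> (x_m z) (Re (relu u z)) (Im (relu u z))"
proof
  have "cmod (relu u z) = 1" unfolding relu_def by (simp add: norm_mult n_unit u)
  thus "(Re (relu u z))\<^sup>2 + (Im (relu u z))\<^sup>2 = 1" by (simp add: cmod_def)
qed (use alpha x_m_pos[OF AD] in auto)

interpretation frame \<alpha> "x_m z" "Re (relB z)" "Im (relB z)" "Re (relu u z)" "Im (relu u z)"
  by (rule frame_state)

lemma miss_frame: "cnj los * miss \<alpha> u z y = Complex (w1 y) (w2 y)"
proof -
  have "cnj los * miss \<alpha> u z y = cnj los * ((posA z + posD z) / 2) + \<i> * of_real y * (cnj los * los) - cnj los * posB z
     - of_real (\<alpha> * radius z y) * (cnj los * u)"
    unfolding miss_def aim_def by (simp add: algebra_simps)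
  also have "\<dots> = \<i> * of_real y - relB z - of_real (\<alpha> * radius z y) * relu u z"
    unfolding n_unit relB_def relu_def by (simp add: algebra_simps)
  also have "radius z y = r y" by (simp add: radius_def r_def)
  finally show ?thesis by (simp add: complex_eq_iff w1_def w2_def)
qed

lemma cmod_miss: "cmod (miss \<alpha> u z y) = sqrt (L y)"
proof -
  have "cmod (miss \<alpha> u z y) = cmod (cnj los * miss \<alpha> u z y)" by (simp add: norm_mult n_unit)
  thus ?thesis unfolding miss_frame by (simp add: L_def cmod_def)
qed

lemma best_iff: "best \<alpha> u z y \<longleftrightarrow> minimizer y"
  by (simp add: best_def minimizer_def cmod_miss)

lemma best_exists: "\<exists>y. best \<alpha> u z y"
  using minimizer_exists best_iff by blast

lemma rel_point:
  "cmod (posB z + of_real (\<alpha> * \<rho>) * u - posA z) =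
     cmod (Complex (Re (relB z) + \<alpha> * \<rho> * Re (relu u z) - x_m z) (Im (relB z) + \<alpha> * \<rho> * Im (relu u z)))"
  "cmod (posB z + of_real (\<alpha> * \<rho>) * u - posD z) =
     cmod (Complex (Re (relB z) + \<alpha> * \<rho> * Re (relu u z) + x_m z) (Im (relB z) + \<alpha> * \<rho> * Im (relu u z)))"
proof -
  have AD': "cnj los * (posA z - posD z) = of_real (2 * x_m z)"
    using A_minus_D[of z] n_unit by (metis mult.left_commute mult.right_neutral)
  have e: "cnj los * (posB z + of_real (\<alpha> * \<rho>) * u - (posA z + posD z) / 2 + of_real (s / 2) * (posA z - posD z))
     = relB z + of_real (\<alpha> * \<rho>) * relu u z + of_real s * x_m z" for s
  proof -
    have "cnj los * (posB z + of_real (\<alpha> * \<rho>) * u - (posA z + posD z) / 2 + of_real (s / 2) * (posA z - posD z))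
     = relB z + of_real (\<alpha> * \<rho>) * relu u z + of_real (s / 2) * (cnj los * (posA z - posD z))"
    proof -
      have gen: "cnj los * (P + q * u - M + c * E) = cnj los * (P - M) + q * (cnj los * u) + c * (cnj los * E)" for P q M c E
        by (simp add: algebra_simps)
      show ?thesis unfolding relB_def relu_def by (rule gen)
    qed
    thus ?thesis unfolding AD' by simp
  qed
  have nm: "cmod w = cmod (cnj los * w)" for w by (simp add: norm_mult n_unit)
  have "cmod (posB z + of_real (\<alpha> * \<rho>) * u - posA z) = cmod (relB z + of_real (\<alpha> * \<rho>) * relu u z + of_real (-1) * x_m z)"
    unfolding e[symmetric] nm[symmetric] by (rule arg_cong[where f=cmod]) (simp add: field_simps)
  also have "relB z + of_real (\<alpha> * \<rho>) * relu u z + of_real (-1) * x_m z =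
    Complex (Re (relB z) + \<alpha> * \<rho> * Re (relu u z) - x_m z) (Im (relB z) + \<alpha> * \<rho> * Im (relu u z))"
    by (simp add: complex_eq_iff)
  finally show "cmod (posB z + of_real (\<alpha> * \<rho>) * u - posA z) =
     cmod (Complex (Re (relB z) + \<alpha> * \<rho> * Re (relu u z) - x_m z) (Im (relB z) + \<alpha> * \<rho> * Im (relu u z)))" .
  have "cmod (posB z + of_real (\<alpha> * \<rho>) * u - posD z) = cmod (relB z + of_real (\<alpha> * \<rho>) * relu u z + of_real 1 * x_m z)"
    unfolding e[symmetric] nm[symmetric] by (rule arg_cong[where f=cmod]) (simp add: field_simps)
  also have "relB z + of_real (\<alpha> * \<rho>) * relu u z + of_real 1 * x_m z =
    Complex (Re (relB z) + \<alpha> * \<rho> * Re (relu u z) + x_m z) (Im (relB z) + \<alpha> * \<rho> * Im (relu u z))"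
    by (simp add: complex_eq_iff)
  finally show "cmod (posB z + of_real (\<alpha> * \<rho>) * u - posD z) =
     cmod (Complex (Re (relB z) + \<alpha> * \<rho> * Re (relu u z) + x_m z) (Im (relB z) + \<alpha> * \<rho> * Im (relu u z)))" .
qed

lemma closer_to_D_iff:
  "cmod (posB z + of_real (\<alpha> * \<rho>) * u - posD z) < cmod (posB z + of_real (\<alpha> * \<rho>) * u - posA z)
     \<longleftrightarrow> Re (relB z) + \<alpha> * \<rho> * Re (relu u z) < 0"
  "cmod (posB z + of_real (\<alpha> * \<rho>) * u - posD z) = cmod (posB z + of_real (\<alpha> * \<rho>) * u - posA z)
     \<longleftrightarrow> Re (relB z) + \<alpha> * \<rho> * Re (relu u z) = 0"
proof -
  have *: "(x + x_m z)\<^sup>2 < (x - x_m z)\<^sup>2 \<longleftrightarrow> x < 0" "(x + x_m z)\<^sup>2 = (x - x_m z)\<^sup>2 \<longleftrightarrow> x = 0" for x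
  proof -
    have "(x + x_m z)\<^sup>2 - (x - x_m z)\<^sup>2 = 4 * x_m z * x" by (simp add: power2_eq_square algebra_simps)
    thus "(x + x_m z)\<^sup>2 < (x - x_m z)\<^sup>2 \<longleftrightarrow> x < 0" "(x + x_m z)\<^sup>2 = (x - x_m z)\<^sup>2 \<longleftrightarrow> x = 0"
      using m_pos by (smt (verit) mult_less_0_iff mult_eq_0_iff)+
  qed
  show "cmod (posB z + of_real (\<alpha> * \<rho>) * u - posD z) < cmod (posB z + of_real (\<alpha> * \<rho>) * u - posA z)
     \<longleftrightarrow> Re (relB z) + \<alpha> * \<rho> * Re (relu u z) < 0"
    unfolding rel_point by (simp add: cmod_def *)
  show "cmod (posB z + of_real (\<alpha> * \<rho>) * u - posD z) = cmod (posB z + of_real (\<alpha> * \<rho>) * u - posA z)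
     \<longleftrightarrow> Re (relB z) + \<alpha> * \<rho> * Re (relu u z) = 0"
    unfolding rel_point by (simp add: cmod_def *)
qed

lemma guarded_frame_state:
  assumes "guarded \<alpha> u z"
  obtains \<rho> where "guarded_frame \<alpha> (x_m z) (Re (relB z)) (Im (relB z)) (Re (relu u z)) (Im (relu u z)) \<rho>"
proof -
  from assms obtain \<rho> where \<rho>: "cmod (posB z + of_real (\<alpha> * \<rho>) * u - posA z) = \<rho>"
     "cmod (posB z + of_real (\<alpha> * \<rho>) * u - posD z) < \<rho>" unfolding guarded_def by blast
  have "capture \<rho>" using \<rho>(1) unfolding capture_def rel_point .
  moreover have "Re (relB z) + \<alpha> * \<rho> * Re (relu u z) < 0" using \<rho> closer_to_D_iff(1)[of \<rho>] by simp
  ultimately show thesis by (intro that[of \<rho>]) (unfold_locales)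
qed

lemma guarded_miss_pos:
  assumes "guarded \<alpha> u z"
  shows "0 < cmod (miss \<alpha> u z y)"
proof -
  from guarded_frame_state[OF assms] obtain \<rho> where
    "guarded_frame \<alpha> (x_m z) (Re (relB z)) (Im (relB z)) (Re (relu u z)) (Im (relu u z)) \<rho>" .
  from guarded_frame.L_pos[OF this] show ?thesis unfolding cmod_miss by simp
qed

lemma best_unique:
  assumes "guarded \<alpha> u z" "Re (relu u z) < 0" "best \<alpha> u z y" "best \<alpha> u z y'"
  shows "y = y'"
proof -
  from guarded_frame_state[OF assms(1)] obtain \<rho> where
    "guarded_frame \<alpha> (x_m z) (Re (relB z)) (Im (relB z)) (Re (relu u z)) (Im (relu u z)) \<rho>" .
  from guarded_frame.minimizer_unique[OF this] show ?thesis using assms best_iff by blast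
qed

text \<open>Subtracting a multiple of the heading changes only the along-track component, so this is
  \<open>minimizer_le_delayed\<close> without coordinates.\<close>

lemma best_le_delayed:
  assumes "guarded \<alpha> u z" "Re (relu u z) < 0" "best \<alpha> u z y" "0 \<le> e"
  shows "cmod (miss \<alpha> u z y) \<le> cmod (miss \<alpha> u z y' - of_real e * u)"
proof -
  from guarded_frame_state[OF assms(1)] obtain \<rho> where
    gf: "guarded_frame \<alpha> (x_m z) (Re (relB z)) (Im (relB z)) (Re (relu u z)) (Im (relu u z)) \<rho>" .
  have "minimizer y" using assms(3) best_iff by simp
  from guarded_frame.minimizer_le_delayed[OF gf assms(2) this assms(4)]
  have le: "L y \<le> (k y' - e)\<^sup>2 + (p y')\<^sup>2" .
  have "cnj los * (miss \<alpha> u z y' - of_real e * u) = cnj los * miss \<alpha> u z y' - of_real e * relu u z"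
    by (simp add: relu_def algebra_simps)
  also have "\<dots> = Complex (w1 y' - e * Re (relu u z)) (w2 y' - e * Im (relu u z))"
    unfolding miss_frame by (simp add: complex_eq_iff)
  finally have "(cmod (cnj los * (miss \<alpha> u z y' - of_real e * u)))\<^sup>2
      = (w1 y' - e * Re (relu u z))\<^sup>2 + (w2 y' - e * Im (relu u z))\<^sup>2"
    by (simp only: cmod_power2 complex.sel)
  hence "(cmod (cnj los * (miss \<alpha> u z y' - of_real e * u)))\<^sup>2
      = L y' - 2 * e * k y' + e\<^sup>2 * ((Re (relu u z))\<^sup>2 + (Im (relu u z))\<^sup>2)"
    by (simp add: L_def k_def power2_eq_square algebra_simps)
  also have "\<dots> = (k y' - e)\<^sup>2 + (p y')\<^sup>2" unfolding unit L_decomp by (simp add: power2_eq_square algebra_simps)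
  finally have "(cmod (miss \<alpha> u z y' - of_real e * u))\<^sup>2 = (k y' - e)\<^sup>2 + (p y')\<^sup>2"
    by (simp add: norm_mult n_unit)
  hence "sqrt (L y) \<le> sqrt ((cmod (miss \<alpha> u z y' - of_real e * u))\<^sup>2)" using le by (intro real_sqrt_le_mono) simp
  thus ?thesis unfolding cmod_miss by simp
qed

text \<open>A capture point that is equidistant from the missiles is itself a possible aim point,
  and flying to it hits the asset. Hence the value vanishes on the boundary of the guarded
  states.\<close>

lemma capture_on_bisector:
  assumes "cmod (posB z + of_real (\<alpha> * \<rho>) * u - posA z) = \<rho>" "cmod (posB z + of_real (\<alpha> * \<rho>) * u - posD z) = \<rho>"
  shows "\<exists>y. miss \<alpha> u z y = 0"
proof -
  have b: "Re (relB z) + \<alpha> * \<rho> * Re (relu u z) = 0" using closer_to_D_iff(2)[of \<rho>] assms by simp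
  define y where "y = Im (relB z) + \<alpha> * \<rho> * Im (relu u z)"
  have "\<rho> = r y" using assms(1) unfolding rel_point b by (simp add: r_def cmod_def y_def)
  hence "w1 y = 0" "w2 y = 0" unfolding w1_def w2_def using b by (simp_all add: y_def)
  hence "cmod (miss \<alpha> u z y) = 0" unfolding cmod_miss L_def by simp
  thus ?thesis by auto
qed

text \<open>The slower asset cannot carry the interception far away: a remote aim point has a large
  miss. This keeps best aim points bounded along trajectories.\<close>

lemma radius_le: "(1 - \<alpha>) * radius z y \<le> cmod (miss \<alpha> u z y) + cmod (posA z - posB z)"
proof -
  have rad: "cmod (aim z y - posA z) = radius z y" by (rule aim_dist(1)[OF AD])
  have "aim z y - posA z = miss \<alpha> u z y - (posA z - posB z) + of_real (\<alpha> * radius z y) * u"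
    unfolding miss_def by simp
  hence "radius z y \<le> cmod (miss \<alpha> u z y - (posA z - posB z)) + cmod (of_real (\<alpha> * radius z y) * u)"
    using rad norm_triangle_ineq by metis
  also have "cmod (of_real (\<alpha> * radius z y) * u) = \<alpha> * radius z y"
    using alpha u by (simp add: norm_mult radius_def)
  also have "cmod (miss \<alpha> u z y - (posA z - posB z)) \<le> cmod (miss \<alpha> u z y) + cmod (posA z - posB z)"
    by (rule norm_triangle_ineq4)
  finally show ?thesis by (simp add: algebra_simps)
qed

end

context frame
begin

text \<open>Squaring the stationarity condition removes the root \<^term>\<open>r y\<close> and leaves the quartic.\<close>

lemma stationary_squared:
  assumes "minimizer y"
  shows "(m\<^sup>2 + y\<^sup>2) * ((1 + \<alpha>\<^sup>2) * y - b2)\<^sup>2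
    = \<alpha>\<^sup>2 * (u2 * m\<^sup>2 + 2 * u2 * y\<^sup>2 - (u1 * b1 + u2 * b2) * y)\<^sup>2"
proof -
  have "r y * w2 y = \<alpha> * k y * y" using stationary[OF assms] r_pos[of y] by simp
  hence "r y * (y - b2) - \<alpha> * (r y)\<^sup>2 * u2 = \<alpha> * (u2 * (y - b2) - u1 * b1 - \<alpha> * r y) * y"
    unfolding w2_def k_eq by (simp add: algebra_simps power2_eq_square)
  hence "r y * ((1 + \<alpha>\<^sup>2) * y - b2) = \<alpha> * (u2 * (m\<^sup>2 + y\<^sup>2) + (u2 * (y - b2) - u1 * b1) * y)"
    unfolding r_sq by (simp add: algebra_simps power2_eq_square)
  also have "\<dots> = \<alpha> * (u2 * m\<^sup>2 + 2 * u2 * y\<^sup>2 - (u1 * b1 + u2 * b2) * y)"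
    by (simp add: algebra_simps power2_eq_square)
  finally have "(r y * ((1 + \<alpha>\<^sup>2) * y - b2))\<^sup>2 = (\<alpha> * (u2 * m\<^sup>2 + 2 * u2 * y\<^sup>2 - (u1 * b1 + u2 * b2) * y))\<^sup>2"
    by simp
  thus ?thesis by (simp only: power_mult_distrib r_sq)
qed

end

section \<open>Relative coordinates, cost function and quartic\<close>

lemma cis_lam_A: "posA z \<noteq> posD z \<Longrightarrow> cis (lam_A z) = sgn (posA z - posD z)"
  by (simp add: lam_A_def cis_Arg)

lemma relu_cis: "posA z \<noteq> posD z \<Longrightarrow> relu (cis th) z = cis (th - lam_A z)"
  by (simp add: relu_def cis_lam_A[symmetric] cis_cnj cis_mult)

lemma relB_coords:
  assumes "posA z \<noteq> posD z"
  shows "xB' z = x_m z + Re (relB z)" "yB' z = Im (relB z)"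
proof -
  have d: "of_real (d_B z) * cis (lam_B z) = posB z - posD z"
    using rcis_cmod_Arg[of "posB z - posD z"] by (simp add: d_B_def lam_B_def rcis_def)
  have "Complex (xB' z) (yB' z) = of_real (d_B z) * cis (lam_B z - lam_A z)"
    by (simp add: complex_eq_iff xB'_def yB'_def)
  also have "\<dots> = cnj (cis (lam_A z)) * (of_real (d_B z) * cis (lam_B z))"
    by (simp add: cis_cnj cis_mult)
  also have "\<dots> = cnj (sgn (posA z - posD z)) * (posB z - posD z)"
    unfolding d cis_lam_A[OF assms] ..
  also have "\<dots> = relB z + cnj (sgn (posA z - posD z)) * (posA z - posD z) / 2"
    unfolding relB_def by (simp add: field_simps)
  also have "cnj (sgn (posA z - posD z)) * (posA z - posD z) = of_real (2 * x_m z)"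
    using A_minus_D[of z] cnj_mult_unit[OF sgn_unit] assms
    by (metis mult.left_commute mult.right_neutral right_minus_eq)
  finally have "Complex (xB' z) (yB' z) = relB z + of_real (x_m z)" by simp
  thus "xB' z = x_m z + Re (relB z)" "yB' z = Im (relB z)" by (simp_all add: complex_eq_iff)
qed

context
  fixes \<alpha> :: real and \<theta>B :: real and z :: state
  assumes alpha: "0 < \<alpha>" "\<alpha> < 1" and AD: "posA z \<noteq> posD z"
begin

interpretation frame \<alpha> "x_m z" "Re (relB z)" "Im (relB z)" "Re (relu (cis \<theta>B) z)" "Im (relu (cis \<theta>B) z)"
  by (rule frame_state) (use alpha AD in auto)

abbreviation (input) "heading \<equiv> relu (cis \<theta>B) z"

lemma phi_trig: "sin (phi \<theta>B z) = - Re heading" "cos (phi \<theta>B z) = Im heading"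
proof -
  have p: "phi \<theta>B z = (\<theta>B - lam_A z) - pi / 2" by (simp add: phi_def)
  show "sin (phi \<theta>B z) = - Re heading" "cos (phi \<theta>B z) = Im heading"
    unfolding p relu_cis[OF AD] by (simp_all add: sin_diff cos_diff)
qed

lemma d_m_rel: "d_m \<theta>B z = Re (relB z) / Re heading"
  by (simp add: d_m_def phi_trig relB_coords[OF AD])

lemma y_m_rel: "y_m \<theta>B z = Im (relB z) - d_m \<theta>B z * Im heading"
  by (simp add: y_m_def phi_trig relB_coords[OF AD])

lemma unit': "(Re heading)\<^sup>2 = 1 - (Im heading)\<^sup>2"
  using unit by simp

text \<open>If the asset moves parallel to the bisector, both sides are 0 under the convention for
  division by 0. The product with the squared component therefore needs no case distinction.\<close>

lemma d_m_scaled: "d_m \<theta>B z * (1 - (Im heading)\<^sup>2) = Re heading * Re (relB z)"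
  unfolding unit'[symmetric] d_m_rel by (simp add: power2_eq_square)

text \<open>The cost is the law of cosines in the triangle whose vertices are the aim point, the
  asset at the time of interception, and the intersection of the asset's line with the bisector:
  \<open>d_m\<close> is the signed distance of the asset from that intersection and
  \<open>y_m\<close> its ordinate. In the parallel case there is no intersection; with
  \<open>d_m = 0\<close> only the constant distance of the asset from the bisector is lost.\<close>

lemma cost_J_miss:
  "cost_J \<alpha> \<theta>B z y = (cmod (miss \<alpha> (cis \<theta>B) z y))\<^sup>2 - (if Re heading = 0 then (Re (relB z))\<^sup>2 else 0)"
proof -
  define d R U where "d = d_m \<theta>B z" and "R = r y" and "U = Im heading"
  have J: "cost_J \<alpha> \<theta>B z y = (d + \<alpha> * R)\<^sup>2 + (y - (Im (relB z) - d * U))\<^sup>2 - 2 * (y - (Im (relB z) - d * U)) * (d + \<alpha> * R) * U"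
    by (simp add: cost_J_def phi_trig y_m_rel d_def R_def U_def r_def)
  also have "\<dots> = (d + \<alpha> * R)\<^sup>2 * (1 - U\<^sup>2) + (y - Im (relB z) - \<alpha> * R * U)\<^sup>2"
    by (simp add: power2_eq_square algebra_simps)
  also have "(d + \<alpha> * R)\<^sup>2 * (1 - U\<^sup>2) = (w1 y)\<^sup>2 - (if Re heading = 0 then (Re (relB z))\<^sup>2 else 0)"
  proof (cases "Re heading = 0")
    case True
    have "w1 y = - Re (relB z)" unfolding w1_def using True by (simp only: mult_zero_right add_0_right)
    thus ?thesis using unit' True by (simp add: U_def)
  next
    case False
    have "(d + \<alpha> * R)\<^sup>2 * (Re heading)\<^sup>2 = (w1 y)\<^sup>2"
      unfolding power_mult_distrib[symmetric] w1_def power2_minus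
      using False by (simp add: d_def d_m_rel R_def algebra_simps)
    thus ?thesis using False by (simp add: U_def unit')
  qed
  also have "y - Im (relB z) - \<alpha> * R * U = w2 y" by (simp add: w2_def R_def U_def)
  finally have "cost_J \<alpha> \<theta>B z y = L y - (if Re heading = 0 then (Re (relB z))\<^sup>2 else 0)" by (simp add: L_def)
  moreover have "(cmod (miss \<alpha> (cis \<theta>B) z y))\<^sup>2 = L y"
    using cmod_miss[OF alpha _ AD] by (simp add: L_def)
  ultimately show ?thesis by simp
qed

text \<open>The quartic is the difference of the two sides of \<open>stationary_squared\<close>,
  written in terms of \<open>d_m\<close> and \<open>y_m\<close>.\<close>

lemma best_quartic_root:
  assumes "best \<alpha> (cis \<theta>B) z y"
  shows "quartic_root \<alpha> \<theta>B z y"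
proof -
  define d U m where "d = d_m \<theta>B z" and "U = Im heading" and "m = x_m z"
  have "minimizer y" using assms best_iff[OF alpha _ AD] by simp
  from stationary_squared[OF this]
  have sq: "(m\<^sup>2 + y\<^sup>2) * ((1 + \<alpha>\<^sup>2) * y - Im (relB z))\<^sup>2 = \<alpha>\<^sup>2 * (U * m\<^sup>2 + 2 * U * y\<^sup>2 - (d * (1 - U\<^sup>2) + U * Im (relB z)) * y)\<^sup>2"
    by (simp add: U_def d_def d_m_scaled m_def)
  have "c4 \<alpha> \<theta>B z * y^4 + 2 * c3 \<alpha> \<theta>B z * y^3 + c2 \<alpha> \<theta>B z * y^2 + 2 * c1 \<alpha> \<theta>B z * y + c0 \<alpha> \<theta>B z
    = \<alpha>\<^sup>2 * (U * m\<^sup>2 + 2 * U * y\<^sup>2 - (d * (1 - U\<^sup>2) + U * Im (relB z)) * y)\<^sup>2 - (m\<^sup>2 + y\<^sup>2) * ((1 + \<alpha>\<^sup>2) * y - Im (relB z))\<^sup>2"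
    unfolding c4_def c3_def c2_def c1_def c0_def phi_trig y_m_rel relB_coords[OF AD] power2_minus unit'
      d_def[symmetric] U_def[symmetric] m_def[symmetric]
    by algebra
  thus ?thesis unfolding quartic_root_def using sq by simp
qed

text \<open>Squaring may add roots that are not stationary points. They do no harm: the global
  minimizers are among the roots, so minimizing over the roots and over the whole bisector is the
  same.\<close>

lemma arg_min_iff_best:
  "is_arg_min (cost_J \<alpha> \<theta>B z) (quartic_root \<alpha> \<theta>B z) y \<longleftrightarrow> best \<alpha> (cis \<theta>B) z y"
proof -
  have le: "cost_J \<alpha> \<theta>B z y \<le> cost_J \<alpha> \<theta>B z y' \<longleftrightarrow> cmod (miss \<alpha> (cis \<theta>B) z y) \<le> cmod (miss \<alpha> (cis \<theta>B) z y')" for y y'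
    unfolding cost_J_miss by (simp add: abs_le_square_iff[symmetric])
  obtain y0 where y0: "best \<alpha> (cis \<theta>B) z y0" using best_exists[OF alpha norm_cis AD] by blast
  show ?thesis
    unfolding is_arg_min_linorder
    using y0 best_quartic_root le unfolding best_def by (meson order_trans)
qed

text \<open>Minimality holds at every state with distinct missiles, whether or not the minimizer is
  unique; ties are resolved by the choice operator.\<close>

lemma y_star_best: "best \<alpha> (cis \<theta>B) z (y_star \<alpha> \<theta>B z)"
proof -
  obtain y0 where y0: "best \<alpha> (cis \<theta>B) z y0" using best_exists[OF alpha norm_cis AD] by blast
  hence "is_arg_min (cost_J \<alpha> \<theta>B z) (quartic_root \<alpha> \<theta>B z) y0" using arg_min_iff_best by simp
  hence "is_arg_min (cost_J \<alpha> \<theta>B z) (quartic_root \<alpha> \<theta>B z) (y_star \<alpha> \<theta>B z)"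
    unfolding y_star_def arg_min_def by (rule someI)
  thus ?thesis using arg_min_iff_best by simp
qed

end

section \<open>Capture point and range of headings\<close>

text \<open>The nonnegative root \<rho> of the quadratic equation obtained by squaring the condition
  that the asset, after advancing by \<alpha> \<rho>, is at distance \<rho> from the attacker's
  present position. The closed formula makes continuity in the state evident.\<close>

definition capture_distance :: "real \<Rightarrow> complex \<Rightarrow> state \<Rightarrow> real" where
  "capture_distance \<alpha> u z =
     (\<alpha> * ((posB z - posA z) \<bullet> u) + sqrt ((\<alpha> * ((posB z - posA z) \<bullet> u))\<^sup>2 + (1 - \<alpha>\<^sup>2) * (cmod (posB z - posA z))\<^sup>2))
       / (1 - \<alpha>\<^sup>2)"

definition capture_point :: "real \<Rightarrow> complex \<Rightarrow> state \<Rightarrow> complex" where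
  "capture_point \<alpha> u z = posB z + of_real (\<alpha> * capture_distance \<alpha> u z) * u"

context
  fixes \<alpha> :: real and u :: complex
  assumes alpha: "0 < \<alpha>" "\<alpha> < 1" and u: "cmod u = 1"
begin

lemma capture_distance:
  "cmod (posB z + of_real (\<alpha> * capture_distance \<alpha> u z) * u - posA z) = capture_distance \<alpha> u z"
  "0 \<le> capture_distance \<alpha> u z"
proof -
  define \<delta> \<beta> \<rho> where "\<delta> = posB z - posA z" and "\<beta> = \<delta> \<bullet> u" and "\<rho> = capture_distance \<alpha> u z"
  have a: "1 - \<alpha>\<^sup>2 > 0" using alpha by (simp add: power_less_one_iff abs_square_less_1)
  let ?R = "(\<alpha> * \<beta>)\<^sup>2 + (1 - \<alpha>\<^sup>2) * (cmod \<delta>)\<^sup>2"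
  have R: "?R \<ge> (\<alpha> * \<beta>)\<^sup>2" using a by simp
  hence R0: "?R \<ge> 0" by (meson order_trans zero_le_power2)
  have "sqrt ?R \<ge> \<bar>\<alpha> * \<beta>\<bar>" using R by (metis real_sqrt_abs real_sqrt_le_iff)
  hence num: "\<alpha> * \<beta> + sqrt ?R \<ge> 0" by linarith
  have \<rho>: "(1 - \<alpha>\<^sup>2) * \<rho> = \<alpha> * \<beta> + sqrt ?R"
    using a by (simp add: \<rho>_def capture_distance_def \<beta>_def \<delta>_def)
  show r0: "0 \<le> capture_distance \<alpha> u z"
    using num a unfolding capture_distance_def \<beta>_def \<delta>_def by simp
  have "((1 - \<alpha>\<^sup>2) * \<rho> - \<alpha> * \<beta>)\<^sup>2 = ?R" unfolding \<rho> using R0 by simp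
  hence "(1 - \<alpha>\<^sup>2) * ((1 - \<alpha>\<^sup>2) * \<rho>\<^sup>2 - 2 * \<alpha> * \<beta> * \<rho> - (cmod \<delta>)\<^sup>2) = 0"
    by (simp add: power2_eq_square algebra_simps)
  hence "(1 - \<alpha>\<^sup>2) * \<rho>\<^sup>2 - 2 * \<alpha> * \<beta> * \<rho> - (cmod \<delta>)\<^sup>2 = 0"
    using a by (metis less_irrefl mult_eq_0_iff)
  hence q: "(cmod \<delta>)\<^sup>2 + 2 * \<alpha> * \<beta> * \<rho> + \<alpha>\<^sup>2 * \<rho>\<^sup>2 = \<rho>\<^sup>2" by (simp add: algebra_simps)
  have "(cmod (\<delta> + (\<alpha> * \<rho>) *\<^sub>R u))\<^sup>2 = (cmod \<delta>)\<^sup>2 + 2 * (\<alpha> * \<rho>) * \<beta> + (\<alpha> * \<rho>)\<^sup>2 * (cmod u)\<^sup>2"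
    unfolding power2_norm_eq_inner \<beta>_def by (simp add: inner_add_left inner_add_right inner_commute power2_eq_square)
  hence "(cmod (\<delta> + (\<alpha> * \<rho>) *\<^sub>R u))\<^sup>2 = \<rho>\<^sup>2" using q u by (simp add: power_mult_distrib algebra_simps)
  hence "cmod (\<delta> + (\<alpha> * \<rho>) *\<^sub>R u) = \<rho>" using r0 by (simp add: \<rho>_def power2_eq_iff_nonneg)
  thus "cmod (posB z + of_real (\<alpha> * capture_distance \<alpha> u z) * u - posA z) = capture_distance \<alpha> u z"
    by (simp add: \<delta>_def \<rho>_def scaleR_conv_of_real algebra_simps)
qed

lemma capture_distance_le:
  assumes "cmod (posB z + of_real (\<alpha> * \<sigma>) * u - posA z) \<le> \<sigma>"
  shows "capture_distance \<alpha> u z \<le> \<sigma>"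
proof (rule capture_le[OF u alpha])
  show "cmod (posB z - posA z + (\<alpha> * capture_distance \<alpha> u z) *\<^sub>R u) = capture_distance \<alpha> u z"
    using capture_distance(1)[of z] by (simp add: scaleR_conv_of_real algebra_simps)
  show "cmod (posB z - posA z + (\<alpha> * \<sigma>) *\<^sub>R u) \<le> \<sigma>"
    using assms by (simp add: scaleR_conv_of_real algebra_simps)
qed

lemma capture_distance_ge:
  assumes "\<sigma> \<le> cmod (posB z + of_real (\<alpha> * \<sigma>) * u - posA z)"
  shows "\<sigma> \<le> capture_distance \<alpha> u z"
proof (rule capture_ge[OF u alpha])
  show "cmod (posB z - posA z + (\<alpha> * capture_distance \<alpha> u z) *\<^sub>R u) = capture_distance \<alpha> u z"
    using capture_distance(1)[of z] by (simp add: scaleR_conv_of_real algebra_simps)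
  show "\<sigma> \<le> cmod (posB z - posA z + (\<alpha> * \<sigma>) *\<^sub>R u)"
    using assms by (simp add: scaleR_conv_of_real algebra_simps)
qed

lemma capture_point_dist: "cmod (capture_point \<alpha> u z - posA z) = capture_distance \<alpha> u z"
  using capture_distance(1)[of z] by (simp add: capture_point_def)

lemma guarded_iff: "guarded \<alpha> u z \<longleftrightarrow> cmod (capture_point \<alpha> u z - posD z) < capture_distance \<alpha> u z"
proof
  assume "guarded \<alpha> u z"
  then obtain \<rho> where \<rho>: "cmod (posB z + of_real (\<alpha> * \<rho>) * u - posA z) = \<rho>"
     "cmod (posB z + of_real (\<alpha> * \<rho>) * u - posD z) < \<rho>" unfolding guarded_def by blast
  have "\<rho> = capture_distance \<alpha> u z"
    using capture_distance_le[of z \<rho>] capture_distance_ge[of \<rho> z] \<rho>(1) by simp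
  thus "cmod (capture_point \<alpha> u z - posD z) < capture_distance \<alpha> u z"
    using \<rho>(2) by (simp add: capture_point_def)
next
  assume "cmod (capture_point \<alpha> u z - posD z) < capture_distance \<alpha> u z"
  thus "guarded \<alpha> u z" unfolding guarded_def
    using capture_distance(1)[of z] by (auto simp: capture_point_def)
qed

lemma not_guarded_at_capture: "posA z = posB z \<Longrightarrow> \<not> guarded \<alpha> u z"
  unfolding guarded_iff by (simp add: capture_distance_def)

lemma capture_distance_cont:
  assumes "continuous_on T (\<lambda>t. posA (x t))" "continuous_on T (\<lambda>t. posB (x t))"
  shows "continuous_on T (\<lambda>t. capture_distance \<alpha> u (x t))"
proof -
  have a: "1 - \<alpha>\<^sup>2 \<noteq> 0" using alpha by (simp add: power2_eq_1_iff)
  show ?thesis unfolding capture_distance_def by (intro continuous_intros assms) (use a in auto)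
qed

lemma capture_point_cont:
  assumes "continuous_on T (\<lambda>t. posA (x t))" "continuous_on T (\<lambda>t. posB (x t))"
  shows "continuous_on T (\<lambda>t. capture_point \<alpha> u (x t))"
  unfolding capture_point_def by (intro continuous_intros capture_distance_cont assms)

end

section \<open>Polar angles and the range of headings\<close>

lemma polar_angle_left:
  assumes "Re w < 0"
  shows "pi / 2 < polar_angle w" "polar_angle w < 3 * pi / 2"
proof -
  have "w \<noteq> 0" using assms by auto
  hence "cos (Arg w) = Re w / cmod w" by (metis cis.sel(1) Re_sgn cis_Arg)
  hence c: "cos (Arg w) < 0" using assms \<open>w \<noteq> 0\<close> by (simp add: divide_neg_pos)
  have b: "- pi < Arg w" "Arg w \<le> pi" using Arg_bounded by auto
  have "pi / 2 < Arg w" if "- pi / 2 \<le> Arg w"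
    using c cos_ge_zero[of "Arg w"] that by (rule_tac ccontr) auto
  thus "pi / 2 < polar_angle w" "polar_angle w < 3 * pi / 2"
    using b by (auto simp: polar_angle_def)
qed

lemma polar_angle_right:
  assumes "Re w > 0"
  shows "polar_angle w = arctan (Im w / Re w)"
  using arg_conv_arctan[OF assms] arctan_lbound[of "Im w / Re w"] by (simp add: polar_angle_def)

lemma polar_angle_vertical:
  "q > 0 \<Longrightarrow> polar_angle (Complex 0 q) = pi / 2" "q < 0 \<Longrightarrow> polar_angle (Complex 0 q) = - (pi / 2)"
proof -
  assume "q > 0"
  moreover have "Complex 0 q = rcis q (pi / 2)" by (simp add: rcis_def complex_eq_iff)
  ultimately have "Arg (Complex 0 q) = pi / 2" using Arg_rcis[of "pi / 2" q] by simp
  thus "polar_angle (Complex 0 q) = pi / 2" using pi_gt_zero unfolding polar_angle_def by (smt (verit) field_sum_of_halves)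
next
  assume "q < 0"
  moreover have "Complex 0 q = rcis (- q) (- (pi / 2))" by (simp add: rcis_def complex_eq_iff)
  ultimately have "Arg (Complex 0 q) = - (pi / 2)" using Arg_rcis[of "- (pi / 2)" "- q"] pi_gt_zero by (simp del: pi_gt_zero)
  thus "polar_angle (Complex 0 q) = - (pi / 2)" unfolding polar_angle_def by simp
qed

lemma cos_neg_left: "pi / 2 < t \<Longrightarrow> t < 3 * pi / 2 \<Longrightarrow> cos t < 0"
  using cos_gt_zero_pi[of "t - pi"] by (simp add: cos_diff)

text \<open>If the asset starts on the defender's side of the bisector, the range of headings is empty,
  except when the Apollonius circle touches the bisector. The asset then flies to the point of contact,
  where the attacker captures it.\<close>

lemma heading_range_recedes:
  assumes alpha: "0 < \<alpha>" "\<alpha> < 1" and AD: "posA z \<noteq> posD z"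
    and g: "guarded \<alpha> (cis \<theta>B) z" and S: "0 \<le> S_disc \<alpha> z"
    and range: "\<theta>B + 2 * pi * of_int k \<in> {theta_under \<alpha> z + lam_A z .. theta_over \<alpha> z + lam_A z}"
  shows "Re (relu (cis \<theta>B) z) < 0"
proof -
  define th where "th = \<theta>B + 2 * pi * of_int k - lam_A z"
  \<comment> \<open>The vectors with components \<open>p\<close> and \<open>q1\<close> or
    \<open>q2\<close> lead from the asset to the two points where the bisector meets the Apollonius
    circle of asset and attacker, the set of points whose distance from the asset is \<alpha> times
    that from the attacker.\<close>
  define m p b q1 q2 where "m = x_m z" and "p = - Re (relB z)" and "b = Im (relB z)"
    and "q1 = y_under \<alpha> z - b" and "q2 = y_over \<alpha> z - b"
  have a: "1 - \<alpha>\<^sup>2 > 0" using alpha by (simp add: power_less_one_iff abs_square_less_1)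
  have m: "m > 0" using x_m_pos[OF AD] by (simp add: m_def)
  have relu: "relu (cis \<theta>B) z = cis th"
  proof -
    have "th = (\<theta>B - lam_A z) + 2 * pi * of_int k" by (simp add: th_def)
    hence "cis th = cis (\<theta>B - lam_A z) * cis (2 * pi * of_int k)" by (simp only: cis_mult)
    thus ?thesis using relu_cis[OF AD] by (simp add: cis_multiple_2pi)
  qed
  have tu: "theta_under \<alpha> z = polar_angle (Complex p q1)" and to: "theta_over \<alpha> z = polar_angle (Complex p q2)"
    by (simp_all add: theta_under_def theta_over_def relB_coords[OF AD] p_def q1_def q2_def b_def)
  have th: "polar_angle (Complex p q1) \<le> th" "th \<le> polar_angle (Complex p q2)"
    using range unfolding tu to th_def by auto
  have SS: "S_disc \<alpha> z = \<alpha>\<^sup>2 * b\<^sup>2 - (1 - \<alpha>\<^sup>2) * (p\<^sup>2 - \<alpha>\<^sup>2 * m\<^sup>2)"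
  proof -
    have "xA' z = 2 * m" by (simp add: m_def x_m_def)
    thus ?thesis unfolding S_disc_def relB_coords[OF AD] m_def[symmetric] b_def[symmetric]
      by (simp add: p_def power2_eq_square algebra_simps)
  qed
  have q1: "q1 = (\<alpha>\<^sup>2 * b + sqrt (S_disc \<alpha> z)) / (1 - \<alpha>\<^sup>2)"
    and q2: "q2 = (\<alpha>\<^sup>2 * b - sqrt (S_disc \<alpha> z)) / (1 - \<alpha>\<^sup>2)"
    using a by (simp_all add: q1_def q2_def y_under_def y_over_def relB_coords[OF AD] b_def[symmetric] field_simps)
  consider "p < 0" | "p = 0" | "p > 0" by linarith
  thus ?thesis
  proof cases
    case 1
    \<comment> \<open>Both boundary vectors point to the defender's side, so all angles of the range
      lie strictly between pi/2 and 3pi/2.\<close>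
    have "cos th < 0"
      by (rule cos_neg_left) (use th polar_angle_left[of "Complex p q1"] polar_angle_left[of "Complex p q2"] 1 in auto)
    thus ?thesis unfolding relu by simp
  next
    case 2
    have "S_disc \<alpha> z = \<alpha>\<^sup>2 * b\<^sup>2 + (1 - \<alpha>\<^sup>2) * \<alpha>\<^sup>2 * m\<^sup>2" unfolding SS 2 by (simp add: algebra_simps)
    moreover have "(1 - \<alpha>\<^sup>2) * \<alpha>\<^sup>2 * m\<^sup>2 > 0" using a m alpha by simp
    moreover have "(\<alpha>\<^sup>2 * b)\<^sup>2 \<le> \<alpha>\<^sup>2 * b\<^sup>2"
    proof -
      have "\<alpha>\<^sup>2 * (\<alpha>\<^sup>2 * b\<^sup>2) \<le> 1 * (\<alpha>\<^sup>2 * b\<^sup>2)" using a by (intro mult_right_mono) auto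
      thus ?thesis by (simp add: power_mult_distrib power2_eq_square[of "\<alpha>\<^sup>2"] mult.assoc)
    qed
    \<comment> \<open>The asset sits on the bisector strictly between the two intersections. The
      range would have to run from pi/2 up to -pi/2.\<close>
    ultimately have "(\<alpha>\<^sup>2 * b)\<^sup>2 < S_disc \<alpha> z" by linarith
    hence "\<bar>\<alpha>\<^sup>2 * b\<bar> < sqrt (S_disc \<alpha> z)" by (metis real_sqrt_abs real_sqrt_less_iff)
    hence "0 < q1" "q2 < 0" unfolding q1 q2 using a by (auto simp: divide_less_0_iff zero_less_divide_iff)
    hence "polar_angle (Complex p q1) = pi / 2" "polar_angle (Complex p q2) = - (pi / 2)"
      unfolding 2 by (simp_all only: polar_angle_vertical)
    thus ?thesis using th pi_gt_zero by linarith
  next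
    case 3
    have pa: "polar_angle (Complex p q) = arctan (q / p)" for q using polar_angle_right[of "Complex p q"] 3 by simp
    \<comment> \<open>The lower end of the range belongs to the upper intersection, so a nonempty
      range forces the two intersections to coincide.\<close>
    have "arctan (q1 / p) \<le> arctan (q2 / p)" using th unfolding pa by linarith
    hence "q1 \<le> q2" using 3 by (simp add: arctan_le_iff divide_le_cancel)
    hence "\<alpha>\<^sup>2 * b + sqrt (S_disc \<alpha> z) \<le> \<alpha>\<^sup>2 * b - sqrt (S_disc \<alpha> z)"
      unfolding q1 q2 using a by (simp add: divide_le_cancel)
    hence S0: "S_disc \<alpha> z = 0" using S real_sqrt_ge_zero[OF S] by simp
    have q: "q2 = q1" unfolding q1 q2 S0 by simp
    \<comment> \<open>The ordinate of the point of contact and, by the Apollonius ratio, the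
      distance of this point from both missiles.\<close>
    define y \<rho> where "y = b + q1" and "\<rho> = cmod (Complex p q1) / \<alpha>"
    have qy: "q1 = \<alpha>\<^sup>2 * y" and bq: "b = (1 - \<alpha>\<^sup>2) * y" using a unfolding y_def q1 S0 by (simp_all add: field_simps)
    have "(1 - \<alpha>\<^sup>2) * (p\<^sup>2 - \<alpha>\<^sup>2 * m\<^sup>2 - \<alpha>\<^sup>2 * (1 - \<alpha>\<^sup>2) * y\<^sup>2) = 0"
      using SS S0 unfolding bq by (simp add: algebra_simps power2_eq_square)
    hence pp: "p\<^sup>2 = \<alpha>\<^sup>2 * m\<^sup>2 + \<alpha>\<^sup>2 * (1 - \<alpha>\<^sup>2) * y\<^sup>2" using a by simp
    have "p\<^sup>2 + q1\<^sup>2 = \<alpha>\<^sup>2 * (m\<^sup>2 + y\<^sup>2)" unfolding pp qy by (simp add: algebra_simps power2_eq_square)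
    hence \<rho>: "\<rho> = sqrt (m\<^sup>2 + y\<^sup>2)" unfolding \<rho>_def cmod_def using alpha by (simp add: real_sqrt_mult)
    have "th = arctan (q1 / p)" using th unfolding q pa by simp
    also have "\<dots> = Arg (Complex p q1)" using arg_conv_arctan[of "Complex p q1"] 3 by simp
    finally have "cis th = sgn (Complex p q1)" using 3 by (simp add: cis_Arg complex_eq_iff)
    hence "of_real (cmod (Complex p q1)) * relu (cis \<theta>B) z = Complex p q1" unfolding relu
      by (simp only: \<open>cis th = sgn (Complex p q1)\<close>) (cases "Complex p q1 = 0", simp_all add: sgn_eq)
    hence "of_real (\<alpha> * \<rho>) * relu (cis \<theta>B) z = Complex p q1" using alpha by (simp add: \<rho>_def)
    hence e: "\<alpha> * \<rho> * Re (relu (cis \<theta>B) z) = p" "\<alpha> * \<rho> * Im (relu (cis \<theta>B) z) = q1" by (simp_all add: complex_eq_iff)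
    have "cmod (posB z + of_real (\<alpha> * \<rho>) * cis \<theta>B - posA z) = \<rho>"
         "cmod (posB z + of_real (\<alpha> * \<rho>) * cis \<theta>B - posD z) = \<rho>"
      unfolding rel_point[OF alpha norm_cis AD] e
      by (simp_all add: p_def cmod_def \<rho> b_def[symmetric] m_def[symmetric] y_def[symmetric])
    from capture_on_bisector[OF alpha norm_cis AD this] obtain y where "miss \<alpha> (cis \<theta>B) z y = 0" ..
    thus ?thesis using guarded_miss_pos[OF alpha norm_cis AD g, of y] by simp
  qed
qed

section \<open>Change of the miss distance along a trajectory\<close>

lemma inner_rotate: "cmod n = 1 \<Longrightarrow> (cnj n * p) \<bullet> (cnj n * q) = p \<bullet> q" for n p q :: complex
proof -
  assume "cmod n = 1"
  hence n: "(Re n)\<^sup>2 + (Im n)\<^sup>2 = 1" by (simp add: cmod_def)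
  have "(cnj n * p) \<bullet> (cnj n * q) = ((Re n)\<^sup>2 + (Im n)\<^sup>2) * (p \<bullet> q)"
    unfolding inner_complex_def by (simp add: algebra_simps power2_eq_square)
  thus ?thesis using n by simp
qed

lemma norm_has_real_derivative:
  fixes E :: "real \<Rightarrow> 'a::real_inner"
  assumes "(E has_vector_derivative e) (at t)" "E t \<noteq> 0"
  shows "((\<lambda>s. norm (E s)) has_real_derivative e \<bullet> sgn (E t)) (at t)"
proof -
  have "((\<lambda>s. norm (E s)) has_derivative (\<lambda>h. (h *\<^sub>R e) \<bullet> sgn (E t))) (at t)"
    using has_derivative_compose[OF assms(1)[unfolded has_vector_derivative_def] has_derivative_norm[OF assms(2)]] .
  thus ?thesis unfolding has_field_derivative_def by (simp add: mult.commute[of _ "e \<bullet> sgn (E t)"])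
qed

text \<open>A unit vector can only turn. Its angular velocity is the component of \<open>e\<close>
  perpendicular to \<open>E t\<close>, divided by the length of \<open>E t\<close>.\<close>

lemma sgn_has_vector_derivative:
  fixes E :: "real \<Rightarrow> complex"
  assumes E: "(E has_vector_derivative e) (at t)" "E t \<noteq> 0"
  shows "((\<lambda>s. sgn (E s)) has_vector_derivative
    \<i> * of_real (Im (cnj (sgn (E t)) * e) / cmod (E t)) * sgn (E t)) (at t)"
proof -
  define n where "n = sgn (E t)"
  define N where "N = cmod (E t)"
  have N: "N > 0" using E by (simp add: N_def)
  have n: "cmod n = 1" using E by (simp add: n_def norm_sgn)
  have En: "E t = N *\<^sub>R n" using E(2) by (simp add: n_def N_def sgn_eq scaleR_conv_of_real)
  have "((\<lambda>s. inverse (cmod (E s))) has_real_derivative - (inverse N * (e \<bullet> n) * inverse N)) (at t)"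
    unfolding N_def n_def by (rule DERIV_inverse'[OF norm_has_real_derivative[OF E]]) (use E in simp)
  hence "((\<lambda>s. inverse (cmod (E s)) *\<^sub>R E s) has_vector_derivative
      inverse (cmod (E t)) *\<^sub>R e + (- (inverse N * (e \<bullet> n) * inverse N)) *\<^sub>R E t) (at t)"
    by (intro has_vector_derivative_scaleR E(1))
  moreover have "inverse (cmod (E t)) *\<^sub>R e + (- (inverse N * (e \<bullet> n) * inverse N)) *\<^sub>R E t
      = (e - (e \<bullet> n) *\<^sub>R n) /\<^sub>R N"
    unfolding En using N n by (simp add: scaleR_right_diff_distrib)
  moreover have "e - (e \<bullet> n) *\<^sub>R n = \<i> * of_real (Im (cnj n * e)) * n"
  proof -
    have sq: "(Re n)\<^sup>2 + (Im n)\<^sup>2 = 1" using n by (simp add: cmod_def)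
    have "Re e = ((Re n)\<^sup>2 + (Im n)\<^sup>2) * Re e" "Im e = ((Re n)\<^sup>2 + (Im n)\<^sup>2) * Im e" using sq by auto
    thus ?thesis by (simp add: complex_eq_iff inner_complex_def algebra_simps power2_eq_square)
  qed
  ultimately have "((\<lambda>s. inverse (cmod (E s)) *\<^sub>R E s) has_vector_derivative
      (\<i> * of_real (Im (cnj n * e)) * n) /\<^sub>R N) (at t)" by (simp only:)
  moreover have "(\<i> * of_real (Im (cnj n * e)) * n) /\<^sub>R N = \<i> * of_real (Im (cnj n * e) / N) * n"
    by (simp add: scaleR_conv_of_real divide_inverse mult.left_commute mult.assoc)
  moreover have "(\<lambda>s. inverse (cmod (E s)) *\<^sub>R E s) = (\<lambda>s. sgn (E s))" by (simp add: sgn_div_norm)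
  ultimately show ?thesis unfolding n_def[symmetric] N_def[symmetric] by (simp only:)
qed

context frame
begin

text \<open>The left-hand side is the scalar product of the miss with its velocity for frozen y,
  where \<open>(a1, a2)\<close> and \<open>(d1, d2)\<close> are the velocities of the missiles. Its
  summands come from the motion of the midpoint, the turning of the bisector, the motion of the
  asset and the change of the radius. Stationarity regroups them into the two losses, each being the
  speed minus the velocity component towards the aim point.\<close>

lemma envelope_identity:
  assumes "w2 y = \<alpha> * k y * y / r y"
  shows "w1 y * ((a1 + d1) / 2 - y * ((a2 - d2) / (2 * m))) + w2 y * ((a2 + d2) / 2)
      - \<alpha> * k y * (v + m / r y * ((a1 - d1) / 2))
    = r y / m * ((w1 y - \<alpha> * k y * m / r y) / 2 * (v - (y * a2 - m * a1) / r y)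
        - (w1 y + \<alpha> * k y * m / r y) / 2 * (v - (m * d1 + y * d2) / r y))"
  unfolding assms using r_pos[of y] m_pos by (simp add: field_simps)

end

context
  fixes \<alpha> v :: real and u :: complex and x :: "real \<Rightarrow> state" and t y :: real and a d :: complex
  assumes alpha: "0 < \<alpha>" "\<alpha> < 1" and u: "cmod u = 1" and v: "0 < v"
    and AD: "posA (x t) \<noteq> posD (x t)" and g: "guarded \<alpha> u (x t)" and y: "best \<alpha> u (x t) y"
    and A: "((\<lambda>s. posA (x s)) has_vector_derivative a) (at t)"
    and D: "((\<lambda>s. posD (x s)) has_vector_derivative d) (at t)"
    and B: "((\<lambda>s. posB (x s)) has_vector_derivative of_real (\<alpha> * v) * u) (at t)"
begin

interpretation frame \<alpha> "x_m (x t)" "Re (relB (x t))" "Im (relB (x t))" "Re (relu u (x t))" "Im (relu u (x t))"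
  by (rule frame_state) (use alpha AD u in auto)

abbreviation (input) "sight \<equiv> sgn (posA (x t) - posD (x t))"
abbreviation (input) "half \<equiv> x_m (x t)"

lemma r_radius: "r y = radius (x t) y"
  by (simp add: r_def radius_def)

lemma aim_frame: "cnj sight * (aim (x t) y - posA (x t)) = Complex (- half) y"
    "cnj sight * (aim (x t) y - posD (x t)) = Complex half y"
proof -
  have n: "cnj sight * sight = 1" using cnj_mult_unit[OF sgn_unit] AD by simp
  show "cnj sight * (aim (x t) y - posA (x t)) = Complex (- half) y"
    "cnj sight * (aim (x t) y - posD (x t)) = Complex half y"
    unfolding aim_rel using n by (metis mult.assoc mult.left_neutral)+
qed

text \<open>The parameter y does not move with time, so no differentiability of the minimizer is
  involved; optimality of y at time t enters only through stationarity.\<close>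

lemma miss_has_derivative:
  "((\<lambda>s. cmod (miss \<alpha> u (x s) y)) has_real_derivative
     r y / half * ((w1 y - \<alpha> * k y * half / r y) / 2 * (v - (aim (x t) y - posA (x t)) \<bullet> a / r y)
        - (w1 y + \<alpha> * k y * half / r y) / 2 * (v - (aim (x t) y - posD (x t)) \<bullet> d / r y))
      / cmod (miss \<alpha> u (x t) y)) (at t)"
proof -
  define n where "n = sight"
  define a' d' where "a' = cnj n * a" and "d' = cnj n * d"
  define N where "N = cmod (posA (x t) - posD (x t))"
  have N: "N = 2 * half" by (simp add: N_def x_m_def xA'_def)
  have half: "half > 0" by (rule x_m_pos[OF AD])
  have E0: "posA (x t) - posD (x t) \<noteq> 0" using AD by simp
  have n1: "cmod n = 1" "cnj n * n = 1" using sgn_unit[OF E0] cnj_mult_unit by (auto simp: n_def)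
  have E: "((\<lambda>s. posA (x s) - posD (x s)) has_vector_derivative (a - d)) (at t)"
    by (intro has_vector_derivative_diff A D)
  \<comment> \<open>The angular velocity of the line of sight; \<open>rr\<close> below is the rate
    of the radius.\<close>
  define lam where "lam = Im (a' - d') / (2 * half)"
  define rr where "rr = half / r y * (Re (a' - d') / 2)"
  have S: "((\<lambda>s. sgn (posA (x s) - posD (x s))) has_vector_derivative \<i> * of_real lam * n) (at t)"
    using sgn_has_vector_derivative[OF E E0]
    by (simp add: n_def[symmetric] N_def[symmetric] N lam_def a'_def d'_def algebra_simps)
  have xm: "((\<lambda>s. x_m (x s)) has_real_derivative Re (a' - d') / 2) (at t)"
  proof -
    have "(a - d) \<bullet> n = Re (a' - d')" by (simp add: inner_complex_def a'_def d'_def algebra_simps)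
    thus ?thesis using norm_has_real_derivative[OF E E0] unfolding x_m_def xA'_def n_def[symmetric]
      by (auto intro!: derivative_eq_intros)
  qed
  have "half\<^sup>2 + y\<^sup>2 > 0" using half by (simp add: add_pos_nonneg)
  hence "((\<lambda>s. sqrt ((x_m (x s))\<^sup>2 + y\<^sup>2)) has_real_derivative
      inverse (sqrt (half\<^sup>2 + y\<^sup>2)) / 2 * (2 * half * (Re (a' - d') / 2))) (at t)"
  proof (rule DERIV_chain2[OF DERIV_real_sqrt])
    show "((\<lambda>s. (x_m (x s))\<^sup>2 + y\<^sup>2) has_real_derivative 2 * half * (Re (a' - d') / 2)) (at t)"
      by (rule derivative_eq_intros xm refl)+ simp
  qed
  moreover have "inverse (sqrt (half\<^sup>2 + y\<^sup>2)) / 2 * (2 * half * (Re (a' - d') / 2)) = rr"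
  proof -
    have "inverse q / 2 * (2 * c * (X / 2)) = c / q * (X / 2)" for q c X :: real by (simp add: field_simps)
    thus ?thesis unfolding rr_def r_def .
  qed
  ultimately have rad: "((\<lambda>s. radius (x s) y) has_real_derivative rr) (at t)"
    unfolding radius_def by (simp only:)
  have rad': "((\<lambda>s. complex_of_real (\<alpha> * radius (x s) y) * u) has_vector_derivative of_real (\<alpha> * rr) * u) (at t)"
  proof -
    have "((\<lambda>s. \<alpha> * radius (x s) y) has_vector_derivative \<alpha> * rr) (at t)"
      unfolding has_real_derivative_iff_has_vector_derivative[symmetric] by (rule DERIV_cmult[OF rad])
    hence "((\<lambda>s. (\<alpha> * radius (x s) y) *\<^sub>R u) has_vector_derivative (\<alpha> * rr) *\<^sub>R u) (at t)"
      by (rule bounded_linear.has_vector_derivative[OF bounded_linear_scaleR_left])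
    thus ?thesis by (simp add: scaleR_conv_of_real)
  qed
  define W where "W = (a + d) / 2 + \<i> * of_real y * (\<i> * of_real lam * n) - of_real (\<alpha> * v) * u - of_real (\<alpha> * rr) * u"
  have M: "((\<lambda>s. miss \<alpha> u (x s) y) has_vector_derivative W) (at t)"
    unfolding miss_def aim_def W_def
    by (intro has_vector_derivative_diff has_vector_derivative_add has_vector_derivative_mult_right
      has_vector_derivative_divide A D B S rad')
  have mp: "miss \<alpha> u (x t) y \<noteq> 0" using guarded_miss_pos[OF alpha u AD g, of y] by auto
  have "((\<lambda>s. cmod (miss \<alpha> u (x s) y)) has_real_derivative W \<bullet> sgn (miss \<alpha> u (x t) y)) (at t)"
    by (rule norm_has_real_derivative[OF M mp])
  moreover have "W \<bullet> sgn (miss \<alpha> u (x t) y) = (W \<bullet> miss \<alpha> u (x t) y) / cmod (miss \<alpha> u (x t) y)"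
    by (simp add: sgn_div_norm divide_inverse)
  moreover have "W \<bullet> miss \<alpha> u (x t) y = r y / half * ((w1 y - \<alpha> * k y * half / r y) / 2 * (v - (aim (x t) y - posA (x t)) \<bullet> a / r y)
        - (w1 y + \<alpha> * k y * half / r y) / 2 * (v - (aim (x t) y - posD (x t)) \<bullet> d / r y))"
  proof -
    have nW: "cnj n * W = (a' + d') / 2 - of_real (y * lam) - of_real (\<alpha> * (v + rr)) * relu u (x t)"
    proof -
      have "cnj n * W = (a' + d') / 2 - of_real (y * lam) * (cnj n * n) - of_real (\<alpha> * (v + rr)) * (cnj n * u)"
        unfolding W_def a'_def d'_def by (simp add: field_simps)
      thus ?thesis unfolding n1 by (simp add: relu_def n_def)
    qed
    have "W \<bullet> miss \<alpha> u (x t) y = (cnj n * W) \<bullet> (cnj n * miss \<alpha> u (x t) y)"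
      using inner_rotate[OF n1(1)] by simp
    also have "\<dots> = w1 y * (Re (a' + d') / 2 - y * lam) + w2 y * (Im (a' + d') / 2) - \<alpha> * k y * (v + rr)"
      unfolding nW unfolding n_def miss_frame[OF alpha u AD]
      by (simp add: inner_complex_def k_def algebra_simps add_divide_distrib)
    also have "\<dots> = w1 y * ((Re a' + Re d') / 2 - y * ((Im a' - Im d') / (2 * half))) + w2 y * ((Im a' + Im d') / 2)
      - \<alpha> * k y * (v + half / r y * ((Re a' - Re d') / 2))"
      by (simp add: lam_def rr_def)
    also have "\<dots> = r y / half * ((w1 y - \<alpha> * k y * half / r y) / 2 * (v - (y * Im a' - half * Re a') / r y)
        - (w1 y + \<alpha> * k y * half / r y) / 2 * (v - (half * Re d' + y * Im d') / r y))"
      by (rule envelope_identity) (use stationary y best_iff[OF alpha u AD] in auto)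
    also have "y * Im a' - half * Re a' = (aim (x t) y - posA (x t)) \<bullet> a"
      using inner_rotate[OF n1(1), of "aim (x t) y - posA (x t)" a] unfolding n_def aim_frame
      by (simp add: inner_complex_def a'_def n_def)
    also have "half * Re d' + y * Im d' = (aim (x t) y - posD (x t)) \<bullet> d"
      using inner_rotate[OF n1(1), of "aim (x t) y - posD (x t)" d] unfolding n_def aim_frame
      by (simp add: inner_complex_def d'_def n_def)
    finally show ?thesis .
  qed
  ultimately show ?thesis by (simp only:)
qed

lemma aim_dist_r: "cmod (aim (x t) y - posA (x t)) = r y" "cmod (aim (x t) y - posD (x t)) = r y"
  unfolding r_radius by (rule aim_dist[OF AD])+

lemma bounds: "(1 - \<alpha>)\<^sup>2 / (1 + \<alpha>) * cmod (miss \<alpha> u (x t) y) \<le> w1 y - \<alpha> * k y * half / r y"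
    "(1 - \<alpha>)\<^sup>2 / (1 + \<alpha>) * cmod (miss \<alpha> u (x t) y) \<le> w1 y + \<alpha> * k y * half / r y"
proof -
  from guarded_frame_state[OF alpha u AD g] obtain \<rho> where
    gf: "guarded_frame \<alpha> half (Re (relB (x t))) (Im (relB (x t))) (Re (relu u (x t))) (Im (relu u (x t))) \<rho>" .
  have "minimizer y" using y best_iff[OF alpha u AD] by simp
  from guarded_frame.minimizer_bound[OF gf this]
  show "(1 - \<alpha>)\<^sup>2 / (1 + \<alpha>) * cmod (miss \<alpha> u (x t) y) \<le> w1 y - \<alpha> * k y * half / r y"
    "(1 - \<alpha>)\<^sup>2 / (1 + \<alpha>) * cmod (miss \<alpha> u (x t) y) \<le> w1 y + \<alpha> * k y * half / r y"
    unfolding cmod_miss[OF alpha u AD] by auto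
qed

lemma inner_aim_le:
  assumes "cmod X = r y" "cmod Y \<le> v"
  shows "X \<bullet> Y / r y \<le> v"
proof -
  have "X \<bullet> Y \<le> cmod X * cmod Y" by (rule norm_cauchy_schwarz)
  also have "\<dots> \<le> r y * v" unfolding assms(1) using assms(2) r_pos[of y] by (intro mult_left_mono) auto
  finally show ?thesis using r_pos[of y] by (simp add: field_simps)
qed

text \<open>The attacker has no loss. The weight of the defender's loss is at least a constant times
  the miss, and this miss cancels against the one by which the derivative of a norm is divided. So
  the rate stays comparable to the loss even where the value is small.\<close>

lemma miss_decreases:
  assumes a: "a = of_real (v / radius (x t) y) * (aim (x t) y - posA (x t))" and d: "cmod d \<le> v"
  obtains \<Delta> where "((\<lambda>s. cmod (miss \<alpha> u (x s) y)) has_real_derivative \<Delta>) (at t)"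
    "\<Delta> \<le> - (radius (x t) y / half * ((1 - \<alpha>)\<^sup>2 / (1 + \<alpha>) / 2) * (v - (aim (x t) y - posD (x t)) \<bullet> d / radius (x t) y))"
proof -
  let ?N = "cmod (miss \<alpha> u (x t) y)"
  have N: "?N > 0" by (rule guarded_miss_pos[OF alpha u AD g])
  have "(aim (x t) y - posA (x t)) \<bullet> a / r y = v"
    unfolding a r_radius[symmetric] scaleR_conv_of_real[symmetric] inner_scaleR_right power2_norm_eq_inner[symmetric] aim_dist_r
    using r_pos[of y] by (simp add: power2_eq_square)
  hence a0: "v - (aim (x t) y - posA (x t)) \<bullet> a / r y = 0" by simp
  define q where "q = v - (aim (x t) y - posD (x t)) \<bullet> d / r y"
  have q: "q \<ge> 0" unfolding q_def using inner_aim_le[OF aim_dist_r(2) d] by simp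
  define C where "C = w1 y + \<alpha> * k y * half / r y"
  have C: "(1 - \<alpha>)\<^sup>2 / (1 + \<alpha>) * ?N \<le> C" unfolding C_def by (rule bounds)
  have half: "half > 0" by (rule x_m_pos[OF AD])
  show thesis
  proof (rule that[OF miss_has_derivative])
    have "r y / half * (((1 - \<alpha>)\<^sup>2 / (1 + \<alpha>) * ?N) / 2 * q) \<le> r y / half * (C / 2 * q)"
      using C q r_pos[of y] half by (intro mult_left_mono mult_right_mono divide_right_mono) auto
    hence "r y / half * (((1 - \<alpha>)\<^sup>2 / (1 + \<alpha>) * ?N) / 2 * q) / ?N \<le> r y / half * (C / 2 * q) / ?N"
      using N by (intro divide_right_mono) auto
    hence "r y / half * ((1 - \<alpha>)\<^sup>2 / (1 + \<alpha>) / 2) * q \<le> r y / half * (C / 2 * q) / ?N"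
      using N by simp
    thus "r y / half * ((w1 y - \<alpha> * k y * half / r y) / 2 * (v - (aim (x t) y - posA (x t)) \<bullet> a / r y)
        - (w1 y + \<alpha> * k y * half / r y) / 2 * (v - (aim (x t) y - posD (x t)) \<bullet> d / r y)) / ?N
      \<le> - (radius (x t) y / half * ((1 - \<alpha>)\<^sup>2 / (1 + \<alpha>) / 2) * (v - (aim (x t) y - posD (x t)) \<bullet> d / radius (x t) y))"
      unfolding a0 q_def[symmetric] C_def[symmetric] r_radius[symmetric] by simp
  qed
qed

lemma miss_increases:
  assumes d: "d = of_real (v / radius (x t) y) * (aim (x t) y - posD (x t))" and a: "cmod a \<le> v"
  obtains \<Delta> where "((\<lambda>s. cmod (miss \<alpha> u (x s) y)) has_real_derivative \<Delta>) (at t)" "0 \<le> \<Delta>"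
proof -
  let ?N = "cmod (miss \<alpha> u (x t) y)"
  have N: "?N > 0" by (rule guarded_miss_pos[OF alpha u AD g])
  have "(aim (x t) y - posD (x t)) \<bullet> d / r y = v"
    unfolding d r_radius[symmetric] scaleR_conv_of_real[symmetric] inner_scaleR_right power2_norm_eq_inner[symmetric] aim_dist_r
    using r_pos[of y] by (simp add: power2_eq_square)
  hence d0: "v - (aim (x t) y - posD (x t)) \<bullet> d / r y = 0" by simp
  have q: "v - (aim (x t) y - posA (x t)) \<bullet> a / r y \<ge> 0" using inner_aim_le[OF aim_dist_r(1) a] by simp
  have "0 \<le> (1 - \<alpha>)\<^sup>2 / (1 + \<alpha>) * ?N" using alpha by simp
  hence C: "0 \<le> w1 y - \<alpha> * k y * half / r y" using bounds(1) by linarith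
  show thesis
  proof (rule that[OF miss_has_derivative])
    show "0 \<le> r y / half * ((w1 y - \<alpha> * k y * half / r y) / 2 * (v - (aim (x t) y - posA (x t)) \<bullet> a / r y)
        - (w1 y + \<alpha> * k y * half / r y) / 2 * (v - (aim (x t) y - posD (x t)) \<bullet> d / r y)) / ?N"
      unfolding d0 using N C q r_pos[of y] x_m_pos[OF AD] by simp
  qed
qed

end

section \<open>Trajectories\<close>

definition velocities :: "real \<Rightarrow> real \<Rightarrow> real \<Rightarrow> real \<Rightarrow> real \<Rightarrow> (real \<Rightarrow> state) \<Rightarrow> real \<Rightarrow> bool" where
  "velocities vB v th a d x t \<longleftrightarrow> ((\<lambda>s. posA (x s)) has_vector_derivative of_real v * cis a) (at t) \<and>
     ((\<lambda>s. posD (x s)) has_vector_derivative of_real v * cis d) (at t) \<and>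
     ((\<lambda>s. posB (x s)) has_vector_derivative of_real vB * cis th) (at t)"

text \<open>Radial projection is Lipschitz away from the origin. One half of the constant comes from
  moving the vector, the other from the change of its length.\<close>

lemma sgn_diff_le:
  fixes X Y :: "'a::real_normed_vector"
  assumes "0 < \<mu>" "\<mu> \<le> norm X" "\<mu> \<le> norm Y"
  shows "norm (sgn X - sgn Y) \<le> 2 / \<mu> * norm (X - Y)"
proof -
  have nz: "norm X > 0" "norm Y > 0" using assms by auto
  have "norm X *\<^sub>R (sgn X - sgn Y) = (X - Y) + (norm Y - norm X) *\<^sub>R sgn Y"
    using nz by (simp add: sgn_div_norm algebra_simps)
  hence "norm X * norm (sgn X - sgn Y) \<le> norm (X - Y) + norm ((norm Y - norm X) *\<^sub>R sgn Y)"
    by (metis norm_triangle_ineq abs_norm_cancel norm_scaleR)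
  also have "norm ((norm Y - norm X) *\<^sub>R sgn Y) = \<bar>norm Y - norm X\<bar>" using nz by (simp add: norm_sgn)
  also have "\<dots> \<le> norm (X - Y)" by (metis norm_triangle_ineq3 norm_minus_commute)
  finally have 1: "norm X * norm (sgn X - sgn Y) \<le> 2 * norm (X - Y)" by simp
  have "\<mu> * norm (sgn X - sgn Y) \<le> norm X * norm (sgn X - sgn Y)" using assms by (intro mult_right_mono) auto
  with 1 show ?thesis using assms(1) by (simp add: field_simps)
qed

lemma radius_diff_le: "\<bar>radius z y - radius z' y\<bar> \<le> \<bar>x_m z - x_m z'\<bar>"
proof -
  have e: "radius z y = norm (x_m z, y)" for z by (simp add: radius_def norm_Pair)
  have "\<bar>norm (x_m z, y) - norm (x_m z', y)\<bar> \<le> norm ((x_m z, y) - (x_m z', y))" by (rule norm_triangle_ineq3)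
  also have "\<dots> = \<bar>x_m z - x_m z'\<bar>" by (simp add: norm_Pair)
  finally show ?thesis unfolding e .
qed

lemma x_m_diff_le: "\<bar>x_m z - x_m z'\<bar> \<le> cmod ((posA z - posD z) - (posA z' - posD z')) / 2"
proof -
  have "\<bar>cmod (posA z - posD z) - cmod (posA z' - posD z')\<bar> \<le> cmod ((posA z - posD z) - (posA z' - posD z'))"
    by (rule norm_triangle_ineq3)
  thus ?thesis unfolding x_m_def xA'_def by linarith
qed

section \<open>Lipschitz continuity of the minimal miss along trajectories\<close>

context
  fixes \<alpha> :: real and u :: complex and x :: "real \<Rightarrow> state" and y :: "real \<Rightarrow> real" and a b K :: real
  assumes alpha: "0 < \<alpha>" "\<alpha> < 1" and u: "cmod u = 1"
    and A: "K-lipschitz_on {a..b} (\<lambda>t. posA (x t))" and D: "K-lipschitz_on {a..b} (\<lambda>t. posD (x t))"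
    and B: "K-lipschitz_on {a..b} (\<lambda>t. posB (x t))"
    and AD: "\<And>t. t \<in> {a..b} \<Longrightarrow> posA (x t) \<noteq> posD (x t)"
    and y: "\<And>t. t \<in> {a..b} \<Longrightarrow> best \<alpha> u (x t) (y t)"
begin

lemma E_lipschitz: "(2 * K)-lipschitz_on {a..b} (\<lambda>t. posA (x t) - posD (x t))"
  using lipschitz_on_diff[OF A D] by simp

lemma separation: obtains \<mu> where "0 < \<mu>" "\<And>t. t \<in> {a..b} \<Longrightarrow> \<mu> \<le> cmod (posA (x t) - posD (x t))"
proof (cases "a \<le> b")
  case True
  have "\<exists>t\<in>{a..b}. \<forall>s\<in>{a..b}. cmod (posA (x t) - posD (x t)) \<le> cmod (posA (x s) - posD (x s))"
    by (intro continuous_attains_inf continuous_on_norm lipschitz_on_continuous_on[OF E_lipschitz]) (use True in auto)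
  then obtain t where "t \<in> {a..b}" "\<And>s. s \<in> {a..b} \<Longrightarrow> cmod (posA (x t) - posD (x t)) \<le> cmod (posA (x s) - posD (x s))" by blast
  thus thesis using that[of "cmod (posA (x t) - posD (x t))"] AD by auto
next
  case False thus thesis using that[of 1] by auto
qed

lemma x_m_lipschitz: "K-lipschitz_on {a..b} (\<lambda>t. x_m (x t))"
proof (rule lipschitz_onI)
  fix s t assume "s \<in> {a..b}" "t \<in> {a..b}"
  hence "dist (posA (x s) - posD (x s)) (posA (x t) - posD (x t)) \<le> 2 * K * dist s t"
    by (rule lipschitz_onD[OF E_lipschitz])
  thus "dist (x_m (x s)) (x_m (x t)) \<le> K * dist s t"
    using x_m_diff_le[of "x s" "x t"] by (simp add: dist_norm)
qed (rule lipschitz_on_nonneg[OF A])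

text \<open>The minimal miss is at most the miss at the midpoint, which is continuous in time and
  hence bounded; \<open>radius_le\<close> turns this into a bound on the aim points.\<close>

lemma best_radius_bounded: obtains Y where "\<And>t. t \<in> {a..b} \<Longrightarrow> radius (x t) (y t) \<le> Y"
proof -
  have "continuous_on {a..b} (\<lambda>t. cmod (miss \<alpha> u (x t) 0) + cmod (posA (x t) - posB (x t)))"
    unfolding miss_def aim_def radius_def
    using lipschitz_on_continuous_on[OF A] lipschitz_on_continuous_on[OF B] lipschitz_on_continuous_on[OF D]
      lipschitz_on_continuous_on[OF x_m_lipschitz]
    by (auto intro!: continuous_intros)
  hence "bounded ((\<lambda>t. cmod (miss \<alpha> u (x t) 0) + cmod (posA (x t) - posB (x t))) ` {a..b})"
    by (intro compact_imp_bounded compact_continuous_image) auto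
  then obtain M where M: "\<And>t. t \<in> {a..b} \<Longrightarrow> norm (cmod (miss \<alpha> u (x t) 0) + cmod (posA (x t) - posB (x t))) \<le> M"
    unfolding bounded_iff by blast
  show thesis
  proof (rule that[of "M / (1 - \<alpha>)"])
    fix t assume t: "t \<in> {a..b}"
    have "(1 - \<alpha>) * radius (x t) (y t) \<le> cmod (miss \<alpha> u (x t) (y t)) + cmod (posA (x t) - posB (x t))"
      by (rule radius_le[OF alpha u AD[OF t]])
    also have "\<dots> \<le> cmod (miss \<alpha> u (x t) 0) + cmod (posA (x t) - posB (x t))"
      using y[OF t] by (simp add: best_def)
    also have "\<dots> \<le> M" using M[OF t] by simp
    finally show "radius (x t) (y t) \<le> M / (1 - \<alpha>)" using alpha by (simp add: field_simps)
  qed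
qed

text \<open>A minimum of functions with a common Lipschitz constant is Lipschitz, however the
  minimizer jumps. The constant is common because the missiles stay apart, so that the bisector
  turns at a bounded rate, and the best aim points stay in a bounded part of it.\<close>

lemma best_miss_lipschitz: obtains K' where "K'-lipschitz_on {a..b} (\<lambda>t. cmod (miss \<alpha> u (x t) (y t)))"
proof -
  obtain \<mu> where \<mu>: "0 < \<mu>" "\<And>t. t \<in> {a..b} \<Longrightarrow> \<mu> \<le> cmod (posA (x t) - posD (x t))"
    using separation by blast
  obtain Y where Y: "\<And>t. t \<in> {a..b} \<Longrightarrow> radius (x t) (y t) \<le> Y" using best_radius_bounded by blast
  \<comment> \<open>The three \<open>K\<close> account for the midpoint, the asset and the radius,
    the last term for the turning of the bisector at an aim point of ordinate at most the absolute
    value of \<open>Y\<close>.\<close>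
  define K' where "K' = 3 * K + \<bar>Y\<bar> * (2 / \<mu> * (2 * K))"
  have K0: "K \<ge> 0" by (rule lipschitz_on_nonneg[OF A])
  have fixed: "cmod (miss \<alpha> u (x s) q) \<le> cmod (miss \<alpha> u (x t) q) + K' * dist s t"
    if s: "s \<in> {a..b}" and t: "t \<in> {a..b}" and q: "\<bar>q\<bar> \<le> \<bar>Y\<bar>" for s t q
  proof -
    define d where "d = dist s t"
    let ?E = "\<lambda>t. posA (x t) - posD (x t)"
    have dA: "cmod (posA (x s) - posA (x t)) \<le> K * d" using lipschitz_onD[OF A s t] by (simp add: dist_norm d_def)
    have dD: "cmod (posD (x s) - posD (x t)) \<le> K * d" using lipschitz_onD[OF D s t] by (simp add: dist_norm d_def)
    have dB: "cmod (posB (x s) - posB (x t)) \<le> K * d" using lipschitz_onD[OF B s t] by (simp add: dist_norm d_def)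
    have dE: "cmod (?E s - ?E t) \<le> 2 * K * d" using lipschitz_onD[OF E_lipschitz s t] by (simp add: dist_norm d_def)
    have dm: "\<bar>x_m (x s) - x_m (x t)\<bar> \<le> K * d" using lipschitz_onD[OF x_m_lipschitz s t] by (simp add: dist_norm d_def)
    define P Q R where "P = ((posA (x s) - posA (x t)) + (posD (x s) - posD (x t))) / 2"
      and "Q = \<i> * of_real q * (sgn (?E s) - sgn (?E t))"
      and "R = of_real (\<alpha> * (radius (x s) q - radius (x t) q)) * u"
    have "miss \<alpha> u (x s) q - miss \<alpha> u (x t) q = P + Q - (posB (x s) - posB (x t)) - R"
      unfolding miss_def aim_def P_def Q_def R_def by (simp add: field_simps)
    hence "cmod (miss \<alpha> u (x s) q - miss \<alpha> u (x t) q) \<le> cmod P + cmod Q + cmod (posB (x s) - posB (x t)) + cmod R"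
      by (smt (verit) norm_triangle_ineq norm_triangle_ineq4)
    moreover have "cmod P \<le> K * d"
      unfolding P_def norm_divide using dA dD norm_triangle_ineq[of "posA (x s) - posA (x t)" "posD (x s) - posD (x t)"] by simp
    moreover have "cmod Q \<le> \<bar>Y\<bar> * (2 / \<mu> * (2 * K * d))"
    proof -
      have "cmod (sgn (?E s) - sgn (?E t)) \<le> 2 / \<mu> * cmod (?E s - ?E t)"
        by (rule sgn_diff_le[OF \<mu>(1) \<mu>(2)[OF s] \<mu>(2)[OF t]])
      also have "\<dots> \<le> 2 / \<mu> * (2 * K * d)" using dE \<mu>(1) by (intro mult_left_mono) auto
      finally have "\<bar>q\<bar> * cmod (sgn (?E s) - sgn (?E t)) \<le> \<bar>Y\<bar> * (2 / \<mu> * (2 * K * d))"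
        using q by (intro mult_mono) auto
      thus ?thesis by (simp add: Q_def norm_mult)
    qed
    moreover have "cmod R \<le> K * d"
    proof -
      have "cmod R = \<alpha> * \<bar>radius (x s) q - radius (x t) q\<bar>" 
        unfolding R_def norm_mult norm_of_real u using alpha by (simp add: abs_mult)
      also have "\<dots> \<le> 1 * \<bar>radius (x s) q - radius (x t) q\<bar>" using alpha by (intro mult_right_mono) auto
      also have "\<dots> \<le> K * d" using radius_diff_le[of "x s" q "x t"] dm by simp
      finally show ?thesis .
    qed
    ultimately have "cmod (miss \<alpha> u (x s) q - miss \<alpha> u (x t) q) \<le> K * d + \<bar>Y\<bar> * (2 / \<mu> * (2 * K * d)) + K * d + K * d"
      using dB by linarith
    also have "\<dots> = K' * d" by (simp add: K'_def algebra_simps)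
    finally show ?thesis using norm_triangle_ineq2[of "miss \<alpha> u (x s) q" "miss \<alpha> u (x t) q"] unfolding d_def by linarith
  qed
  have yY: "\<bar>y t\<bar> \<le> \<bar>Y\<bar>" if "t \<in> {a..b}" for t
  proof -
    have "\<bar>y t\<bar> \<le> radius (x t) (y t)" unfolding radius_def by (rule real_sqrt_ge_abs2)
    thus ?thesis using Y[OF that] by linarith
  qed
  \<comment> \<open>The minimizer at time t serves as a competitor at time s.\<close>
  have one: "cmod (miss \<alpha> u (x s) (y s)) \<le> cmod (miss \<alpha> u (x t) (y t)) + K' * dist s t"
    if "s \<in> {a..b}" "t \<in> {a..b}" for s t
    using y[OF that(1)] fixed[OF that yY[OF that(2)]] unfolding best_def by (meson order_trans)
  show thesis
  proof (rule that, rule lipschitz_onI)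
    fix s t assume st: "s \<in> {a..b}" "t \<in> {a..b}"
    show "dist (cmod (miss \<alpha> u (x s) (y s))) (cmod (miss \<alpha> u (x t) (y t))) \<le> K' * dist s t"
      using one[OF st] one[OF st(2,1)] by (simp add: dist_real_def[of "cmod _"] dist_commute[of t s] abs_le_iff)
  next
    show "0 \<le> K'" unfolding K'_def using K0 \<mu>(1) by simp
  qed
qed

end

lemma indefinite_integral_lipschitz:
  fixes f F :: "real \<Rightarrow> 'b::euclidean_space"
  assumes F: "\<And>t. t \<in> {0..T} \<Longrightarrow> (f has_integral (F t - F0)) {0..t}" and K: "\<And>t. norm (f t) \<le> K"
  shows "K-lipschitz_on {0..T} F"
proof (rule lipschitz_on_leI)
  show K0: "0 \<le> K" using K[of 0] norm_ge_zero order_trans by blast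
  fix s t assume st: "s \<in> {0..T}" "t \<in> {0..T}" "s \<le> t"
  have i: "f integrable_on {0..t}" using F st by blast
  have "integral {0..s} f + integral {s..t} f = integral {0..t} f"
    by (rule Henstock_Kurzweil_Integration.integral_combine) (use st i in auto)
  hence "F s - F0 + integral {s..t} f = F t - F0" using F[OF st(1)] F[OF st(2)] by (simp only: integral_unique)
  hence "F t - F s = integral {s..t} f" by (simp add: algebra_simps)
  moreover have "f integrable_on {s..t}" using i by (rule integrable_on_subinterval) (use st in auto)
  ultimately have "(f has_integral (F t - F s)) (cbox s t)" by (simp add: integrable_integral)
  from has_integral_bound[OF K0 this] have "norm (F t - F s) \<le> K * measure lborel (cbox s t)" using K by blast
  thus "dist (F s) (F t) \<le> K * dist s t" using st by (simp add: dist_norm norm_minus_commute)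
qed

context
  fixes vB v th :: real and chi psi :: "real \<Rightarrow> real" and z0 :: state and x :: "real \<Rightarrow> state" and T :: real
  assumes tr: "trajectory vB v v th chi psi z0 x {0..T}"
begin

lemma trajectory_integrals:
  assumes "t \<in> {0..T}"
  shows "((\<lambda>s. of_real v * cis (chi s)) has_integral (posA (x t) - posA z0)) {0..t}"
    "((\<lambda>s. of_real v * cis (psi s)) has_integral (posD (x t) - posD z0)) {0..t}"
    "((\<lambda>s. of_real vB * cis th) has_integral (posB (x t) - posB z0)) {0..t}"
proof -
  have i: "((\<lambda>s. velocity vB v v th (chi s) (psi s)) has_integral (x t - z0)) {0..t}"
    using tr assms by (simp add: trajectory_def)
  show "((\<lambda>s. of_real vB * cis th) has_integral (posB (x t) - posB z0)) {0..t}"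
    using has_integral_linear[OF i bounded_linear_fst] by (simp add: o_def velocity_def posB_def)
  have s: "((\<lambda>s. snd (velocity vB v v th (chi s) (psi s))) has_integral snd (x t - z0)) {0..t}"
    using has_integral_linear[OF i bounded_linear_snd] by (simp add: o_def)
  show "((\<lambda>s. of_real v * cis (chi s)) has_integral (posA (x t) - posA z0)) {0..t}"
    using has_integral_linear[OF s bounded_linear_fst] by (simp add: o_def velocity_def posA_def)
  show "((\<lambda>s. of_real v * cis (psi s)) has_integral (posD (x t) - posD z0)) {0..t}"
    using has_integral_linear[OF s bounded_linear_snd] by (simp add: o_def velocity_def posD_def)
qed

lemma trajectory_posB:
  assumes "t \<in> {0..T}"
  shows "posB (x t) = posB z0 + of_real (vB * t) * cis th"
proof -
  have "((\<lambda>s. of_real vB * cis th) has_integral (t - 0) *\<^sub>R (of_real vB * cis th)) {0..t}"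
    using has_integral_const_real[of "of_real vB * cis th" 0 t] assms by simp
  hence "posB (x t) - posB z0 = (t - 0) *\<^sub>R (of_real vB * cis th)"
    using trajectory_integrals(3)[OF assms] has_integral_unique by blast
  thus ?thesis by (simp add: scaleR_conv_of_real algebra_simps)
qed

lemma trajectory_start: "0 \<le> T \<Longrightarrow> x 0 = z0"
proof -
  assume "0 \<le> T"
  hence "((\<lambda>s. velocity vB v v th (chi s) (psi s)) has_integral (x 0 - z0)) {0..0}"
    using tr unfolding trajectory_def by (metis atLeastAtMost_iff order_refl)
  moreover have "((\<lambda>s. velocity vB v v th (chi s) (psi s)) has_integral 0) {0..0}"
    using has_integral_refl(2)[of _ 0] by simp
  ultimately have "x 0 - z0 = 0" by (rule has_integral_unique)
  thus "x 0 = z0" by simp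
qed

lemma trajectory_lipschitz:
  assumes "0 \<le> v" "0 \<le> vB" "vB \<le> v"
  shows "v-lipschitz_on {0..T} (\<lambda>t. posA (x t))" "v-lipschitz_on {0..T} (\<lambda>t. posD (x t))"
    "v-lipschitz_on {0..T} (\<lambda>t. posB (x t))"
  by (rule indefinite_integral_lipschitz, erule trajectory_integrals, use assms in \<open>simp add: norm_mult\<close>)+

lemma trajectory_derivatives:
  obtains N where "negligible N" "\<And>t. t \<in> {0<..<T} - N \<Longrightarrow>
     velocities vB v th (chi t) (psi t) x t"
proof -
  obtain N1 where N1: "negligible N1" "\<And>t. t \<in> {0<..<T} - N1 \<Longrightarrow> ((\<lambda>s. posA (x s)) has_vector_derivative of_real v * cis (chi t)) (at t)"
    using indefinite_integral_derivative_AE[OF trajectory_integrals(1)] by blast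
  obtain N2 where N2: "negligible N2" "\<And>t. t \<in> {0<..<T} - N2 \<Longrightarrow> ((\<lambda>s. posD (x s)) has_vector_derivative of_real v * cis (psi t)) (at t)"
    using indefinite_integral_derivative_AE[OF trajectory_integrals(2)] by blast
  obtain N3 where N3: "negligible N3" "\<And>t. t \<in> {0<..<T} - N3 \<Longrightarrow> ((\<lambda>s. posB (x s)) has_vector_derivative of_real vB * cis th) (at t)"
    using indefinite_integral_derivative_AE[OF trajectory_integrals(3)] by blast
  show thesis
    by (rule that[of "N1 \<union> N2 \<union> N3"]) (use N1 N2 N3 in \<open>auto simp: velocities_def\<close>)
qed

end

section \<open>The region of the defender\<close>

text \<open>The right-hand side does not depend on the state, so a solution is the indefinite
  integral of a bounded measurable function.\<close>

lemma trajectory_exists: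
  assumes "chi \<in> controls" "psi \<in> controls"
  obtains x where "trajectory vB vA vD th chi psi z x {0..}"
proof -
  have [measurable]: "chi \<in> borel_measurable borel" "psi \<in> borel_measurable borel"
    using assms by (auto simp: controls_def)
  have [measurable]: "cis \<in> borel_measurable borel"
    by (intro borel_measurable_continuous_onI continuous_intros)
  let ?f = "\<lambda>s. velocity vB vA vD th (chi s) (psi s)"
  have "?f integrable_on {0..t}" for t
  proof (rule measurable_bounded_by_integrable_imp_integrable)
    have "?f \<in> borel_measurable borel" unfolding velocity_def by measurable
    hence "?f \<in> borel_measurable lebesgue" by (simp add: measurable_completion)
    thus "?f \<in> borel_measurable (lebesgue_on {0..t})" by (rule measurable_restrict_space1)
    show "(\<lambda>_. \<bar>vB\<bar> + (\<bar>vA\<bar> + \<bar>vD\<bar>)) integrable_on {0..t}" by (rule integrable_const_ivl)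
    fix s
    have "norm (?f s) \<le> cmod (of_real vB * cis th) + (cmod (of_real vA * cis (chi s)) + cmod (of_real vD * cis (psi s)))"
      unfolding velocity_def by (meson norm_Pair_le order_trans add_left_mono)
    thus "norm (?f s) \<le> \<bar>vB\<bar> + (\<bar>vA\<bar> + \<bar>vD\<bar>)" by (simp add: norm_mult)
  qed auto
  hence "trajectory vB vA vD th chi psi z (\<lambda>t. z + integral {0..t} ?f) {0..}"
    unfolding trajectory_def by (auto intro: integrable_integral)
  thus thesis by (rule that)
qed

lemma trajectory_subset: "trajectory vB vA vD th chi psi z x I \<Longrightarrow> J \<subseteq> I \<Longrightarrow> trajectory vB vA vD th chi psi z x J"
  unfolding trajectory_def by blast

definition wrap_angle :: "real \<Rightarrow> real" where
  "wrap_angle a = a - 2 * pi * of_int \<lfloor>(a + pi) / (2 * pi)\<rfloor>"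

lemma wrap_angle_bounds: "- pi \<le> wrap_angle a" "wrap_angle a < pi"
proof -
  define q where "q = (a + pi) / (2 * pi)"
  have q: "a + pi = 2 * pi * q" by (simp add: q_def)
  have "2 * pi * of_int \<lfloor>q\<rfloor> \<le> 2 * pi * q" "2 * pi * q < 2 * pi * (of_int \<lfloor>q\<rfloor> + 1)"
    by auto
  thus "- pi \<le> wrap_angle a" "wrap_angle a < pi"
    unfolding wrap_angle_def q_def[symmetric] q[symmetric] by (simp_all add: algebra_simps)
qed

lemma cis_wrap_angle: "cis (wrap_angle a) = cis a"
proof -
  have "cis a = cis (wrap_angle a + 2 * pi * of_int \<lfloor>(a + pi) / (2 * pi)\<rfloor>)" by (simp add: wrap_angle_def)
  also have "\<dots> = cis (wrap_angle a) * cis (2 * pi * of_int \<lfloor>(a + pi) / (2 * pi)\<rfloor>)" by (simp only: cis_mult)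
  finally show ?thesis by (simp add: cis_multiple_2pi)
qed

lemma wrap_angle_control: "f \<in> borel_measurable borel \<Longrightarrow> (\<lambda>s. wrap_angle (f s)) \<in> controls"
proof -
  assume [measurable]: "f \<in> borel_measurable borel"
  have "(\<lambda>s. wrap_angle (f s)) \<in> borel_measurable borel" unfolding wrap_angle_def by measurable
  thus ?thesis by (simp add: controls_def wrap_angle_bounds)
qed

text \<open>Flying along the unit vector \<open>e\<close>, the attacker is at distance \<sigma> when
  the defender, starting at \<open>D\<close>, meets it after a path no longer. Flying on together
  they would bring the defender to the target within \<rho>. As it cannot be there with any margin,
  the triangle inequality is an equality and both started from the same point.\<close>

lemma no_early_interception:
  fixes A D e :: complex
  assumes e: "cmod e = 1" and \<sigma>: "0 \<le> \<sigma>" "\<sigma> < \<rho>" and D: "cmod (A + \<sigma> *\<^sub>R e - D) \<le> \<sigma>" and far: "\<rho> \<le> cmod (A + \<rho> *\<^sub>R e - D)"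
  shows "A = D"
proof -
  define X where "X = A + \<sigma> *\<^sub>R e - D"
  have ee: "e \<bullet> e = 1" using e by (simp add: norm_eq_1)
  have X2: "X \<bullet> X \<le> \<sigma>\<^sup>2" using D unfolding X_def[symmetric] power2_norm_eq_inner[symmetric] by (intro power_mono) auto
  have eq: "A + \<rho> *\<^sub>R e - D = X + (\<rho> - \<sigma>) *\<^sub>R e" by (simp add: X_def algebra_simps)
  have "\<rho>\<^sup>2 \<le> (cmod (X + (\<rho> - \<sigma>) *\<^sub>R e))\<^sup>2" using far \<sigma> unfolding eq by (intro power_mono) auto
  also have "\<dots> = X \<bullet> X + 2 * (\<rho> - \<sigma>) * (e \<bullet> X) + (\<rho> - \<sigma>)\<^sup>2"
    unfolding power2_norm_eq_inner by (simp add: inner_add_left inner_add_right inner_commute ee power2_eq_square algebra_simps)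
  finally have "2 * (\<rho> - \<sigma>) * \<sigma> \<le> 2 * (\<rho> - \<sigma>) * (e \<bullet> X)" using X2 by (simp add: power2_eq_square algebra_simps)
  hence eX: "\<sigma> \<le> e \<bullet> X" using \<sigma> by simp
  have "(X - \<sigma> *\<^sub>R e) \<bullet> (X - \<sigma> *\<^sub>R e) = X \<bullet> X - 2 * \<sigma> * (e \<bullet> X) + \<sigma>\<^sup>2"
    by (simp add: inner_diff_left inner_diff_right inner_commute ee power2_eq_square algebra_simps)
  also have "\<dots> \<le> \<sigma>\<^sup>2 - 2 * \<sigma> * \<sigma> + \<sigma>\<^sup>2" using X2 mult_left_mono[OF eX, of "2 * \<sigma>"] \<sigma> by simp
  finally have "(X - \<sigma> *\<^sub>R e) \<bullet> (X - \<sigma> *\<^sub>R e) \<le> 0" by (simp add: power2_eq_square)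
  hence "X = \<sigma> *\<^sub>R e" by (metis inner_eq_zero_iff inner_ge_zero order_antisym right_minus_eq)
  thus ?thesis by (simp add: X_def)
qed

definition game_value :: "real \<Rightarrow> real \<Rightarrow> state \<Rightarrow> real" where
  "game_value \<alpha> th z = cmod (miss \<alpha> (cis th) z (y_star \<alpha> th z))"

text \<open>For the aim parameter 0 the aim point is the midpoint of the missiles, also when they coincide.\<close>

lemma miss_0: "miss \<alpha> u z 0 = (posA z + posD z) / 2 - posB z - of_real (\<alpha> * x_m z) * u"
  by (simp add: miss_def aim_def radius_def x_m_def xA'_def)

lemma aim_direction:
  assumes AD: "posA z \<noteq> posD z"
  shows "cos (h - lam_A z) = c / radius z y \<Longrightarrow> sin (h - lam_A z) = s / radius z y \<Longrightarrow>
    cis h = sgn (posA z - posD z) * Complex c s / of_real (radius z y)"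
proof -
  assume "cos (h - lam_A z) = c / radius z y" "sin (h - lam_A z) = s / radius z y"
  hence "cis (h - lam_A z) = Complex c s / of_real (radius z y)" by (simp add: complex_eq_iff)
  moreover have "cis h = cis (lam_A z) * cis (h - lam_A z)" by (simp add: cis_mult)
  ultimately show ?thesis by (simp add: cis_lam_A[OF AD])
qed

lemma ln_lipschitz:
  assumes "0 < \<mu>"
  shows "(1 / \<mu>)-lipschitz_on {\<mu>..} (ln :: real \<Rightarrow> real)"
proof (rule lipschitz_on_leI)
  fix a b :: real assume ab: "a \<in> {\<mu>..}" "b \<in> {\<mu>..}" "a \<le> b"
  have "ln b - ln a \<le> (b - a) / a" using ab assms by (intro ln_diff_le) auto
  also have "\<dots> \<le> (b - a) / \<mu>" using ab assms by (intro divide_left_mono) auto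
  finally have "ln b - ln a \<le> (b - a) / \<mu>" .
  moreover have "ln a \<le> ln b" using ab assms by simp
  ultimately show "dist (ln a) (ln b) \<le> 1 / \<mu> * dist a b" using ab by (simp add: dist_real_def)
qed (use assms in simp)

lemma ln_comp_lipschitz:
  fixes f :: "real \<Rightarrow> real"
  assumes f: "K-lipschitz_on S f" and \<mu>: "0 < \<mu>" "\<And>t. t \<in> S \<Longrightarrow> \<mu> \<le> f t"
  shows "(1 / \<mu> * K)-lipschitz_on S (\<lambda>t. ln (f t))"
  by (rule lipschitz_on_compose2[OF f lipschitz_on_subset[OF ln_lipschitz[OF \<mu>(1)]]]) (use \<mu> in auto)

text \<open>The distance of two unit vectors is only of the order of the square root of the defect 1
  - e . f. The inequality between the means, with weight \<epsilon>, makes the bound linear in the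
  defect.\<close>

lemma inner_defect:
  fixes f e n :: "'a::real_inner"
  assumes "norm f = 1" "norm e = 1" "norm n = 1" "0 < \<epsilon>"
  shows "f \<bullet> n \<le> e \<bullet> n + \<epsilon> + (1 - e \<bullet> f) / (2 * \<epsilon>)"
proof -
  have ff: "f \<bullet> f = 1" "e \<bullet> e = 1" using assms by (simp_all add: norm_eq_1)
  have "(norm (f - e))\<^sup>2 = 2 * (1 - e \<bullet> f)"
    unfolding power2_norm_eq_inner by (simp add: inner_diff_left inner_diff_right inner_commute ff)
  moreover have "0 \<le> (norm (f - e) - 2 * \<epsilon>)\<^sup>2" by simp
  ultimately have "4 * \<epsilon> * norm (f - e) \<le> 2 * (1 - e \<bullet> f) + 4 * \<epsilon>\<^sup>2"
    by (simp add: power2_eq_square algebra_simps)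
  hence "norm (f - e) \<le> \<epsilon> + (1 - e \<bullet> f) / (2 * \<epsilon>)"
    using assms(4) by (simp add: field_simps power2_eq_square)
  moreover have "(f - e) \<bullet> n \<le> norm (f - e)" using norm_cauchy_schwarz[of "f - e" n] assms by simp
  ultimately show ?thesis by (simp add: inner_diff_left)
qed

definition straight :: "complex \<Rightarrow> complex \<Rightarrow> complex \<Rightarrow> state \<Rightarrow> real \<Rightarrow> state" where
  "straight b a d z t = (posB z + of_real t * b, posA z + of_real t * a, posD z + of_real t * d)"

lemma pos_straight [simp]:
  "posB (straight b a d z t) = posB z + of_real t * b"
  "posA (straight b a d z t) = posA z + of_real t * a"
  "posD (straight b a d z t) = posD z + of_real t * d"
  by (simp_all add: straight_def posA_def posB_def posD_def)

lemma straight_trajectory: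
  assumes "\<And>s. s \<in> {0..<T} \<Longrightarrow> velocity vB vA vD th (chi s) (psi s) = (b, a, d)"
  shows "trajectory vB vA vD th chi psi z (straight b a d z) {0..T}"
  unfolding trajectory_def
proof
  fix t assume t: "t \<in> {0..T}"
  have "((\<lambda>_. (b, a, d)) has_integral (t - 0) *\<^sub>R (b, a, d)) {0..t}"
    using has_integral_const_real[of "(b, a, d)" 0 t] t by simp
  hence "((\<lambda>s. velocity vB vA vD th (chi s) (psi s)) has_integral (t - 0) *\<^sub>R (b, a, d)) {0..t}"
    \<comment> \<open>The velocity need not be prescribed at the final time. In the application the
      missiles coincide there and the laws say nothing.\<close>
    by (rule has_integral_spike_finite[rotated 2, of _ _ _ "{T}"]) (use assms t in auto)
  moreover have "(t - 0) *\<^sub>R (b, a, d) = straight b a d z t - z"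
    by (simp add: prod_eq_iff straight_def posA_def posB_def posD_def scaleR_conv_of_real)
  ultimately show "((\<lambda>s. velocity vB vA vD th (chi s) (psi s)) has_integral straight b a d z t - z) {0..t}"
    by simp
qed

context
  fixes vB v th \<alpha> :: real
  assumes speeds: "0 < vB" "0 < v" and \<alpha>: "\<alpha> = vB / v" "\<alpha> < 1"
begin

lemma alpha_bounds: "0 < \<alpha>" "\<alpha> < 1" "\<alpha> * v = vB" "vB \<le> v"
proof -
  show "0 < \<alpha>" "\<alpha> < 1" "\<alpha> * v = vB" using speeds \<alpha> by simp_all
  thus "vB \<le> v" using speeds mult_right_mono[of \<alpha> 1 v] by simp
qed

lemmas asset_facts = alpha_bounds(1,2) norm_cis

lemmas speed_lipschitz =
  trajectory_lipschitz[OF _ less_imp_le[OF speeds(2)] less_imp_le[OF speeds(1)] alpha_bounds(4)]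

text \<open>Otherwise the attacker flies straight to the capture point, to which the defender is not
  strictly nearer. The asset arrives there at the same time, and an interception on the way is ruled
  out by \<open>no_early_interception\<close>, whatever the strategy of the defender.\<close>

lemma defender_region_guarded:
  assumes "z \<in> defender_region vB v v th"
  shows "guarded \<alpha> (cis th) z"
proof (rule ccontr)
  assume ng: "\<not> guarded \<alpha> (cis th) z"
  define C \<rho> where "C = capture_point \<alpha> (cis th) z" and "\<rho> = capture_distance \<alpha> (cis th) z"
  have far: "\<rho> \<le> cmod (C - posD z)"
    using ng guarded_iff[OF asset_facts] by (simp add: C_def \<rho>_def)
  have C: "cmod (C - posA z) = \<rho>" "0 \<le> \<rho>"
    using capture_point_dist capture_distance(2) alpha_bounds unfolding C_def \<rho>_def by auto
  define h where "h = wrap_angle (Arg (C - posA z))"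
  have reach: "C = posA z + \<rho> *\<^sub>R cis h"
    unfolding h_def cis_wrap_angle using C rcis_cmod_Arg[of "C - posA z"] by (simp add: rcis_def scaleR_conv_of_real)
  from assms obtain \<beta> where AD: "posA z \<noteq> posD z" and \<beta>: "nonanticipative \<beta>" and win:
    "\<And>chi x t. chi \<in> controls \<Longrightarrow> trajectory vB v v th chi (\<beta> chi) z x {0..} \<Longrightarrow> 0 \<le> t \<Longrightarrow> posA (x t) = posB (x t) \<Longrightarrow>
       \<exists>s\<in>{0..<t}. posA (x s) = posD (x s)"
    unfolding defender_region_def by blast
  define chi where "chi = (\<lambda>_::real. h)"
  have chi: "chi \<in> controls" unfolding chi_def h_def by (rule wrap_angle_control) simp
  hence "\<beta> chi \<in> controls" using \<beta> by (auto simp: nonanticipative_def)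
  from trajectory_exists[OF chi this] obtain x where x: "trajectory vB v v th chi (\<beta> chi) z x {0..}" by blast
  define t where "t = \<rho> / v"
  have t: "0 \<le> t" "v * t = \<rho>" using C speeds by (auto simp: t_def)
  have xt: "trajectory vB v v th chi (\<beta> chi) z x {0..t}" by (rule trajectory_subset[OF x]) auto
  have A: "posA (x s) = posA z + (v * s) *\<^sub>R cis h" if "s \<in> {0..t}" for s
  proof -
    have "((\<lambda>_. of_real v * cis h) has_integral (s - 0) *\<^sub>R (of_real v * cis h)) {0..s}"
      using has_integral_const_real[of "of_real v * cis h" 0 s] that by simp
    hence "posA (x s) - posA z = (s - 0) *\<^sub>R (of_real v * cis h)"
      using trajectory_integrals(1)[OF xt that] unfolding chi_def by (rule has_integral_unique[rotated])
    thus ?thesis by (simp add: scaleR_conv_of_real algebra_simps)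
  qed
  have "posA (x t) = C" using A[of t] t reach by simp
  moreover have "posB (x t) = C"
    using trajectory_posB[OF xt, of t] t unfolding C_def capture_point_def \<rho>_def[symmetric] t(2)[symmetric]
      alpha_bounds(3)[symmetric] by (simp add: mult.assoc)
  ultimately obtain s where s: "s \<in> {0..<t}" "posA (x s) = posD (x s)" using win[OF chi x t(1)] by auto
  have "cmod (posD (x s) - posD (x 0)) \<le> v * dist s 0"
    using lipschitz_onD[OF trajectory_lipschitz(2)[OF xt], of s 0] speeds alpha_bounds s by (simp add: dist_norm)
  hence D: "cmod (posD (x s) - posD z) \<le> v * s" using trajectory_start[OF xt t(1)] s by simp
  have "posA z = posD z"
  proof (rule no_early_interception)
    show "cmod (cis h) = 1" by simp
    show "0 \<le> v * s" "v * s < \<rho>" using s speeds by (auto simp flip: t(2))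
    show "cmod (posA z + (v * s) *\<^sub>R cis h - posD z) \<le> v * s" using D A[of s] s by simp
    show "\<rho> \<le> cmod (posA z + \<rho> *\<^sub>R cis h - posD z)" using far reach by simp
  qed
  thus False using AD by simp
qed

text \<open>The defender copies the motion of the attacker reflected in the initial bisector. Then the missiles
  collide when the attacker crosses the bisector, which it must do before it meets the asset.\<close>

lemma guarded_defender_region:
  assumes AD: "posA z \<noteq> posD z" and g: "guarded \<alpha> (cis th) z" and recede: "Re (relu (cis th) z) < 0"
  shows "z \<in> defender_region vB v v th"
proof -
  \<comment> \<open>Reflection of a heading in the bisector, which is perpendicular to the direction
    \<open>lam_A z\<close>. It uses only the present value of the attacker's control.\<close>
  define \<beta> where "\<beta> = (\<lambda>chi (s::real). wrap_angle (pi - chi s + 2 * lam_A z))"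
  have "\<beta> chi \<in> controls" if "chi \<in> controls" for chi
  proof -
    have [measurable]: "chi \<in> borel_measurable borel" using that by (simp add: controls_def)
    show ?thesis unfolding \<beta>_def by (rule wrap_angle_control) measurable
  qed
  hence \<beta>: "nonanticipative \<beta>" unfolding nonanticipative_def \<beta>_def by auto
  have "\<exists>s\<in>{0..<t}. posA (x s) = posD (x s)"
    if chi: "chi \<in> controls" and x: "trajectory vB v v th chi (\<beta> chi) z x {0..}" and t: "0 \<le> t" and hit: "posA (x t) = posB (x t)"
    for chi x t
  proof -
    have xt: "trajectory vB v v th chi (\<beta> chi) z x {0..t}" by (rule trajectory_subset[OF x]) auto
    define n where "n = sgn (posA z - posD z)"
    define M where "M = (posA z + posD z) / 2"
    have n: "cmod n = 1" "cnj n * n = 1" using sgn_unit cnj_mult_unit AD by (auto simp: n_def)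
    have nl: "n = cis (lam_A z)" using cis_lam_A[OF AD] by (simp add: n_def)
    define pA pD where "pA = (\<lambda>s. cnj n * (posA (x s) - M))" and "pD = (\<lambda>s. cnj n * (posD (x s) - M))"
    have AD': "cnj n * (posA z - posD z) = of_real (2 * x_m z)"
      using A_minus_D[of z] n unfolding n_def by (metis mult.left_commute mult.right_neutral)
    have pA0: "cnj n * (posA z - M) = of_real (x_m z)" and pD0: "cnj n * (posD z - M) = - of_real (x_m z)"
    proof -
      have e: "posA z - M = (posA z - posD z) / 2" "posD z - M = - ((posA z - posD z) / 2)" by (simp_all add: M_def field_simps)
      show "cnj n * (posA z - M) = of_real (x_m z)" "cnj n * (posD z - M) = - of_real (x_m z)"
        by (simp_all only: e times_divide_eq_right mult_minus_right AD') simp_all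
    qed
    have mirror: "pD s = - cnj (pA s)" if s: "s \<in> {0..t}" for s
    proof -
      have "bounded_linear (\<lambda>w. - (n * cnj (cnj n * w)))"
        by (intro bounded_linear_minus bounded_linear_compose[OF bounded_linear_mult_right]
            bounded_linear_compose[OF bounded_linear_cnj] bounded_linear_mult_right bounded_linear_ident)
      from has_integral_linear[OF trajectory_integrals(1)[OF xt s] this]
      have "((\<lambda>s. - (n * cnj (cnj n * (of_real v * cis (chi s))))) has_integral - (n * cnj (cnj n * (posA (x s) - posA z)))) {0..s}"
        by (simp add: o_def)
      moreover have "- (n * cnj (cnj n * (of_real v * cis (chi s)))) = of_real v * cis (\<beta> chi s)" for s
      proof -
        have "- (n * cnj (cnj n * (of_real v * cis (chi s)))) = of_real v * (cis pi * (cis (lam_A z) * (cis (lam_A z) * cis (- chi s))))"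
          unfolding nl by (simp add: cis_cnj)
        also have "\<dots> = of_real v * cis (\<beta> chi s)" unfolding \<beta>_def cis_wrap_angle cis_mult by (simp add: algebra_simps)
        finally show ?thesis .
      qed
      ultimately have "((\<lambda>s. of_real v * cis (\<beta> chi s)) has_integral - (n * cnj (cnj n * (posA (x s) - posA z)))) {0..s}"
        by simp
      hence "posD (x s) - posD z = - (n * cnj (cnj n * (posA (x s) - posA z)))"
        using trajectory_integrals(2)[OF xt s] has_integral_unique by blast
      hence "cnj n * (posD (x s) - posD z) = - (cnj n * n * cnj (cnj n * (posA (x s) - posA z)))" by simp
      hence "pD s - cnj n * (posD z - M) = - cnj (pA s - cnj n * (posA z - M))"
        unfolding n pA_def pD_def by (simp add: algebra_simps)
      thus ?thesis unfolding pA0 pD0 by simp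
    qed
    have start: "x 0 = z" by (rule trajectory_start[OF xt t])
    have "cmod (posA (x t) - posA z) \<le> v * t"
      using lipschitz_onD[OF trajectory_lipschitz(1)[OF xt], of t 0] speeds alpha_bounds t start by (simp add: dist_norm)
    moreover have Bt: "posB (x t) = posB z + of_real (\<alpha> * (v * t)) * cis th"
      using trajectory_posB[OF xt, of t] t unfolding alpha_bounds(3)[symmetric] by (simp add: mult.assoc)
    ultimately have le: "capture_distance \<alpha> (cis th) z \<le> v * t"
      using capture_distance_le[OF asset_facts] hit by metis
    have "Re (relB z) + \<alpha> * capture_distance \<alpha> (cis th) z * Re (relu (cis th) z) < 0"
      using g unfolding guarded_iff[OF asset_facts]
      using closer_to_D_iff(1)[OF asset_facts AD, of "capture_distance \<alpha> (cis th) z" th]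
        capture_distance(1)[OF asset_facts, of z th]
      by (simp add: capture_point_def)
    \<comment> \<open>The meeting is not earlier than the undisturbed capture, and as the asset
      recedes, it is then at least as far on the defender's side.\<close>
    moreover have "\<alpha> * (v * t) * Re (relu (cis th) z) \<le> \<alpha> * capture_distance \<alpha> (cis th) z * Re (relu (cis th) z)"
      using le recede alpha_bounds by (intro mult_right_mono_neg mult_left_mono) auto
    ultimately have "Re (relB z + of_real (\<alpha> * (v * t)) * relu (cis th) z) < 0" by simp
    moreover have "pA t = relB z + of_real (\<alpha> * (v * t)) * relu (cis th) z"
      unfolding pA_def hit Bt relB_def relu_def n_def M_def by (simp add: algebra_simps)
    ultimately have neg: "Re (pA t) < 0" by simp
    have pos: "Re (pA 0) > 0" unfolding pA_def start pA0 using x_m_pos[OF AD] by simp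
    have "continuous_on {0..t} (\<lambda>s. Re (pA s))"
      unfolding pA_def using lipschitz_on_continuous_on[OF trajectory_lipschitz(1)[OF xt]] speeds alpha_bounds
      by (auto intro!: continuous_intros)
    hence "\<exists>s\<ge>0. s \<le> t \<and> Re (pA s) = 0" by (intro IVT2') (use neg pos t in auto)
    then obtain s where s: "0 \<le> s" "s \<le> t" "Re (pA s) = 0" by blast
    have "s \<noteq> t" using s neg by auto
    moreover have "posA (x s) = posD (x s)"
    proof -
      have "pD s = pA s" using mirror[of s] s by (simp add: complex_eq_iff)
      hence "n * (cnj n * (posD (x s) - M)) = n * (cnj n * (posA (x s) - M))" by (simp add: pA_def pD_def)
      hence "cnj n * n * (posD (x s) - M) = cnj n * n * (posA (x s) - M)" by (simp add: mult_ac)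
      thus ?thesis unfolding n by simp
    qed
    ultimately show ?thesis using s by (intro bexI[of _ s]) auto
  qed
  thus ?thesis unfolding defender_region_def using AD \<beta> by blast
qed

section \<open>Guarantee of the defender\<close>

abbreviation (input) "val \<equiv> game_value \<alpha> th"

lemma best_y_star: "posA z \<noteq> posD z \<Longrightarrow> best \<alpha> (cis th) z (y_star \<alpha> th z)"
  by (rule y_star_best) (use alpha_bounds in auto)

lemma value_le: "posA z \<noteq> posD z \<Longrightarrow> val z \<le> cmod (miss \<alpha> (cis th) z y)"
  using best_y_star unfolding best_def game_value_def by blast

lemma value_lipschitz:
  assumes tr: "trajectory vB v v th chi psi z0 x {0..T}" and sub: "{a..b} \<subseteq> {0..T}"
    and AD: "\<And>t. t \<in> {a..b} \<Longrightarrow> posA (x t) \<noteq> posD (x t)"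
  obtains K where "K-lipschitz_on {a..b} (\<lambda>t. val (x t))"
proof -
  have l: "v-lipschitz_on {a..b} (\<lambda>t. posA (x t))" "v-lipschitz_on {a..b} (\<lambda>t. posD (x t))"
      "v-lipschitz_on {a..b} (\<lambda>t. posB (x t))"
    using trajectory_lipschitz[OF tr] lipschitz_on_subset[OF _ sub] speeds alpha_bounds by auto
  show thesis
    using best_miss_lipschitz[OF asset_facts l AD best_y_star[OF AD]] that
    unfolding game_value_def by blast
qed

context
  fixes psi :: "state \<Rightarrow> real"
  assumes law: "\<And>z. posA z \<noteq> posD z \<Longrightarrow>
      cos (psi z - lam_A z) = x_m z / sqrt ((x_m z)^2 + (y_star \<alpha> th z)^2) \<and>
      sin (psi z - lam_A z) = y_star \<alpha> th z / sqrt ((x_m z)^2 + (y_star \<alpha> th z)^2)"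
begin

lemma defender_velocity:
  assumes AD: "posA z \<noteq> posD z"
  shows "of_real v * cis (psi z) = of_real (v / radius z (y_star \<alpha> th z)) * (aim z (y_star \<alpha> th z) - posD z)"
  using aim_direction[OF AD, of "psi z" "x_m z" "y_star \<alpha> th z" "y_star \<alpha> th z"] law[OF AD]
  by (simp add: aim_rel radius_def)

text \<open>At each time the majorant is the miss for the parameter chosen at that time. Guardedness
  is required at interior times only, so that t may be the first time at which it fails.\<close>

lemma defender_value_mono:
  assumes tr: "trajectory vB v v th chi (\<lambda>t. psi (x t)) z0 x {0..T}" and t: "0 \<le> t" "t \<le> T"
    and AD: "\<And>s. s \<in> {0..t} \<Longrightarrow> posA (x s) \<noteq> posD (x s)"
    and g: "\<And>s. s \<in> {0<..<t} \<Longrightarrow> guarded \<alpha> (cis th) (x s)"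
  shows "val (x 0) \<le> val (x t)"
proof -
  have "{0..t} \<subseteq> {0..T}" using t by auto
  from value_lipschitz[OF tr this AD] obtain K where K: "K-lipschitz_on {0..t} (\<lambda>s. val (x s))" by blast
  obtain N where N: "negligible N" and der: "\<And>t. t \<in> {0<..<T} - N \<Longrightarrow>
     velocities vB v th (chi t) (psi (x t)) x t"
    using trajectory_derivatives[OF tr] by blast
  show ?thesis
  proof (rule mono_from_majorant[OF t(1) K N])
    fix s assume s: "s \<in> {0<..<t} - N"
    have ADs: "posA (x s) \<noteq> posD (x s)" by (rule AD) (use s in auto)
    let ?y = "y_star \<alpha> th (x s)"
    have d: "((\<lambda>s. posA (x s)) has_vector_derivative of_real v * cis (chi s)) (at s)"
     "((\<lambda>s. posD (x s)) has_vector_derivative of_real v * cis (psi (x s))) (at s)"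
     "((\<lambda>s. posB (x s)) has_vector_derivative of_real (\<alpha> * v) * cis th) (at s)"
      unfolding alpha_bounds(3) using der[of s] s t by (auto simp: velocities_def)
    obtain \<Delta> where "((\<lambda>q. cmod (miss \<alpha> (cis th) (x q) ?y)) has_real_derivative \<Delta>) (at s)" "0 \<le> \<Delta>"
    proof (rule miss_increases[OF asset_facts speeds(2) ADs _ best_y_star[OF ADs] d defender_velocity[OF ADs]])
      show "guarded \<alpha> (cis th) (x s)" by (rule g) (use s in auto)
      show "cmod (of_real v * cis (chi s)) \<le> v" using speeds by (simp add: norm_mult)
    qed
    thus "\<exists>\<phi> D. \<phi> s = val (x s) \<and> (\<forall>q\<in>{0..t}. val (x q) \<le> \<phi> q) \<and> (\<phi> has_real_derivative D) (at s) \<and> 0 \<le> D"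
      using value_le AD by (intro exI[of _ "\<lambda>q. cmod (miss \<alpha> (cis th) (x q) ?y)"] exI[of _ \<Delta>]) (auto simp: game_value_def)
  qed
qed

text \<open>Leaving the guarded states would require passing through a state of value 0, while the value does
  not decrease.\<close>

lemma defender_keeps_guarded:
  assumes tr: "trajectory vB v v th chi (\<lambda>t. psi (x t)) z0 x {0..T}" and T: "0 \<le> T"
    and AD: "\<And>s. s \<in> {0..T} \<Longrightarrow> posA (x s) \<noteq> posD (x s)" and g0: "guarded \<alpha> (cis th) z0" and t: "t \<in> {0..T}"
  shows "guarded \<alpha> (cis th) (x t)"
proof (rule ccontr)
  assume ng: "\<not> guarded \<alpha> (cis th) (x t)"
  define f where "f s = cmod (capture_point \<alpha> (cis th) (x s) - posD (x s)) - capture_distance \<alpha> (cis th) (x s)" for s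
  have guarded_f: "guarded \<alpha> (cis th) (x s) \<longleftrightarrow> f s < 0" for s
    unfolding f_def guarded_iff[OF asset_facts] by simp
  have start: "x 0 = z0" by (rule trajectory_start[OF tr T])
  note lip = speed_lipschitz[OF tr]
  note cont = lip[THEN lipschitz_on_continuous_on]
  have fc: "continuous_on {0..T} f"
    unfolding f_def
    by (intro continuous_intros cont capture_point_cont[OF asset_facts] capture_distance_cont[OF asset_facts])
  have f0: "f 0 < 0" using g0 guarded_f[of 0] unfolding start by blast
  have zero: "\<exists>q\<in>{0..s}. f q = 0" if "s \<in> {0..T}" "\<not> f s < 0" for s
  proof -
    have "\<exists>q\<ge>0. q \<le> s \<and> f q = 0"
      by (rule IVT') (use that f0 continuous_on_subset[OF fc] in auto)
    thus ?thesis by auto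
  qed
  define S where "S = {s \<in> {0..T}. f s = 0}"
  have "compact S"
    unfolding S_def using continuous_closed_preimage_constant[OF fc closed_atLeastAtMost, of 0]
    by (metis (no_types, lifting) Collect_cong bounded_closed_interval bounded_subset compact_eq_bounded_closed mem_Collect_eq subsetI)
  moreover have "S \<noteq> {}"
  proof -
    have "\<not> f t < 0" using ng guarded_f[of t] by blast
    from zero[OF t this] obtain q where "q \<in> {0..t}" "f q = 0" by blast
    hence "q \<in> S" using t by (auto simp: S_def)
    thus ?thesis by blast
  qed
  ultimately obtain s where s: "s \<in> S" and least: "\<And>q. q \<in> S \<Longrightarrow> s \<le> q"
    using compact_attains_inf[of S] by metis
  have s0: "s \<in> {0..T}" "f s = 0" using s by (auto simp: S_def)
  have g: "guarded \<alpha> (cis th) (x q)" if q: "q \<in> {0<..<s}" for q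
  proof (rule ccontr)
    assume "\<not> guarded \<alpha> (cis th) (x q)"
    hence "\<exists>p\<in>{0..q}. f p = 0" by (intro zero) (use q s0 guarded_f in auto)
    then obtain p where "p \<in> {0..q}" "f p = 0" by blast
    hence "s \<le> p" using q s0 by (intro least) (auto simp: S_def)
    thus False using \<open>p \<in> {0..q}\<close> q by simp
  qed
  have "val (x 0) \<le> val (x s)"
    by (rule defender_value_mono[OF tr _ _ _ g]) (use s0 AD in auto)
  moreover have "0 < val (x 0)"
    unfolding start game_value_def by (rule guarded_miss_pos[OF asset_facts _ g0]) (use AD[of 0] start T in auto)
  \<comment> \<open>Where \<open>f\<close> vanishes, the capture point is equidistant from the
    missiles and hence an aim point with miss 0.\<close>
  moreover have "val (x s) \<le> 0"
  proof -
    have "cmod (posB (x s) + of_real (\<alpha> * capture_distance \<alpha> (cis th) (x s)) * cis th - posD (x s)) = capture_distance \<alpha> (cis th) (x s)"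
      using s0(2) unfolding f_def capture_point_def by simp
    from capture_on_bisector[OF asset_facts AD[OF s0(1)] capture_distance(1)[OF asset_facts] this]
    obtain y where y: "miss \<alpha> (cis th) (x s) y = 0" by blast
    show ?thesis using value_le[OF AD[OF s0(1)], of y] unfolding y by simp
  qed
  ultimately show False by linarith
qed

text \<open>Capture cannot occur while the missiles are apart, because it is not a guarded state. In
  an interception the value stays below the miss at the midpoint, which unlike the best aim point
  has a limit at the collision, namely the payoff.\<close>

lemma defender_guarantee:
  assumes pl: "play vB v v th chi psi z0 x tf" and AD: "posA z0 \<noteq> posD z0" and g0: "guarded \<alpha> (cis th) z0"
  shows "val z0 \<le> payoff (x tf)"
proof -
  have tf: "0 \<le> tf" and tr: "trajectory vB v v th (\<lambda>t. chi (x t)) (\<lambda>t. psi (x t)) z0 x {0..tf}"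
    and fin: "terminal (x tf)" and nterm: "\<And>t. t \<in> {0..<tf} \<Longrightarrow> \<not> terminal (x t)"
    using pl by (auto simp: play_def)
  have start: "x 0 = z0" by (rule trajectory_start[OF tr tf])
  have ADt: "posA (x t) \<noteq> posD (x t)" if "t \<in> {0..<tf}" for t using nterm[OF that] by (simp add: terminal_def)
  show ?thesis
  proof (cases "posA (x tf) = posD (x tf)")
    case False
    have "guarded \<alpha> (cis th) (x tf)"
      by (rule defender_keeps_guarded[OF tr tf _ g0]) (use False ADt tf in \<open>auto simp: less_le\<close>)
    moreover have "posA (x tf) = posB (x tf)" using fin False by (simp add: terminal_def)
    ultimately show ?thesis using not_guarded_at_capture[OF asset_facts] by blast
  next
    case True
    have "tf \<noteq> 0" using True AD start by auto
    hence tf0: "0 < tf" using tf by simp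
    have le: "val z0 \<le> cmod (miss \<alpha> (cis th) (x t) 0)" if t: "t \<in> {0..<tf}" for t
    proof -
      have tr': "trajectory vB v v th (\<lambda>t. chi (x t)) (\<lambda>t. psi (x t)) z0 x {0..t}"
        by (rule trajectory_subset[OF tr]) (use t in auto)
      have "val (x 0) \<le> val (x t)"
      proof (rule defender_value_mono[OF tr' _ order_refl])
        fix s assume "s \<in> {0<..<t}"
        thus "guarded \<alpha> (cis th) (x s)" by (intro defender_keeps_guarded[OF tr' _ _ g0]) (use t ADt in auto)
      qed (use t ADt in auto)
      also have "\<dots> \<le> cmod (miss \<alpha> (cis th) (x t) 0)" by (rule value_le[OF ADt[OF t]])
      finally show ?thesis unfolding start .
    qed
    note lip = speed_lipschitz[OF tr]
    note cont = lip[THEN lipschitz_on_continuous_on]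
    have c: "continuous_on {0..tf} (\<lambda>t. cmod (miss \<alpha> (cis th) (x t) 0))"
      unfolding miss_0 x_m_def xA'_def by (intro continuous_intros cont) auto
    have "((\<lambda>t. cmod (miss \<alpha> (cis th) (x t) 0)) \<longlongrightarrow> cmod (miss \<alpha> (cis th) (x tf) 0)) (at tf within {0..<tf})"
    proof (rule tendsto_within_subset)
      show "((\<lambda>t. cmod (miss \<alpha> (cis th) (x t) 0)) \<longlongrightarrow> cmod (miss \<alpha> (cis th) (x tf) 0)) (at tf within {0..tf})"
        using c tf by (simp add: continuous_on_def)
    qed auto
    moreover have "\<forall>\<^sub>F t in at tf within {0..<tf}. val z0 \<le> cmod (miss \<alpha> (cis th) (x t) 0)"
      unfolding eventually_at_filter using le by (intro always_eventually) auto
    moreover have "at tf within {0..<tf} \<noteq> bot" using tf0 by (simp add: at_within_eq_bot_iff)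
    ultimately have "val z0 \<le> cmod (miss \<alpha> (cis th) (x tf) 0)" by (intro tendsto_lowerbound)
    also have "\<dots> = payoff (x tf)" unfolding miss_0 True by (simp add: x_m_def xA'_def True payoff_def dist_norm)
    finally show ?thesis .
  qed
qed

end

section \<open>Guarantee of the attacker\<close>

context
  fixes chi :: "state \<Rightarrow> real"
  assumes law: "\<And>z. posA z \<noteq> posD z \<Longrightarrow>
      cos (chi z - lam_A z) = (x_m z - xA' z) / sqrt ((x_m z - xA' z)^2 + (y_star \<alpha> th z)^2) \<and>
      sin (chi z - lam_A z) = y_star \<alpha> th z / sqrt ((x_m z - xA' z)^2 + (y_star \<alpha> th z)^2)"
begin

lemma attacker_velocity:
  assumes AD: "posA z \<noteq> posD z"
  shows "of_real v * cis (chi z) = of_real (v / radius z (y_star \<alpha> th z)) * (aim z (y_star \<alpha> th z) - posA z)"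
proof -
  have e: "x_m z - xA' z = - x_m z" by (simp add: x_m_def)
  show ?thesis
    using aim_direction[OF AD, of "chi z" "- x_m z" "y_star \<alpha> th z" "y_star \<alpha> th z"] law[OF AD, unfolded e]
    by (simp add: aim_rel radius_def)
qed

context
  fixes psi :: "real \<Rightarrow> real" and z0 :: state and x :: "real \<Rightarrow> state" and T :: real
  assumes tr: "trajectory vB v v th (\<lambda>t. chi (x t)) psi z0 x {0..T}"
    and AD: "\<And>t. t \<in> {0..<T} \<Longrightarrow> posA (x t) \<noteq> posD (x t)"
    and g: "\<And>t. t \<in> {0..<T} \<Longrightarrow> guarded \<alpha> (cis th) (x t)"
begin

text \<open>One minus the cosine of the angle between the defender's heading and its direction to
  the best aim point.\<close>

definition defect :: "real \<Rightarrow> real" where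
  "defect t = 1 - (aim (x t) (y_star \<alpha> th (x t)) - posD (x t)) \<bullet> cis (psi t) / radius (x t) (y_star \<alpha> th (x t))"

lemma radius_pos: "posA z \<noteq> posD z \<Longrightarrow> 0 < radius z y"
  using x_m_pos[of z] unfolding radius_def by (simp add: add_pos_nonneg)

lemma unit_aim:
  assumes "posA z \<noteq> posD z"
  shows "cmod ((aim z y - posD z) /\<^sub>R radius z y) = 1"
  using aim_dist(2)[OF assms] radius_pos[OF assms, of y] by simp

lemma defect_nonneg: assumes "posA (x t) \<noteq> posD (x t)" shows "0 \<le> defect t"
proof -
  let ?y = "y_star \<alpha> th (x t)"
  let ?e = "(aim (x t) ?y - posD (x t)) /\<^sub>R radius (x t) ?y"
  have "?e \<bullet> cis (psi t) \<le> cmod ?e * cmod (cis (psi t))" by (rule norm_cauchy_schwarz)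
  hence "?e \<bullet> cis (psi t) \<le> 1" unfolding unit_aim[OF assms] by simp
  thus ?thesis by (simp add: defect_def divide_inverse mult.commute)
qed

context
  fixes t :: real
  assumes t: "t \<in> {0..<T}"
    and der: "velocities vB v th (chi (x t)) (psi t) x t"
begin

lemma value_rate:
  obtains \<Delta> where
    "((\<lambda>s. cmod (miss \<alpha> (cis th) (x s) (y_star \<alpha> th (x t)))) has_real_derivative \<Delta>) (at t)"
    "\<Delta> \<le> - (radius (x t) (y_star \<alpha> th (x t)) / x_m (x t) * ((1 - \<alpha>)\<^sup>2 / (1 + \<alpha>) / 2) * (v * defect t))"
proof -
  have ADt: "posA (x t) \<noteq> posD (x t)" by (rule AD[OF t])
  let ?y = "y_star \<alpha> th (x t)"
  have d: "((\<lambda>s. posA (x s)) has_vector_derivative of_real v * cis (chi (x t))) (at t)"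
   "((\<lambda>s. posD (x s)) has_vector_derivative of_real v * cis (psi t)) (at t)"
   "((\<lambda>s. posB (x s)) has_vector_derivative of_real (\<alpha> * v) * cis th) (at t)"
    unfolding alpha_bounds(3) using der by (auto simp: velocities_def)
  have dv: "cmod (of_real v * cis (psi t)) \<le> v" using speeds by (simp add: norm_mult)
  have best: "best \<alpha> (cis th) (x t) ?y" by (rule best_y_star[OF ADt])
  obtain \<Delta> where \<Delta>: "((\<lambda>s. cmod (miss \<alpha> (cis th) (x s) ?y)) has_real_derivative \<Delta>) (at t)"
    "\<Delta> \<le> - (radius (x t) ?y / x_m (x t) * ((1 - \<alpha>)\<^sup>2 / (1 + \<alpha>) / 2) * (v - (aim (x t) ?y - posD (x t)) \<bullet> (of_real v * cis (psi t)) / radius (x t) ?y))"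
    by (rule miss_decreases[OF asset_facts speeds(2) ADt g[OF t] best d attacker_velocity[OF ADt] dv])
  have "v - (aim (x t) ?y - posD (x t)) \<bullet> (of_real v * cis (psi t)) / radius (x t) ?y = v * defect t"
    unfolding defect_def scaleR_conv_of_real[symmetric] inner_scaleR_right by (simp add: algebra_simps)
  with \<Delta> that show thesis by simp
qed

text \<open>If both missiles flew to the aim point at distance R, the separation 2 m would close at
  the rate 2 v m / R. While R stays away from 0 this is at most proportional to the separation and
  alone would not bring it to 0 in finite time. Faster closing requires the defender to deviate, and
  \<open>inner_defect\<close> measures what it can gain.\<close>

lemma separation_rate:
  assumes \<epsilon>: "0 < \<epsilon>"
  obtains \<Delta> where "((\<lambda>s. 2 * x_m (x s)) has_real_derivative \<Delta>) (at t)"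
    "- \<Delta> \<le> v * (2 * x_m (x t) / radius (x t) (y_star \<alpha> th (x t)) + \<epsilon> + defect t / (2 * \<epsilon>))"
proof -
  have ADt: "posA (x t) \<noteq> posD (x t)" by (rule AD[OF t])
  let ?y = "y_star \<alpha> th (x t)"
  define R m where "R = radius (x t) ?y" and "m = x_m (x t)"
  define n where "n = sgn (posA (x t) - posD (x t))"
  have n: "cmod n = 1" unfolding n_def using sgn_unit ADt by simp
  define \<Delta>' where "\<Delta>' = (of_real v * cis (chi (x t)) - of_real v * cis (psi t)) \<bullet> n"
  have "((\<lambda>s. posA (x s) - posD (x s)) has_vector_derivative (of_real v * cis (chi (x t)) - of_real v * cis (psi t))) (at t)"
    by (intro has_vector_derivative_diff) (use der in \<open>auto simp: velocities_def\<close>)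
  from norm_has_real_derivative[OF this] ADt
  have der2: "((\<lambda>s. 2 * x_m (x s)) has_real_derivative \<Delta>') (at t)"
    by (simp add: x_m_def xA'_def \<Delta>'_def n_def)
  have comp: "(n * Complex c s) \<bullet> n = c" for c s
  proof -
    have "(n * Complex c s) \<bullet> n = ((Re n)\<^sup>2 + (Im n)\<^sup>2) * c" by (simp add: inner_complex_def power2_eq_square algebra_simps)
    moreover have "(Re n)\<^sup>2 + (Im n)\<^sup>2 = 1" using n by (simp add: cmod_def)
    ultimately show ?thesis by simp
  qed
  have A: "(of_real v * cis (chi (x t))) \<bullet> n = - (v * m / R)"
  proof -
    have "of_real v * cis (chi (x t)) = (v / R) *\<^sub>R (n * Complex (- m) ?y)"
      using attacker_velocity[OF ADt] unfolding aim_rel R_def m_def n_def by (simp add: scaleR_conv_of_real)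
    thus ?thesis by (simp add: comp)
  qed
  define e where "e = (aim (x t) ?y - posD (x t)) /\<^sub>R R"
  have en: "e \<bullet> n = m / R"
    unfolding e_def aim_rel inner_scaleR_left n_def[symmetric] comp by (simp add: m_def divide_inverse mult.commute)
  have "cis (psi t) \<bullet> n \<le> e \<bullet> n + \<epsilon> + (1 - e \<bullet> cis (psi t)) / (2 * \<epsilon>)"
    by (rule inner_defect) (use unit_aim[OF ADt] n \<epsilon> in \<open>auto simp: e_def R_def\<close>)
  also have "1 - e \<bullet> cis (psi t) = defect t"
    unfolding e_def defect_def R_def by (simp add: divide_inverse mult.commute)
  finally have "v * (cis (psi t) \<bullet> n) \<le> v * (m / R + \<epsilon> + defect t / (2 * \<epsilon>))"
    unfolding en using speeds by (intro mult_left_mono) auto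
  moreover have "- \<Delta>' = v * m / R + v * (cis (psi t) \<bullet> n)"
    unfolding \<Delta>'_def inner_diff_left A by (simp add: scaleR_conv_of_real[symmetric])
  ultimately have "- \<Delta>' \<le> v * (2 * m / R + \<epsilon> + defect t / (2 * \<epsilon>))" by (simp add: algebra_simps)
  with der2 that show thesis unfolding R_def m_def by blast
qed

end

lemma attacker_value_antimono:
  assumes t: "t \<in> {0..<T}"
  shows "val (x t) \<le> val z0"
proof -
  have sub: "{0..t} \<subseteq> {0..T}" using t by auto
  have ADt: "posA (x s) \<noteq> posD (x s)" if "s \<in> {0..t}" for s using AD that t by auto
  from value_lipschitz[OF tr sub ADt] obtain K where K: "K-lipschitz_on {0..t} (\<lambda>s. val (x s))" by blast
  obtain N where N: "negligible N" and der: "\<And>t. t \<in> {0<..<T} - N \<Longrightarrow>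
     velocities vB v th (chi (x t)) (psi t) x t"
    using trajectory_derivatives[OF tr] by blast
  have "val (x t) \<le> val (x 0)"
  proof (rule antimono_from_majorant[OF _ K N])
    fix s assume s: "s \<in> {0<..<t} - N"
    have ADs: "posA (x s) \<noteq> posD (x s)" using ADt s by auto
    have s': "s \<in> {0<..<T} - N" and s0: "s \<in> {0..<T}" using s t by auto
    obtain \<Delta> where
      \<Delta>: "((\<lambda>q. cmod (miss \<alpha> (cis th) (x q) (y_star \<alpha> th (x s)))) has_real_derivative \<Delta>) (at s)"
      "\<Delta> \<le> - (radius (x s) (y_star \<alpha> th (x s)) / x_m (x s) * ((1 - \<alpha>)\<^sup>2 / (1 + \<alpha>) / 2) * (v * defect s))"
      by (rule value_rate[OF s0 der[OF s']])
    have "0 \<le> radius (x s) (y_star \<alpha> th (x s)) / x_m (x s) * ((1 - \<alpha>)\<^sup>2 / (1 + \<alpha>) / 2) * (v * defect s)"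
      using radius_pos[OF ADs, of "y_star \<alpha> th (x s)"] x_m_pos[OF ADs] defect_nonneg[OF ADs] alpha_bounds(1) speeds
      by (intro mult_nonneg_nonneg divide_nonneg_nonneg) auto
    hence "\<Delta> \<le> 0" using \<Delta>(2) by linarith
    thus "\<exists>\<phi> D. \<phi> s = val (x s) \<and> (\<forall>q\<in>{0..t}. val (x q) \<le> \<phi> q) \<and> (\<phi> has_real_derivative D) (at s) \<and> D \<le> 0"
      using value_le[OF ADt] \<Delta>(1)
      by (intro exI[of _ "\<lambda>q. cmod (miss \<alpha> (cis th) (x q) (y_star \<alpha> th (x s)))"] exI[of _ \<Delta>]) (auto simp: game_value_def)
  qed (use t in auto)
  thus ?thesis using trajectory_start[OF tr] t by simp
qed

text \<open>If the aim point stays away from the attacker while the missiles collide at a positive rate, the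
  defender must keep turning the line of sight, and each turn by a fixed amount costs it a fixed
  amount of value: with suitable constants, the value minus the logarithm of the separation grows at most
  like minus one half of the logarithm of the time to go. As the separation is at most proportional to the time to
  go, the value would have to become negative.\<close>

lemma aim_not_bounded_away:
  assumes c: "0 < c" and sep: "\<And>t. t \<in> {0..T} \<Longrightarrow> c * (T - t) \<le> dist (posA (x t)) (posD (x t))"
    and coll: "posA (x T) = posD (x T)" and t1: "0 \<le> t1" "t1 < T" and r0: "0 < r0"
    and far: "\<And>t. t \<in> {t1..<T} \<Longrightarrow> r0 \<le> radius (x t) (y_star \<alpha> th (x t))"
  shows False
proof -
  \<comment> \<open>With the lower bound on the separation this makes
    \<open>v * \<epsilon> / (2 * m)\<close> at most one half of the reciprocal of the time to
    go.\<close>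
  define \<epsilon> where "\<epsilon> = c / (2 * v)"
  define \<kappa> where "\<kappa> = (1 - \<alpha>)\<^sup>2 / (1 + \<alpha>) / 2"
  \<comment> \<open>Scales the loss of value so that it cancels the defect term in the logarithmic
    closing rate.\<close>
  define K where "K = 1 / (4 * \<epsilon> * r0 * \<kappa>)"
  have \<epsilon>: "\<epsilon> > 0" using c speeds by (simp add: \<epsilon>_def)
  have \<kappa>: "\<kappa> > 0" using alpha_bounds by (simp add: \<kappa>_def)
  have K: "K > 0" using \<epsilon> \<kappa> r0 by (simp add: K_def)
  have T0: "0 \<le> T" using t1 by simp
  have sep': "2 * x_m (x t) = dist (posA (x t)) (posD (x t))" for t by (simp add: x_m_def xA'_def dist_norm)
  note lip = speed_lipschitz[OF tr]
  \<comment> \<open>In the derivative the first term absorbs the defect, the third the part of the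
    closing rate due to \<open>\<epsilon>\<close>, and the last the part \<open>v / R\<close>, which
    is at most \<open>v / r0\<close>.\<close>
  define F where "F t = K * val (x t) - ln (2 * x_m (x t)) + 1/2 * ln (T - t) - v / r0 * t" for t
  obtain N where N: "negligible N" and der: "\<And>t. t \<in> {0<..<T} - N \<Longrightarrow>
     velocities vB v th (chi (x t)) (psi t) x t"
    using trajectory_derivatives[OF tr] by blast
  have mono: "F t2 \<le> F t1" if t2: "t1 < t2" "t2 < T" for t2
  proof -
    have sub: "{t1..t2} \<subseteq> {0..T}" using t1 t2 by auto
    have ADt: "posA (x s) \<noteq> posD (x s)" if "s \<in> {t1..t2}" for s using AD that t1 t2 by auto
    from value_lipschitz[OF tr sub ADt] obtain KV where KV: "KV-lipschitz_on {t1..t2} (\<lambda>s. val (x s))" by blast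
    have lm: "(2 * v)-lipschitz_on {t1..t2} (\<lambda>t. 2 * x_m (x t))"
      using lipschitz_on_cmult_real[OF x_m_lipschitz[OF asset_facts lip[THEN lipschitz_on_subset[OF _ sub]] ADt best_y_star[OF ADt]], of 2] by simp
    have "0 < c * (T - t2)" using c t2 by simp
    moreover have "c * (T - t2) \<le> 2 * x_m (x t)" if "t \<in> {t1..t2}" for t
    proof -
      have "c * (T - t2) \<le> c * (T - t)" using that c by simp
      also have "\<dots> \<le> 2 * x_m (x t)" unfolding sep' by (rule sep) (use that sub in auto)
      finally show ?thesis .
    qed
    ultimately have l1: "(1 / (c * (T - t2)) * (2 * v))-lipschitz_on {t1..t2} (\<lambda>t. ln (2 * x_m (x t)))"
      by (intro ln_comp_lipschitz lm)
    have l2: "(1 / (T - t2) * 1)-lipschitz_on {t1..t2} (\<lambda>t. ln (T - t))"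
      by (rule ln_comp_lipschitz) (use t2 in \<open>auto intro!: lipschitz_onI simp: dist_real_def\<close>)
    have l3: "1-lipschitz_on {t1..t2} (\<lambda>t::real. t)" by (rule lipschitz_on_id)
    obtain KF where KF: "KF-lipschitz_on {t1..t2} F"
      unfolding F_def
      using lipschitz_on_diff[OF lipschitz_on_add[OF lipschitz_on_diff[OF lipschitz_on_cmult_real[OF KV, of K] l1]
        lipschitz_on_cmult_real[OF l2, of "1/2"]] lipschitz_on_cmult_real[OF l3, of "v / r0"]]
      by blast
    show ?thesis
    proof (rule antimono_from_majorant[OF _ KF N])
      fix t assume t: "t \<in> {t1<..<t2} - N"
      have t': "t \<in> {0<..<T} - N" using t t1 t2 by auto
      have ADs: "posA (x t) \<noteq> posD (x t)" using ADt t by auto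
      let ?y = "y_star \<alpha> th (x t)"
      define R m \<delta> where "R = radius (x t) ?y" and "m = x_m (x t)" and "\<delta> = defect t"
      have R: "r0 \<le> R" unfolding R_def by (rule far) (use t t2 in auto)
      have m: "m > 0" unfolding m_def by (rule x_m_pos[OF ADs])
      have \<delta>: "0 \<le> \<delta>" unfolding \<delta>_def by (rule defect_nonneg[OF ADs])
      have t0: "t \<in> {0..<T}" using t' by auto
      obtain \<Delta>1 where
        \<Delta>1: "((\<lambda>s. cmod (miss \<alpha> (cis th) (x s) ?y)) has_real_derivative \<Delta>1) (at t)" "\<Delta>1 \<le> - (R / m * \<kappa> * (v * \<delta>))"
        unfolding R_def m_def \<delta>_def \<kappa>_def by (rule value_rate[OF t0 der[OF t']])
      obtain \<Delta>2 where
        \<Delta>2: "((\<lambda>s. 2 * x_m (x s)) has_real_derivative \<Delta>2) (at t)" "- \<Delta>2 \<le> v * (2 * m / R + \<epsilon> + \<delta> / (2 * \<epsilon>))"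
        unfolding R_def m_def \<delta>_def by (rule separation_rate[OF t0 der[OF t'] \<epsilon>])
      define \<phi> where "\<phi> s = K * cmod (miss \<alpha> (cis th) (x s) ?y) - ln (2 * x_m (x s)) + 1/2 * ln (T - s) - v / r0 * s" for s
      define D where "D = K * \<Delta>1 - \<Delta>2 / (2 * m) - 1/2 / (T - t) - v / r0"
      have "(\<phi> has_real_derivative D) (at t)"
      proof -
        have 1: "((\<lambda>s. ln (2 * x_m (x s))) has_real_derivative 1 / (2 * m) * \<Delta>2) (at t)"
          unfolding m_def by (rule DERIV_chain2[OF DERIV_ln_divide \<Delta>2(1)]) (use m in \<open>simp add: m_def\<close>)
        have 2: "((\<lambda>s. ln (T - s)) has_real_derivative - 1 / (T - t)) (at t)"
          using t t2 by (auto intro!: derivative_eq_intros simp: divide_inverse)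
        have "(\<phi> has_real_derivative K * \<Delta>1 - 1 / (2 * m) * \<Delta>2 + 1/2 * (- 1 / (T - t)) - v / r0 * 1) (at t)"
          unfolding \<phi>_def by (intro DERIV_add DERIV_diff DERIV_cmult 1 2 \<Delta>1(1) DERIV_ident)
        thus ?thesis unfolding D_def by simp
      qed
      moreover have "D \<le> 0"
      proof -
        have "K * \<Delta>1 \<le> K * - (R / m * \<kappa> * (v * \<delta>))" using \<Delta>1(2) K by (intro mult_left_mono) auto
        also have "\<dots> \<le> - (K * (r0 / m * \<kappa> * (v * \<delta>)))"
          using R m \<kappa> \<delta> speeds K by (simp add: mult_left_mono mult_right_mono divide_right_mono)
        also have "K * (r0 / m * \<kappa> * (v * \<delta>)) = v * \<delta> / (4 * \<epsilon> * m)"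
          using r0 \<kappa> \<epsilon> m by (simp add: K_def field_simps)
        finally have 1: "K * \<Delta>1 \<le> - (v * \<delta> / (4 * \<epsilon> * m))" .
        have "- \<Delta>2 / (2 * m) \<le> v * (2 * m / R + \<epsilon> + \<delta> / (2 * \<epsilon>)) / (2 * m)"
          using \<Delta>2(2) m by (intro divide_right_mono) auto
        also have "\<dots> = v / R + v * \<epsilon> / (2 * m) + v * \<delta> / (4 * \<epsilon> * m)"
          using m \<epsilon> R r0 by (simp add: field_simps)
        finally have 2: "- \<Delta>2 / (2 * m) \<le> v / R + v * \<epsilon> / (2 * m) + v * \<delta> / (4 * \<epsilon> * m)" .
        have 3: "v / R \<le> v / r0" using R r0 speeds by (intro divide_left_mono) auto
        have "c * (T - t) \<le> 2 * m" unfolding m_def sep' by (rule sep) (use t' in auto)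
        hence "v * \<epsilon> / (2 * m) \<le> v * \<epsilon> / (c * (T - t))"
          using c t' speeds \<epsilon> m by (intro divide_left_mono) auto
        also have "\<dots> = 1/2 / (T - t)" using c speeds t' by (simp add: \<epsilon>_def)
        finally show ?thesis unfolding D_def using 1 2 3 by linarith
      qed
      moreover have "\<forall>s\<in>{t1..t2}. F s \<le> \<phi> s"
        unfolding F_def \<phi>_def using value_le[OF ADt] K by auto
      moreover have "\<phi> t = F t" by (simp add: F_def \<phi>_def game_value_def)
      ultimately show "\<exists>\<phi> D. \<phi> t = F t \<and> (\<forall>q\<in>{t1..t2}. F q \<le> \<phi> q) \<and> (\<phi> has_real_derivative D) (at t) \<and> D \<le> 0"
        by blast
    qed (use t2 in auto)
  qed
  \<comment> \<open>By the collision the separation is at most \<open>2 * v * (T - t2)\<close>.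
    Hence \<open>F t2\<close> is at least minus one half of the logarithm of the time to go, up to a
    constant, while \<open>F\<close> does not increase.\<close>
  have bound: "- (1/2 * ln (T - t2)) \<le> F t1 + ln (2 * v) + v / r0 * T" if t2: "t1 < t2" "t2 < T" for t2
  proof -
    have "dist (posA (x t2)) (posA (x T)) \<le> v * dist t2 T" "dist (posD (x t2)) (posD (x T)) \<le> v * dist t2 T"
      using lipschitz_onD[OF lip(1), of t2 T] lipschitz_onD[OF lip(2), of t2 T] t1 t2 by auto
    hence "dist (posA (x t2)) (posD (x t2)) \<le> 2 * v * (T - t2)"
      using dist_triangle2[of "posA (x t2)" "posD (x t2)" "posA (x T)"] coll t2 by (simp add: dist_real_def)
    hence "2 * x_m (x t2) \<le> 2 * v * (T - t2)" unfolding sep' .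
    moreover have "0 < x_m (x t2)" by (rule x_m_pos[OF AD]) (use t1 t2 in auto)
    ultimately have "ln (2 * x_m (x t2)) \<le> ln (2 * v * (T - t2))" by simp
    also have "\<dots> = ln (2 * v) + ln (T - t2)" using speeds t2 by (intro ln_mult_pos) auto
    finally have 1: "ln (2 * x_m (x t2)) \<le> ln (2 * v) + ln (T - t2)" .
    have "v / r0 * t2 \<le> v / r0 * T" using t2 r0 speeds by (intro mult_left_mono) auto
    moreover have "0 \<le> K * val (x t2)" using K by (simp add: game_value_def)
    ultimately show ?thesis using mono[OF t2] 1 unfolding F_def[of t2] by linarith
  qed
  define M where "M = F t1 + ln (2 * v) + v / r0 * T"
  \<comment> \<open>Small enough for minus one half of its logarithm to be at least
    \<open>M + 1\<close>, and for \<open>T - h\<close> to come after \<open>t1\<close>.\<close>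
  define h where "h = min ((T - t1) / 2) (exp (- 2 * (M + 1)))"
  have h: "0 < h" "h < T - t1" "ln h \<le> - 2 * (M + 1)"
  proof -
    show "0 < h" "h < T - t1" using t1 by (auto simp: h_def min_less_iff_disj)
    hence "ln h \<le> ln (exp (- 2 * (M + 1)))" by (subst ln_le_cancel_iff) (auto simp: h_def)
    thus "ln h \<le> - 2 * (M + 1)" by simp
  qed
  have "- (1/2 * ln (T - (T - h))) \<le> M" unfolding M_def by (rule bound) (use h in auto)
  thus False using h(3) by simp
qed

end

text \<open>If the payoff exceeded the value, then shortly before the end the distance from attacker
  to asset would exceed the value by a fixed amount. This distance is at most the value plus 1 +
  \<alpha> times the radius, so the aim point would stay away from the attacker, contrary to
  \<open>aim_not_bounded_away\<close>.\<close>

lemma attacker_guarantee: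
  assumes pl: "play vB v v th chi psi z0 x tf" and AD: "posA z0 \<noteq> posD z0"
    and reg: "regular_interception (defender_region vB v v th) x tf"
  shows "payoff (x tf) \<le> val z0"
proof (rule ccontr)
  assume less: "\<not> payoff (x tf) \<le> val z0"
  have tf: "0 \<le> tf" and tr: "trajectory vB v v th (\<lambda>t. chi (x t)) (\<lambda>t. psi (x t)) z0 x {0..tf}"
    using pl by (auto simp: play_def)
  from reg obtain c where coll: "posA (x tf) = posD (x tf)" and inR: "\<And>t. t \<in> {0..<tf} \<Longrightarrow> x t \<in> defender_region vB v v th"
    and c: "0 < c" "\<And>t. t \<in> {0..tf} \<Longrightarrow> c * (tf - t) \<le> dist (posA (x t)) (posD (x t))"
    unfolding regular_interception_def by blast
  have ADt: "posA (x t) \<noteq> posD (x t)" and g: "guarded \<alpha> (cis th) (x t)" if "t \<in> {0..<tf}" for t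
    using inR[OF that] defender_region_guarded by (auto simp: defender_region_def)
  have tf0: "0 < tf" using tf coll AD trajectory_start[OF tr tf] by (cases "tf = 0") auto
  define \<eta> where "\<eta> = (payoff (x tf) - val z0) / 2"
  have \<eta>: "\<eta> > 0" using less by (simp add: \<eta>_def)
  note lip = speed_lipschitz[OF tr]
  \<comment> \<open>From \<open>t1\<close> on, attacker and asset each move by at most half of
    \<eta>, so that one \<eta> of the excess is left.\<close>
  define t1 where "t1 = max 0 (tf - \<eta> / (2 * v))"
  have t1: "0 \<le> t1" "t1 < tf" using tf0 \<eta> speeds by (auto simp: t1_def)
  have far: "\<eta> / (1 + \<alpha>) \<le> radius (x t) (y_star \<alpha> th (x t))" if t: "t \<in> {t1..<tf}" for t
  proof -
    have t0: "t \<in> {0..<tf}" using t t1 by auto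
    let ?y = "y_star \<alpha> th (x t)"
    have "dist (posA (x t)) (posA (x tf)) \<le> v * (tf - t)" "dist (posB (x t)) (posB (x tf)) \<le> v * (tf - t)"
      using lipschitz_onD[OF lip(1), of t tf] lipschitz_onD[OF lip(3), of t tf] t0 by (auto simp: dist_real_def)
    moreover have "payoff (x tf) \<le> dist (posA (x t)) (posA (x tf)) + dist (posA (x t)) (posB (x t)) + dist (posB (x t)) (posB (x tf))"
      unfolding payoff_def using dist_triangle[of "posA (x tf)" "posB (x tf)" "posA (x t)"] dist_triangle[of "posA (x t)" "posB (x tf)" "posB (x t)"]
      by (simp add: dist_commute)
    moreover have "v * (tf - t) \<le> \<eta> / 2"
    proof -
      have "tf - t \<le> \<eta> / (2 * v)" using t by (auto simp: t1_def)
      thus ?thesis using speeds by (simp add: field_simps)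
    qed
    moreover have "payoff (x tf) = val z0 + 2 * \<eta>" by (simp add: \<eta>_def field_simps)
    ultimately have 1: "val z0 + \<eta> \<le> dist (posA (x t)) (posB (x t))" by linarith
    have 2: "val (x t) \<le> val z0" by (rule attacker_value_antimono[OF tr ADt g t0])
    have "posA (x t) - posB (x t) = miss \<alpha> (cis th) (x t) ?y - (aim (x t) ?y - posA (x t)) + of_real (\<alpha> * radius (x t) ?y) * cis th"
      by (simp add: miss_def)
    hence "dist (posA (x t)) (posB (x t)) \<le> val (x t) + cmod (aim (x t) ?y - posA (x t)) + cmod (of_real (\<alpha> * radius (x t) ?y) * cis th)"
      unfolding dist_norm game_value_def by (smt (verit) norm_triangle_ineq norm_triangle_ineq4)
    also have "cmod (aim (x t) ?y - posA (x t)) = radius (x t) ?y" by (rule aim_dist(1)[OF ADt[OF t0]])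
    also have "cmod (of_real (\<alpha> * radius (x t) ?y) * cis th) = \<alpha> * radius (x t) ?y"
      unfolding norm_mult norm_of_real norm_cis using alpha_bounds(1) by (simp add: radius_def)
    finally have "\<eta> \<le> (1 + \<alpha>) * radius (x t) ?y" using 1 2 by (simp add: algebra_simps)
    thus ?thesis using alpha_bounds(1) by (simp add: pos_divide_le_eq mult.commute)
  qed
  show False
    by (rule aim_not_bounded_away[OF tr ADt g c(1) c(2) coll t1 _ far]) (use \<eta> alpha_bounds in auto)
qed

end

section \<open>Optimal play\<close>

context
  fixes z :: state and y :: real
  assumes AD: "posA z \<noteq> posD z" and g: "guarded \<alpha> (cis th) z" and recede: "Re (relu (cis th) z) < 0"
    and y: "best \<alpha> (cis th) z y"
begin

text \<open>The candidate for the equilibrium play, defined without the feedback laws;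
  \<open>homing_y_star\<close> is what shows that the laws generate it.\<close>

definition homing :: "real \<Rightarrow> state" where
  "homing = straight (of_real vB * cis th) (of_real (v / radius z y) * (aim z y - posA z))
     (of_real (v / radius z y) * (aim z y - posD z)) z"

definition arrival :: real where "arrival = radius z y / v"

text \<open>The fraction of the way still to be flown. The triangle of the aim point and the
  missiles shrinks towards the aim point by this factor.\<close>

definition remaining :: "real \<Rightarrow> real" where "remaining t = 1 - t / arrival"

lemma radius_z_pos: "0 < radius z y"
  using x_m_pos[OF AD] unfolding radius_def by (simp add: add_pos_nonneg)

lemma arrival_pos: "0 < arrival"
  using radius_z_pos speeds by (simp add: arrival_def)

lemma remaining_pos: "t \<in> {0..<arrival} \<Longrightarrow> 0 < remaining t"
  using arrival_pos by (simp add: remaining_def)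

lemma t_remaining: "v * t = (1 - remaining t) * radius z y"
  using radius_z_pos speeds by (simp add: remaining_def arrival_def)

lemma homing_AD:
  "aim z y - posA (homing t) = of_real (remaining t) * (aim z y - posA z)"
  "aim z y - posD (homing t) = of_real (remaining t) * (aim z y - posD z)"
proof -
  have "t * (v / radius z y) = 1 - remaining t" using t_remaining[of t] radius_z_pos by (simp add: field_simps)
  hence e: "of_real t * (of_real (v / radius z y) * X) = X - of_real (remaining t) * X" for X :: complex
  proof -
    have "of_real t * (of_real (v / radius z y) * X) = of_real (t * (v / radius z y)) * X"
      by (simp only: of_real_mult mult.assoc)
    also have "\<dots> = of_real (1 - remaining t) * X" unfolding \<open>t * (v / radius z y) = 1 - remaining t\<close> ..
    finally show ?thesis by (simp add: algebra_simps)
  qed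
  show "aim z y - posA (homing t) = of_real (remaining t) * (aim z y - posA z)"
    "aim z y - posD (homing t) = of_real (remaining t) * (aim z y - posD z)"
    unfolding homing_def pos_straight e by (simp_all add: algebra_simps)
qed

lemma homing_B: "posB (homing t) = posB z + of_real (\<alpha> * (v * t)) * cis th"
proof -
  have "of_real t * (of_real vB * cis th) = of_real (\<alpha> * (v * t)) * cis th"
    unfolding alpha_bounds(3)[symmetric] by simp
  thus ?thesis unfolding homing_def pos_straight by (simp only:)
qed

lemma homing_separation: "posA (homing t) - posD (homing t) = of_real (remaining t) * (posA z - posD z)"
proof -
  have "posA (homing t) - posD (homing t) = (aim z y - posD (homing t)) - (aim z y - posA (homing t))" by simp
  thus ?thesis unfolding homing_AD by (simp add: algebra_simps)
qed

context
  fixes t :: real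
  assumes t: "t \<in> {0..<arrival}"
begin

lemma homing_AD_ne: "posA (homing t) \<noteq> posD (homing t)"
  using homing_separation[of t] remaining_pos[OF t] AD by (metis eq_iff_diff_eq_0 less_irrefl mult_eq_0_iff of_real_eq_0_iff)

lemma homing_sgn: "sgn (posA (homing t) - posD (homing t)) = sgn (posA z - posD z)"
  unfolding homing_separation using remaining_pos[OF t] by (simp add: sgn_mult sgn_of_real)

lemma homing_x_m: "x_m (homing t) = remaining t * x_m z"
  unfolding x_m_def xA'_def homing_separation using remaining_pos[OF t] by (simp add: norm_mult)

lemma homing_relu: "relu u (homing t) = relu u z"
  by (simp add: relu_def homing_sgn)

text \<open>The bisector stays the same line, but its origin, the midpoint of the missiles, slides
  along it towards the aim point. So the parameter is merely shifted.\<close>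

lemma homing_aim: "aim (homing t) y' = aim z (y + (y' - remaining t * y))"
proof -
  define n where "n = sgn (posA z - posD z)"
  have P: "aim z y = posA z + n * Complex (- x_m z) y" using aim_rel(1)[of z y] by (simp add: n_def algebra_simps)
  have "aim (homing t) y' = posA (homing t) + n * Complex (- (remaining t * x_m z)) y'"
    using aim_rel(1)[of "homing t" y'] unfolding homing_sgn homing_x_m n_def[symmetric] by (simp add: algebra_simps)
  also have "posA (homing t) = aim z y - of_real (remaining t) * (aim z y - posA z)"
    using homing_AD(1)[of t] by (simp add: algebra_simps)
  also have "aim z y - posA z = n * Complex (- x_m z) y" using aim_rel(1)[of z y] by (simp add: n_def)
  finally have "aim (homing t) y' = aim z y + n * (Complex (- (remaining t * x_m z)) y' - of_real (remaining t) * Complex (- x_m z) y)"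
    by (simp add: algebra_simps)
  also have "Complex (- (remaining t * x_m z)) y' - of_real (remaining t) * Complex (- x_m z) y = \<i> * of_real (y' - remaining t * y)"
    by (simp add: complex_eq_iff)
  finally have "aim (homing t) y' = aim z y + \<i> * of_real (y' - remaining t * y) * n" by (simp add: mult.commute)
  thus ?thesis unfolding aim_def n_def by (simp add: algebra_simps)
qed

lemma homing_radius: "radius (homing t) (remaining t * y) = remaining t * radius z y"
proof -
  have "(remaining t * x_m z)\<^sup>2 + (remaining t * y)\<^sup>2 = (remaining t)\<^sup>2 * ((x_m z)\<^sup>2 + y\<^sup>2)"
    by (simp add: power_mult_distrib distrib_left)
  thus ?thesis unfolding radius_def homing_x_m using remaining_pos[OF t] by (simp add: real_sqrt_mult)
qed

text \<open>Other points of the fixed bisector are reached only later than from the initial state.\<close>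

lemma homing_best: "best \<alpha> (cis th) (homing t) (remaining t * y)"
  unfolding best_def
proof
  fix y'
  define y'' where "y'' = y + (y' - remaining t * y)"
  \<comment> \<open>The attacker's extra flight length to this point by way of its current position;
    it is nonnegative by the triangle inequality.\<close>
  define e where "e = v * t + radius (homing t) y' - radius z y''"
  have "radius z y'' = cmod (aim z y'' - posA z)" using aim_dist(1)[OF AD] by simp
  also have "aim z y'' - posA z = (aim (homing t) y' - posA (homing t)) + of_real (1 - remaining t) * (aim z y - posA z)"
    unfolding homing_aim y''_def[symmetric] using homing_AD(1)[of t] by (simp add: algebra_simps)
  also have "cmod \<dots> \<le> cmod (aim (homing t) y' - posA (homing t)) + cmod (of_real (1 - remaining t) * (aim z y - posA z))"
    by (rule norm_triangle_ineq)
  also have "cmod (aim (homing t) y' - posA (homing t)) = radius (homing t) y'" by (rule aim_dist(1)[OF homing_AD_ne])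
  also have "cmod (of_real (1 - remaining t) * (aim z y - posA z)) = v * t"
  proof -
    have "0 \<le> 1 - remaining t" using t arrival_pos by (simp add: remaining_def)
    thus ?thesis unfolding norm_mult norm_of_real aim_dist(1)[OF AD] t_remaining by simp
  qed
  finally have e: "0 \<le> \<alpha> * e" using alpha_bounds(1) by (simp add: e_def)
  have "miss \<alpha> (cis th) (homing t) y' = miss \<alpha> (cis th) z y'' - of_real (\<alpha> * e) * cis th"
    unfolding miss_def homing_aim homing_B y''_def[symmetric] e_def by (simp add: algebra_simps)
  hence ge: "cmod (miss \<alpha> (cis th) z y) \<le> cmod (miss \<alpha> (cis th) (homing t) y')"
    using best_le_delayed[OF asset_facts AD g recede y e] by simp
  have "miss \<alpha> (cis th) (homing t) (remaining t * y) = aim z y - posB z - of_real (\<alpha> * (v * t + remaining t * radius z y)) * cis th"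
    unfolding miss_def homing_aim homing_B homing_radius by (simp add: algebra_simps)
  also have "v * t + remaining t * radius z y = radius z y" unfolding t_remaining by (simp add: algebra_simps)
  finally have "miss \<alpha> (cis th) (homing t) (remaining t * y) = miss \<alpha> (cis th) z y" by (simp add: miss_def)
  thus "cmod (miss \<alpha> (cis th) (homing t) (remaining t * y)) \<le> cmod (miss \<alpha> (cis th) (homing t) y')" using ge by simp
qed

text \<open>The capture point only moves further along the path of the asset, away from the bisector.\<close>

lemma homing_guarded: "guarded \<alpha> (cis th) (homing t)"
proof -
  define \<rho> \<rho>' where "\<rho> = capture_distance \<alpha> (cis th) z" and "\<rho>' = capture_distance \<alpha> (cis th) (homing t)"
  note cd = capture_distance[OF asset_facts]
  \<comment> \<open>The attacker has flown \<open>v * t\<close>, so the old capture point is at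
    least the rest of \<rho> away, and it is the point the asset reaches after the corresponding
    rest of its way.\<close>
  have "\<rho> - v * t \<le> cmod (posB z + of_real (\<alpha> * \<rho>) * cis th - posA z) - cmod (posA (homing t) - posA z)"
  proof -
    have "posA (homing t) - posA z = of_real (1 - remaining t) * (aim z y - posA z)"
      using homing_AD(1)[of t] by (simp add: algebra_simps)
    moreover have "0 \<le> 1 - remaining t" using t arrival_pos by (simp add: remaining_def)
    ultimately have "cmod (posA (homing t) - posA z) = v * t"
      unfolding t_remaining by (simp only: norm_mult norm_of_real aim_dist(1)[OF AD] abs_of_nonneg)
    thus ?thesis using cd(1)[of z th] by (simp add: \<rho>_def)
  qed
  also have "\<dots> \<le> cmod (posB z + of_real (\<alpha> * \<rho>) * cis th - posA (homing t))"
    using norm_triangle_ineq2[of "posB z + of_real (\<alpha> * \<rho>) * cis th - posA z" "posA (homing t) - posA z"]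
    by (simp only: diff_diff_eq2 diff_add_cancel)
  also have "posB z + of_real (\<alpha> * \<rho>) * cis th = posB (homing t) + of_real (\<alpha> * (\<rho> - v * t)) * cis th"
    unfolding homing_B by (simp add: algebra_simps)
  finally have le: "\<rho> - v * t \<le> \<rho>'"
    unfolding \<rho>'_def by (rule capture_distance_ge[OF asset_facts])
  have "Re (relB z) + \<alpha> * \<rho> * Re (relu (cis th) z) < 0"
    using g unfolding guarded_iff[OF asset_facts]
    using closer_to_D_iff(1)[OF asset_facts AD, of \<rho> th] cd(1)[of z th] by (simp add: capture_point_def \<rho>_def)
  moreover have "\<alpha> * (v * t + \<rho>') * Re (relu (cis th) z) \<le> \<alpha> * \<rho> * Re (relu (cis th) z)"
    using le recede alpha_bounds(1) by (intro mult_right_mono_neg mult_left_mono) auto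
  \<comment> \<open>The midpoint moves only along the bisector, so the abscissa of the asset changes
    by the asset's own motion alone.\<close>
  moreover have "Re (relB (homing t)) = Re (relB z) + \<alpha> * (v * t) * Re (relu (cis th) z)"
  proof -
    define n where "n = sgn (posA z - posD z)"
    have nn: "cnj n * n = 1" unfolding n_def using cnj_mult_unit[OF sgn_unit] AD by simp
    have M: "(posA z' + posD z') / 2 = aim z' 0" for z' by (simp add: aim_def)
    have "relB (homing t) = cnj n * (posB (homing t) - aim (homing t) 0)"
      unfolding relB_def homing_sgn n_def M ..
    also have "\<dots> = cnj n * (posB (homing t) - aim z 0) - cnj n * (aim (homing t) 0 - aim z 0)" by (simp add: algebra_simps)
    also have "aim (homing t) 0 - aim z 0 = \<i> * of_real (y - remaining t * y) * n"
      unfolding homing_aim by (simp add: aim_def n_def)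
    also have "cnj n * (\<i> * of_real (y - remaining t * y) * n) = \<i> * of_real (y - remaining t * y) * (cnj n * n)" by simp
    also have "cnj n * (posB (homing t) - aim z 0) = relB z + of_real (\<alpha> * (v * t)) * relu (cis th) z"
      unfolding homing_B relB_def relu_def n_def M by (simp add: algebra_simps)
    finally show ?thesis unfolding nn by simp
  qed
  ultimately have "Re (relB (homing t)) + \<alpha> * \<rho>' * Re (relu (cis th) (homing t)) < 0"
    unfolding homing_relu by (simp add: algebra_simps)
  hence "cmod (posB (homing t) + of_real (\<alpha> * \<rho>') * cis th - posD (homing t)) < \<rho>'"
    using closer_to_D_iff(1)[OF asset_facts homing_AD_ne, of \<rho>' th] cd(1)[of "homing t" th] by (simp add: \<rho>'_def)
  thus ?thesis unfolding guarded_iff[OF asset_facts] capture_point_def \<rho>'_def .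
qed

text \<open>The feedback laws use whichever minimizer the choice operator returns at the current
  state. Uniqueness guarantees that it is always the point aimed at from the start.\<close>

lemma homing_y_star: "y_star \<alpha> th (homing t) = remaining t * y"
  by (rule best_unique[OF asset_facts homing_AD_ne homing_guarded _ _ homing_best])
    (use recede homing_relu best_y_star[OF homing_AD_ne] in auto)

end

lemma homing_play:
  assumes attacker: "\<And>z. posA z \<noteq> posD z \<Longrightarrow>
      of_real v * cis (chi z) = of_real (v / radius z (y_star \<alpha> th z)) * (aim z (y_star \<alpha> th z) - posA z)"
    and defender: "\<And>z. posA z \<noteq> posD z \<Longrightarrow>
      of_real v * cis (psi z) = of_real (v / radius z (y_star \<alpha> th z)) * (aim z (y_star \<alpha> th z) - posD z)"
  shows "play vB v v th chi psi z homing arrival"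
    and "regular_interception (defender_region vB v v th) homing arrival"
    and "payoff (homing arrival) = cmod (miss \<alpha> (cis th) z y)"
proof -
  have end0: "remaining arrival = 0" using arrival_pos by (simp add: remaining_def)
  have A: "posA (homing arrival) = aim z y" and D: "posD (homing arrival) = aim z y"
    using homing_AD[of arrival] unfolding end0 by simp_all
  have "velocity vB v v th (chi (homing s)) (psi (homing s)) =
     (of_real vB * cis th, of_real (v / radius z y) * (aim z y - posA z), of_real (v / radius z y) * (aim z y - posD z))"
    if s: "s \<in> {0..<arrival}" for s
  proof -
    have ne: "posA (homing s) \<noteq> posD (homing s)" by (rule homing_AD_ne[OF s])
    have rem: "remaining s > 0" by (rule remaining_pos[OF s])
    have P: "aim (homing s) (remaining s * y) = aim z y" unfolding homing_aim[OF s] by simp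
    have "v / (remaining s * radius z y) * remaining s = v / radius z y" using rem by simp
    hence e: "of_real (v / (remaining s * radius z y)) * (of_real (remaining s) * X) = of_real (v / radius z y) * X" for X :: complex
      by (metis mult.assoc of_real_mult)
    show ?thesis
      using attacker[OF ne] defender[OF ne]
      unfolding velocity_def homing_y_star[OF s] homing_radius[OF s] P homing_AD e by simp
  qed
  hence tr: "trajectory vB v v th (\<lambda>t. chi (homing t)) (\<lambda>t. psi (homing t)) z homing {0..arrival}"
    unfolding homing_def by (rule straight_trajectory)
  show "play vB v v th chi psi z homing arrival"
    unfolding play_def
  proof (intro conjI ballI)
    fix t assume t: "t \<in> {0..<arrival}"
    have "posA (homing t) \<noteq> posB (homing t)"
      using not_guarded_at_capture[OF asset_facts] homing_guarded[OF t] by blast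
    thus "\<not> terminal (homing t)" using homing_AD_ne[OF t] by (simp add: terminal_def)
  qed (use tr arrival_pos A D in \<open>simp_all add: terminal_def\<close>)
  show "regular_interception (defender_region vB v v th) homing arrival"
    unfolding regular_interception_def
  proof (intro conjI ballI exI)
    fix t assume t: "t \<in> {0..<arrival}"
    show "homing t \<in> defender_region vB v v th"
      by (rule guarded_defender_region[OF homing_AD_ne[OF t] homing_guarded[OF t]])
        (use recede homing_relu[OF t] in simp)
  next
    \<comment> \<open>The collision rate is the closing speed, since the separation decreases
      linearly to 0.\<close>
    show "0 < cmod (posA z - posD z) / arrival" using AD arrival_pos by simp
    fix t assume t: "t \<in> {0..arrival}"
    hence "0 \<le> remaining t" using arrival_pos by (simp add: remaining_def)
    moreover have "remaining t = (arrival - t) / arrival" using arrival_pos by (simp add: remaining_def field_simps)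
    moreover have "dist (posA (homing t)) (posD (homing t)) = \<bar>remaining t\<bar> * cmod (posA z - posD z)"
      unfolding dist_norm homing_separation norm_mult norm_of_real ..
    ultimately have "dist (posA (homing t)) (posD (homing t)) = (arrival - t) / arrival * cmod (posA z - posD z)"
      by (metis abs_of_nonneg)
    thus "cmod (posA z - posD z) / arrival * (arrival - t) \<le> dist (posA (homing t)) (posD (homing t))"
      by (simp add: mult.commute)
  qed (use A D in simp)
  have "v * arrival = radius z y" using speeds by (simp add: arrival_def)
  thus "payoff (homing arrival) = cmod (miss \<alpha> (cis th) z y)"
    unfolding payoff_def dist_norm A homing_B by (simp add: miss_def algebra_simps)
qed

end

end

text \<open>The laws fix the headings only where the missiles are apart, so the statement is about
  every pair of feedbacks that obeys them there. The unique minimizer is part of the conclusion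
  because the laws speak of the minimizing solution. The integer k expresses that headings count
  modulo 2 pi, and a nonnegative discriminant makes the two ordinates that bound the range
  genuine.\<close>

theorem theorem5:
  fixes vB vA vD \<theta>B \<alpha> :: real and z0 :: state and chi psi :: "state \<Rightarrow> real"
  assumes speeds: "0 < vB" "0 < vA" "vA = vD"
    and alpha: "\<alpha> = vB / vA" "\<alpha> < 1"
    and feedback: "chi \<in> feedback" "psi \<in> feedback"
    and attacker_law: "\<And>z. posA z \<noteq> posD z \<Longrightarrow>
      cos (chi z - lam_A z) = (x_m z - xA' z) / sqrt ((x_m z - xA' z)^2 + (y_star \<alpha> \<theta>B z)^2) \<and>
      sin (chi z - lam_A z) = y_star \<alpha> \<theta>B z / sqrt ((x_m z - xA' z)^2 + (y_star \<alpha> \<theta>B z)^2)"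
    and defender_law: "\<And>z. posA z \<noteq> posD z \<Longrightarrow>
      cos (psi z - lam_A z) = x_m z / sqrt ((x_m z)^2 + (y_star \<alpha> \<theta>B z)^2) \<and>
      sin (psi z - lam_A z) = y_star \<alpha> \<theta>B z / sqrt ((x_m z)^2 + (y_star \<alpha> \<theta>B z)^2)"
    and region: "z0 \<in> defender_region vB vA vD \<theta>B"
    and real_range: "0 \<le> S_disc \<alpha> z0"
    and heading_range: "\<exists>k::int.
      \<theta>B + 2 * pi * of_int k \<in> {theta_under \<alpha> z0 + lam_A z0 .. theta_over \<alpha> z0 + lam_A z0}"
  shows "(\<exists>!y. is_arg_min (cost_J \<alpha> \<theta>B z0) (quartic_root \<alpha> \<theta>B z0) y) \<and>
    saddle_point vB vA vD \<theta>B chi psi z0"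
proof -
  note sp = speeds(1,2) and vD = speeds(3)[symmetric]
  note ab = alpha_bounds[OF sp alpha]
  have AD: "posA z0 \<noteq> posD z0" using region by (simp add: defender_region_def)
  have g: "guarded \<alpha> (cis \<theta>B) z0" by (rule defender_region_guarded[OF sp alpha region[unfolded vD]])
  from heading_range obtain k :: int where
    k: "\<theta>B + 2 * pi * of_int k \<in> {theta_under \<alpha> z0 + lam_A z0 .. theta_over \<alpha> z0 + lam_A z0}" ..
  have recede: "Re (relu (cis \<theta>B) z0) < 0" by (rule heading_range_recedes[OF ab(1,2) AD g real_range k])
  let ?y = "y_star \<alpha> \<theta>B z0"
  have best: "best \<alpha> (cis \<theta>B) z0 ?y" by (rule best_y_star[OF sp alpha AD])
  have "\<exists>!y. is_arg_min (cost_J \<alpha> \<theta>B z0) (quartic_root \<alpha> \<theta>B z0) y"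
    unfolding arg_min_iff_best[OF ab(1,2) AD]
    using best best_unique[OF ab(1,2) norm_cis AD g recede] by blast
  moreover have "saddle_point vB vA vD \<theta>B chi psi z0"
    unfolding saddle_point_def vD
  proof (intro conjI feedback exI ballI allI impI)
    note hp = homing_play[OF sp alpha AD g recede best
      attacker_velocity[OF sp alpha attacker_law] defender_velocity[OF sp alpha defender_law]]
    show "play vB vA vA \<theta>B chi psi z0 (homing vB vA \<theta>B z0 ?y) (arrival vA z0 ?y)" by (rule hp(1))
    show "regular_interception (defender_region vB vA vA \<theta>B) (homing vB vA \<theta>B z0 ?y) (arrival vA z0 ?y)" by (rule hp(2))
    have val: "payoff (homing vB vA \<theta>B z0 ?y (arrival vA z0 ?y)) = game_value \<alpha> \<theta>B z0"
      unfolding game_value_def by (rule hp(3))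
    show "payoff (homing vB vA \<theta>B z0 ?y (arrival vA z0 ?y)) \<le> payoff (x' tf')"
      if "chi' \<in> feedback" "play vB vA vA \<theta>B chi' psi z0 x' tf'" for chi' x' tf'
      unfolding val by (rule defender_guarantee[OF sp alpha defender_law that(2) AD g])
    show "payoff (x' tf') \<le> payoff (homing vB vA \<theta>B z0 ?y (arrival vA z0 ?y))"
      if "psi' \<in> feedback" "play vB vA vA \<theta>B chi psi' z0 x' tf'"
        "regular_interception (defender_region vB vA vA \<theta>B) x' tf'" for psi' x' tf'
      unfolding val by (rule attacker_guarantee[OF sp alpha attacker_law that(2) AD that(3)])
  qed
  ultimately show ?thesis ..
qed

end
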